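(* Let $1\le p<\infty$ and $0<s<1$. If $\Omega\subset\mathbb{R}^2$ is a (bounded) simply connected uniform domain, then $$(L^p(\Omega), W^{1,p}(\Omega))_{s,p}=\widetilde W^{s,p}(\Omega).$$
   Context: A domain is a nonempty connected open set. For a bounded domain $\Omega\subset\mathbb{R}^n$ (here $n=2$), $d(x)$ denotes the distance from $x\in\Omega$ to $\partial\Omega$. The space $\widetilde W^{s,p}(\Omega)$ is the set of $f\in L^p(\Omega)$ such that $$|f|_{\widetilde W^{s,p}(\Omega)} = \Big( \int_\Omega \int_{|x-y|<\frac{d(x)}{2}} \frac{|f(x)-f(y)|^p}{|x-y|^{n+sp}}\,dy\,dx \Big)^{1/p}<\infty .$$ The real interpolation space $(L^p(\Omega), W^{1,p}(\Omega))_{s,p}$ is the set of $f\in L^p(\Omega)+W^{1,p}(\Omega)$ such that $$|f|_{(L^p(\Omega), W^{1,p}(\Omega))_{s,p}} = \Big\{ \int_0^\infty \big(\ell^{-s}K(\ell,f)\big)^p\,\frac{d\ell}{\ell}\Big\}^{1/p}<\infty,$$ where $K(\ell,f)=\inf\{\|g\|_{L^p(\Omega)}+\ell\|h\|_{W^{1,p}(\Omega)} : f=g+h,\ g\in L^p(\Omega),\ h\in W^{1,p}(\Omega)\}$. Uniform domain: a bounded domain $\Omega\subset\mathbb{R}^n$ is uniform if there exist constants $a$ and $b$ such that each pair $x,y\in\Omega$ can be joined by an arc $\gamma$ in $\Omega$ with (1) $l(\gamma)\le a|x-y|$, and (2) $\min_{j=1,2} l(\gamma_j)\le b\,d(z)$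 for all $z\in\gamma$, where $\gamma_1,\gamma_2$ are the components of $\gamma\setminus\{z\}$ and $l$ denotes length. *)

theory Defs
  imports "HOL-Analysis.Analysis"
begin

definition path_length :: "(real \<Rightarrow> 'a::metric_space) \<Rightarrow> ennreal" where
  "path_length g =
     (SUP (n, t) \<in> {(n, t). mono t \<and> range t \<subseteq> {0..1}}.
        ennreal (\<Sum>i<(n::nat). dist (g (t i)) (g (t (Suc i)))))"

definition bounded_domain :: "'a::euclidean_space set \<Rightarrow> bool" where
  "bounded_domain \<Omega> \<longleftrightarrow> \<Omega> \<noteq> {} \<and> open \<Omega> \<and> connected \<Omega> \<and> bounded \<Omega>"

definition bdist :: "'a::euclidean_space set \<Rightarrow> 'a \<Rightarrow> real" where
  "bdist \<Omega> x = infdist x (frontier \<Omega>)"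

text \<open>
  Removing the point \<open>\<gamma> u\<close> from the arc \<open>\<gamma>\<close> leaves \<open>\<gamma> ` {0..<u}\<close> and \<open>\<gamma> ` {u<..1}\<close>, whose
  lengths are those of the closed subarcs used below; at an endpoint one of the two pieces is
  empty and has length \<open>0\<close>. An \<^const>\<open>arc\<close> is injective, so the two points have to be
  distinct; for coinciding points the condition holds trivially (degenerate arc of length \<open>0\<close>).
\<close>

definition uniform_domain :: "'a::euclidean_space set \<Rightarrow> bool" where
  "uniform_domain \<Omega> \<longleftrightarrow> bounded_domain \<Omega> \<and>
     (\<exists>a b :: real. \<forall>x\<in>\<Omega>. \<forall>y\<in>\<Omega>. x \<noteq> y \<longrightarrow>
        (\<exists>\<gamma>. arc \<gamma> \<and> path_image \<gamma> \<subseteq> \<Omega> \<and> pathstart \<gamma> = x \<and> pathfinish \<gamma> = y \<and>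
           path_length \<gamma> \<le> ennreal (a * dist x y) \<and>
           (\<forall>u\<in>{0..1}.
              min (path_length (subpath 0 u \<gamma>)) (path_length (subpath u 1 \<gamma>))
                \<le> ennreal (b * bdist \<Omega> (\<gamma> u)))))"

text \<open>
  Elements of function spaces over \<open>\<Omega>\<close> are represented by total real-valued functions, of which
  only the values on \<open>\<Omega>\<close> matter. Functions are not identified when they agree almost everywhere
  on \<open>\<Omega>\<close>; instead, all spaces below are closed under such changes.
\<close>

definition Lp_space :: "real \<Rightarrow> 'a::euclidean_space set \<Rightarrow> ('a \<Rightarrow> real) set" where
  "Lp_space p \<Omega> =
     {f. f \<in> borel_measurable (lebesgue_on \<Omega>) \<and>
         integrable (lebesgue_on \<Omega>) (\<lambda>x. \<bar>f x\<bar> powr p)}"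

definition Lp_norm :: "real \<Rightarrow> 'a::euclidean_space set \<Rightarrow> ('a \<Rightarrow> real) \<Rightarrow> real" where
  "Lp_norm p \<Omega> f = (\<integral>x. \<bar>f x\<bar> powr p \<partial>lebesgue_on \<Omega>) powr (1 / p)"

primrec Ck :: "nat \<Rightarrow> ('a::euclidean_space \<Rightarrow> real) \<Rightarrow> bool" where
  "Ck 0 f \<longleftrightarrow> continuous_on UNIV f"
| "Ck (Suc k) f \<longleftrightarrow> (\<forall>x. f differentiable at x) \<and>
     (\<forall>v. Ck k (\<lambda>x. frechet_derivative f (at x) v))"

definition test_function :: "'a::euclidean_space set \<Rightarrow> ('a \<Rightarrow> real) \<Rightarrow> bool" where
  "test_function \<Omega> \<phi> \<longleftrightarrow> (\<forall>k. Ck k \<phi>) \<and>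
     compact (closure {x. \<phi> x \<noteq> 0}) \<and> closure {x. \<phi> x \<noteq> 0} \<subseteq> \<Omega>"

definition locally_integrable :: "'a::euclidean_space set \<Rightarrow> ('a \<Rightarrow> real) \<Rightarrow> bool" where
  "locally_integrable \<Omega> f \<longleftrightarrow> (\<forall>C. compact C \<and> C \<subseteq> \<Omega> \<longrightarrow> integrable (lebesgue_on C) f)"

definition is_weak_partial ::
  "'a::euclidean_space set \<Rightarrow> 'a \<Rightarrow> ('a \<Rightarrow> real) \<Rightarrow> ('a \<Rightarrow> real) \<Rightarrow> bool" where
  "is_weak_partial \<Omega> i f g \<longleftrightarrow> locally_integrable \<Omega> f \<and> locally_integrable \<Omega> g \<and>
     (\<forall>\<phi>. test_function \<Omega> \<phi> \<longrightarrow>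
        (\<integral>x. f x * frechet_derivative \<phi> (at x) i \<partial>lebesgue_on \<Omega>) =
        - (\<integral>x. g x * \<phi> x \<partial>lebesgue_on \<Omega>))"

text \<open>On an open set the weak derivative is unique up to a null set, so the choice is harmless.\<close>

definition weak_partial ::
  "'a::euclidean_space set \<Rightarrow> 'a \<Rightarrow> ('a \<Rightarrow> real) \<Rightarrow> ('a \<Rightarrow> real)" where
  "weak_partial \<Omega> i f = (SOME g. is_weak_partial \<Omega> i f g)"

definition W1p_space :: "real \<Rightarrow> 'a::euclidean_space set \<Rightarrow> ('a \<Rightarrow> real) set" where
  "W1p_space p \<Omega> =
     {f \<in> Lp_space p \<Omega>. \<forall>i\<in>Basis. \<exists>g\<in>Lp_space p \<Omega>. is_weak_partial \<Omega> i f g}"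

definition W1p_norm :: "real \<Rightarrow> 'a::euclidean_space set \<Rightarrow> ('a \<Rightarrow> real) \<Rightarrow> real" where
  "W1p_norm p \<Omega> f =
     (Lp_norm p \<Omega> f powr p + (\<Sum>i\<in>Basis. Lp_norm p \<Omega> (weak_partial \<Omega> i f) powr p)) powr (1 / p)"

definition ennreal_powr :: "ennreal \<Rightarrow> real \<Rightarrow> ennreal" where
  "ennreal_powr x r = (if x = \<infinity> then \<infinity> else ennreal (enn2real x powr r))"

text \<open>For \<open>x \<in> \<Omega>\<close> the inner domain of integration is automatically contained in \<open>\<Omega>\<close>.\<close>

definition restricted_seminorm ::
  "real \<Rightarrow> real \<Rightarrow> 'a::euclidean_space set \<Rightarrow> ('a \<Rightarrow> real) \<Rightarrow> ennreal" where
  "restricted_seminorm s p \<Omega> f =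
     ennreal_powr
       (\<integral>\<^sup>+x\<in>\<Omega>. (\<integral>\<^sup>+y\<in>{y. norm (x - y) < bdist \<Omega> x / 2}.
            ennreal (\<bar>f x - f y\<bar> powr p / norm (x - y) powr (real DIM('a) + s * p))
          \<partial>lebesgue) \<partial>lebesgue) (1 / p)"

definition restricted_space :: "real \<Rightarrow> real \<Rightarrow> 'a::euclidean_space set \<Rightarrow> ('a \<Rightarrow> real) set" where
  "restricted_space s p \<Omega> = {f \<in> Lp_space p \<Omega>. restricted_seminorm s p \<Omega> f < \<infinity>}"

definition decomposes ::
  "'a::euclidean_space set \<Rightarrow> ('a \<Rightarrow> real) \<Rightarrow> ('a \<Rightarrow> real) \<Rightarrow> ('a \<Rightarrow> real) \<Rightarrow> bool" where
  "decomposes \<Omega> f g h \<longleftrightarrow> (AE x in lebesgue_on \<Omega>. f x = g x + h x)"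

definition K_functional ::
  "real \<Rightarrow> 'a::euclidean_space set \<Rightarrow> real \<Rightarrow> ('a \<Rightarrow> real) \<Rightarrow> real" where
  "K_functional p \<Omega> l f =
     Inf {Lp_norm p \<Omega> g + l * W1p_norm p \<Omega> h | g h.
            decomposes \<Omega> f g h \<and> g \<in> Lp_space p \<Omega> \<and> h \<in> W1p_space p \<Omega>}"

definition interpolation_seminorm ::
  "real \<Rightarrow> real \<Rightarrow> 'a::euclidean_space set \<Rightarrow> ('a \<Rightarrow> real) \<Rightarrow> ennreal" where
  "interpolation_seminorm s p \<Omega> f =
     ennreal_powr
       (\<integral>\<^sup>+l\<in>{0<..}. ennreal ((l powr (- s) * K_functional p \<Omega> l f) powr p / l) \<partial>lborel) (1 / p)"

definition interpolation_space ::
  "real \<Rightarrow> real \<Rightarrow> 'a::euclidean_space set \<Rightarrow> ('a \<Rightarrow> real) set" where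
  "interpolation_space s p \<Omega> =
     {f. (\<exists>g\<in>Lp_space p \<Omega>. \<exists>h\<in>W1p_space p \<Omega>. decomposes \<Omega> f g h) \<and>
         interpolation_seminorm s p \<Omega> f < \<infinity>}"

end

(*
Write f = g + h. Translation by z changes g by at most 2 |g|_p and h by at most C |z| |grad h|_p,
as long as the segments [x, x + z] stay in the domain. Near-optimal decompositions at the dyadic
scales l = R / 2^k, integrated over the shells |z| ~ l, therefore bound the restricted seminorm by
the interpolation seminorm.

Conversely, at every scale t take averages of f over balls of radius ~ t whose centres have distance
~ t to the boundary (such centres exist near every point of a uniform domain), and glue them by a
partition of unity of scale t to a C^1 function h_t. Two such balls at distance at most C t are joined
by a chain of boundedly many balls along the arc of the uniformity condition, so t grad h_t and
h_t - h_{t/2} are controlled by differences of f at distance less than half the distance to the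
boundary. Since f - h_t is the telescoping sum of the functions h_{t/2^(k+1)} - h_{t/2^k}, up to sign,
a Hardy inequality for dyadic sums shows that f = (f - h_t) + h_t is a good decomposition at scale t.
*)
theory Submission
  imports Defs
begin

section \<open>Smooth functions and bumps\<close>

text \<open>The restricted seminorm sees only differences at separation below half the boundary
  distance, so averaging f over balls centred at x itself breaks down once the scale exceeds the
  distance of x from the boundary. Hence averages are attached to grid cells and taken over balls
  pushed into the interior, and two of them are compared only along chains whose links are short
  relative to the boundary distance: with links of length d and boundary distance at least 8 d,
  points of consecutive balls are less than 3 d apart, which is below half of 7 d. Membership in the
  interpolation space amounts to finiteness of a dyadic sum with weights t^(-s p), because K is
  monotone in the scale. The hypothesis s < 1 enters through the series of t^(p - s p), which
  absorbs the slack of near-optimal decompositions and the part of the Sobolev norm that does not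
  come from the gradient. Functions are replaced by Borel representatives vanishing outside the
  domain, so that translation invariance and Fubini are available for \<open>lborel\<close>.\<close>

lemma Ck_Suc_intro:
  assumes "\<And>x. (f has_derivative f' x) (at x)" and "\<And>v. Ck k (\<lambda>x. f' x v)"
  shows "Ck (Suc k) f"
proof -
  have "frechet_derivative f (at x) = f' x" for x
    using frechet_derivative_at[OF assms(1)] by simp
  then show ?thesis
    using assms by (auto simp: differentiable_def)
qed

lemma Ck_Suc_has_derivative:
  "Ck (Suc k) f \<Longrightarrow> (f has_derivative frechet_derivative f (at x)) (at x)"
  by (simp add: frechet_derivative_works)

lemma Ck_SucD: "Ck (Suc k) f \<Longrightarrow> Ck k f"
proof (induction k arbitrary: f)
  case 0
  then show ?case
    by (auto intro!: differentiable_imp_continuous_on simp: differentiable_on_def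
        intro: differentiable_at_withinI)
next
  case (Suc k)
  then show ?case
    by (metis Ck.simps(2))
qed

lemma Ck_continuous: "Ck k f \<Longrightarrow> continuous_on UNIV f"
proof (induction k arbitrary: f)
  case (Suc k)
  then show ?case using Ck_SucD by blast
qed simp

lemma Ck_const [simp]: "Ck k (\<lambda>x. c)"
proof (induction k arbitrary: c)
  case (Suc k)
  show ?case
    by (rule Ck_Suc_intro[where f' = "\<lambda>_ _. 0"]) (auto intro: Suc)
qed simp

lemma Ck_add: "Ck k f \<Longrightarrow> Ck k g \<Longrightarrow> Ck k (\<lambda>x. f x + g x)"
proof (induction k arbitrary: f g)
  case (Suc k)
  show ?case
    by (rule Ck_Suc_intro[OF has_derivative_add[OF Ck_Suc_has_derivative Ck_Suc_has_derivative]])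
      (use Suc in auto)
qed (simp add: continuous_on_add)

lemma Ck_mult: "Ck k f \<Longrightarrow> Ck k g \<Longrightarrow> Ck k (\<lambda>x. f x * g x)"
proof (induction k arbitrary: f g)
  case (Suc k)
  have "Ck k (\<lambda>x. f x * frechet_derivative g (at x) v + frechet_derivative f (at x) v * g x)" for v
    using Suc.prems Ck_SucD[OF Suc.prems(1)] Ck_SucD[OF Suc.prems(2)]
    by (intro Ck_add Suc.IH) auto
  then show ?case
    by (intro Ck_Suc_intro[OF has_derivative_mult[OF Ck_Suc_has_derivative Ck_Suc_has_derivative]])
      (use Suc.prems in auto)
qed (simp add: continuous_on_mult)

lemma Ck_prod: "(\<And>i. i \<in> I \<Longrightarrow> Ck k (f i)) \<Longrightarrow> Ck k (\<lambda>x. \<Prod>i\<in>I. f i x)"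
  by (induction I rule: infinite_finite_induct) (auto intro: Ck_mult)

lemma Ck_linear:
  assumes "bounded_linear L"
  shows "Ck k L"
proof (cases k)
  case 0
  then show ?thesis
    using assms by (simp add: linear_continuous_on)
next
  case (Suc j)
  show ?thesis
    unfolding Suc
    by (rule Ck_Suc_intro[OF bounded_linear_imp_has_derivative[OF assms]]) simp
qed

lemma Ck_translate: "Ck k f \<Longrightarrow> Ck k (\<lambda>x. f (x + c))"
proof (induction k arbitrary: f)
  case 0
  then show ?case
    by (simp add: continuous_on_compose2[of UNIV f] continuous_on_add)
next
  case (Suc k)
  have "((\<lambda>x. f (x + c)) has_derivative frechet_derivative f (at (x + c))) (at x)" for x
    by (rule has_derivative_compose[of "\<lambda>x. x + c" "\<lambda>v. v" x UNIV f, OF _ Ck_Suc_has_derivative[OF Suc.prems]])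
      (auto intro!: derivative_eq_intros)
  then show ?case
    by (rule Ck_Suc_intro) (use Suc in auto)
qed

text \<open>The span of these functions is closed under differentiation, whence smoothness.\<close>

definition flat :: "nat \<Rightarrow> real \<Rightarrow> real" where
  "flat m x = (if x > 0 then (1 / x) ^ m * exp (- (1 / x)) else 0)"

text \<open>The substitution \<open>y = inverse x\<close> turns the claim into the decay of
  \<open>y ^ m / exp y\<close> at infinity.\<close>

lemma flat_tendsto_0: "(flat m \<longlongrightarrow> 0) (at_right 0)"
proof -
  have "((\<lambda>x::real. (inverse x) ^ m / exp (inverse x)) \<longlongrightarrow> 0) (at_right 0)"
    using filterlim_compose[OF tendsto_power_div_exp_0 filterlim_inverse_at_top_right] .
  moreover have "eventually (\<lambda>x::real. (inverse x) ^ m / exp (inverse x) = flat m x) (at_right 0)"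
    unfolding eventually_at_right_field
    by (rule exI[of _ 1]) (auto simp: flat_def exp_minus field_simps)
  ultimately show ?thesis
    by (rule Lim_transform_eventually)
qed

lemma flat_has_derivative:
  "(flat m has_real_derivative (flat (m + 2) x - real m * flat (m + 1) x)) (at x)"
proof (cases "x = 0")
  case False
  show ?thesis
  proof (cases "x > 0")
    case True
    have "((\<lambda>x. (1 / x) ^ m * exp (- (1 / x))) has_real_derivative
       (flat (m + 2) x - real m * flat (m + 1) x)) (at x)"
      using True
      apply (auto intro!: derivative_eq_intros simp: flat_def)
      by (cases m) (auto simp: field_simps power2_eq_square)
    then show ?thesis
      by (rule DERIV_cong_ev[THEN iffD1, rotated 3])
        (auto simp: flat_def True intro!: eventually_mono[OF eventually_nhds_in_open[of "{0<..}" x]])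
  next
    assume "\<not> x > 0"
    then have "x < 0" using False by simp
    have "((\<lambda>x. 0) has_real_derivative (flat (m + 2) x - real m * flat (m + 1) x)) (at x)"
      using \<open>x < 0\<close> by (auto simp: flat_def)
    then show ?thesis
      by (rule DERIV_cong_ev[THEN iffD1, rotated 3])
        (auto simp: flat_def \<open>x < 0\<close> intro!: eventually_mono[OF eventually_nhds_in_open[of "{..<0}" x]])
  qed
next
  case True
  \<comment> \<open>For positive h the difference quotient at the origin is
    \<open>flat (Suc m) h\<close>, whose limit is known; from the left it vanishes.\<close>
  have "((\<lambda>h. flat m h / h) \<longlongrightarrow> 0) (at_right 0)"
    by (rule Lim_transform_eventually[OF flat_tendsto_0[of "Suc m"]])
      (auto simp: eventually_at_right_field flat_def intro!: exI[of _ 1])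
  moreover have "((\<lambda>h. flat m h / h) \<longlongrightarrow> 0) (at_left 0)"
    by (rule Lim_transform_eventually[OF tendsto_const])
      (auto simp: eventually_at_left_field flat_def intro!: exI[of _ "-1"])
  ultimately have "((\<lambda>h. flat m h / h) \<longlongrightarrow> 0) (at 0)"
    by (simp add: filterlim_split_at)
  then show ?thesis
    using True by (simp add: DERIV_def flat_def)
qed

text \<open>The order m is general in the induction because differentiation replaces
  \<open>flat m\<close> by \<open>flat (m + 1)\<close> and \<open>flat (m + 2)\<close>.\<close>

lemma Ck_flat_compose: "Ck k g \<Longrightarrow> Ck k (\<lambda>x. flat m (g x))"
proof (induction k arbitrary: m g)
  case 0
  have "continuous_on UNIV (flat m)"
    by (meson DERIV_isCont continuous_at_imp_continuous_on flat_has_derivative)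
  then show ?case
    using 0 by (simp add: continuous_on_compose2[of UNIV "flat m"])
next
  case (Suc k)
  have "((\<lambda>x. flat m (g x)) has_derivative
      (\<lambda>v. (flat (m + 2) (g x) + (- real m) * flat (m + 1) (g x)) * frechet_derivative g (at x) v)) (at x)" for x
    using has_derivative_compose[OF Ck_Suc_has_derivative[OF Suc.prems]
        flat_has_derivative[unfolded has_field_derivative_def]]
    by simp
  moreover have "Ck k (\<lambda>x. (flat (m + 2) (g x) + (- real m) * flat (m + 1) (g x)) * frechet_derivative g (at x) v)" for v
    using Suc Ck_SucD[OF Suc.prems] by (intro Ck_add Ck_mult Suc.IH) auto
  ultimately show ?case
    by (rule Ck_Suc_intro)
qed

text \<open>Smooth minorants of the indicator of \<open>box a b\<close>: inside, each factor is the
  exponential of -1 / ((n + 1) q), with q > 0 the product of the distances to two opposite faces,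
  and so tends to 1; outside, if the corners are in the right order, some factor is 0.\<close>

definition box_bump :: "'a::euclidean_space \<Rightarrow> 'a \<Rightarrow> nat \<Rightarrow> 'a \<Rightarrow> real" where
  "box_bump a b n x = (\<Prod>i\<in>Basis. flat 0 (real (Suc n) * ((x \<bullet> i - a \<bullet> i) * (b \<bullet> i - x \<bullet> i))))"

lemma Ck_box_bump: "Ck k (box_bump a b n)"
proof -
  have "Ck k (\<lambda>x. flat 0 (real (Suc n) * ((x \<bullet> i + - (a \<bullet> i)) * (b \<bullet> i + (- 1) * (x \<bullet> i)))))" for i :: 'a
    by (intro Ck_flat_compose Ck_mult Ck_add Ck_const Ck_linear bounded_linear_inner_left)
  then show ?thesis
    unfolding box_bump_def by (intro Ck_prod) simp
qed

lemma flat_0_bounds: "0 \<le> flat 0 x" "flat 0 x \<le> 1"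
  by (auto simp: flat_def)

lemma box_bump_bounds: "0 \<le> box_bump a b n x" "box_bump a b n x \<le> 1"
  unfolding box_bump_def by (auto intro!: prod_nonneg prod_le_1 simp: flat_0_bounds)

lemma box_bump_eq_0:
  assumes "x \<notin> box a b" "\<And>i. i \<in> Basis \<Longrightarrow> a \<bullet> i \<le> b \<bullet> i"
  shows "box_bump a b n x = 0"
proof -
  obtain i where i: "i \<in> Basis" "\<not> (a \<bullet> i < x \<bullet> i \<and> x \<bullet> i < b \<bullet> i)"
    using assms(1) by (auto simp: mem_box)
  then have "(x \<bullet> i - a \<bullet> i) * (b \<bullet> i - x \<bullet> i) \<le> 0"
    using assms(2)[OF i(1)] by (auto simp: mult_le_0_iff)
  then have "real (Suc n) * ((x \<bullet> i - a \<bullet> i) * (b \<bullet> i - x \<bullet> i)) \<le> 0"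
    by (simp add: mult_nonneg_nonpos)
  then have "flat 0 (real (Suc n) * ((x \<bullet> i - a \<bullet> i) * (b \<bullet> i - x \<bullet> i))) = 0"
    unfolding flat_def by auto
  then show ?thesis
    unfolding box_bump_def using i(1) by (auto intro: prod_zero)
qed

lemma box_bump_tendsto:
  assumes "\<And>i. i \<in> Basis \<Longrightarrow> a \<bullet> i \<le> b \<bullet> i"
  shows "(\<lambda>n. box_bump a b n x) \<longlonglongrightarrow> indicat_real (box a b) x"
proof (cases "x \<in> box a b")
  case True
  have "(\<lambda>n. flat 0 (real (Suc n) * ((x \<bullet> i - a \<bullet> i) * (b \<bullet> i - x \<bullet> i)))) \<longlonglongrightarrow> 1" if "i \<in> Basis" for i
  proof -
    define c where "c = (x \<bullet> i - a \<bullet> i) * (b \<bullet> i - x \<bullet> i)"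
    have c: "c > 0" unfolding c_def using True that by (auto simp: mem_box)
    have "(\<lambda>n. exp (- ((1 / c) * (1 / real (Suc n))))) \<longlonglongrightarrow> exp (- ((1 / c) * 0))"
      using LIMSEQ_inverse_real_of_nat by (intro tendsto_intros) (simp add: inverse_eq_divide)
    moreover have "flat 0 (real (Suc n) * c) = exp (- ((1 / c) * (1 / real (Suc n))))" for n
      using c by (simp add: flat_def mult.commute)
    ultimately show ?thesis
      unfolding c_def[symmetric] by simp
  qed
  then have "(\<lambda>n. box_bump a b n x) \<longlonglongrightarrow> (\<Prod>i\<in>(Basis::'a set). 1)"
    unfolding box_bump_def by (intro tendsto_prod)
  then show ?thesis using True by simp
next
  case False
  then show ?thesis
    using box_bump_eq_0[OF False assms] by simp
qed

lemma test_function_box_bump: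
  assumes "cbox a b \<subseteq> U" "\<And>i. i \<in> Basis \<Longrightarrow> a \<bullet> i \<le> b \<bullet> i"
  shows "test_function U (box_bump a b n)"
proof -
  have "closure {x. box_bump a b n x \<noteq> 0} \<subseteq> cbox a b"
    using box_bump_eq_0[OF _ assms(2)] box_subset_cbox[of a b]
    by (intro closure_minimal) blast+
  then show ?thesis
    using assms(1) compact_cbox[of a b] bounded_subset[OF bounded_cbox]
    unfolding test_function_def by (auto simp: Ck_box_bump compact_eq_bounded_closed)
qed

section \<open>The fundamental lemma of the calculus of variations\<close>

text \<open>Boxes form an intersection-stable generator of the Borel sets, so a Dynkin argument
  extends the vanishing of the integral to all of them. The whole space is not a box; its integral
  is assumed separately, for the step to complements. Uniqueness of densities then compares u with
  0.\<close>

lemma AE_zero_if_integral_box_zero: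
  fixes u :: "'a::euclidean_space \<Rightarrow> real"
  assumes u: "integrable lborel u" and u0: "integral\<^sup>L lborel u = 0"
    and box: "\<And>a b. (LINT x:box a b|lborel. u x) = 0"
  shows "AE x in lborel. u x = 0"
proof (rule density_unique_real[OF u integrable_zero])
  fix A :: "'a set" assume "A \<in> sets lborel"
  then have A: "A \<in> sigma_sets UNIV (range (\<lambda>(a, b). box a b))"
    by (simp add: borel_eq_box)
  have int: "set_integrable lborel B u" if "B \<in> sigma_sets UNIV (range (\<lambda>(a, b). box a b :: 'a set))" for B
    using that u integrable_mult_indicator[of B lborel u]
    by (simp add: set_integrable_def borel_eq_box)
  have "(LINT x:A|lborel. u x) = 0"
  proof (rule sigma_sets_induct_disjoint[OF _ _ A])
    show "Int_stable (range (\<lambda>(a, b). box a b :: 'a set))"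
      by (auto simp: Int_stable_def box_Int_box intro!: range_eqI[where x = "(_, _)"])
  next
    show "range (\<lambda>(a, b). box a b :: 'a set) \<subseteq> Pow UNIV" by simp
  next
    fix B :: "'a set" assume "B \<in> range (\<lambda>(a, b). box a b)"
    then show "(LINT x:B|lborel. u x) = 0" using box by auto
  next
    show "(LINT x:{}|lborel. u x) = 0" by (simp add: set_lebesgue_integral_def)
  next
    fix B :: "'a set" assume B: "B \<in> sigma_sets UNIV (range (\<lambda>(a, b). box a b))"
      and 0: "(LINT x:B|lborel. u x) = 0"
    have "(LINT x:B \<union> (UNIV - B)|lborel. u x) = (LINT x:B|lborel. u x) + (LINT x:UNIV - B|lborel. u x)"
      using int[OF B] int[OF sigma_sets.Compl[OF B]] by (intro set_integral_Un) auto
    moreover have "(LINT x:UNIV|lborel. u x) = 0"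
      using u0 by (simp add: set_lebesgue_integral_def)
    ultimately show "(LINT x:UNIV - B|lborel. u x) = 0"
      using 0 by simp
  next
    fix B :: "nat \<Rightarrow> 'a set"
    assume B: "disjoint_family B" "range B \<subseteq> sigma_sets UNIV (range (\<lambda>(a, b). box a b))"
      and 0: "\<And>i. (LINT x:B i|lborel. u x) = 0"
    have Bs: "B i \<in> sets lborel" for i
      using B(2) by (auto simp: borel_eq_box)
    then have "(\<Union>i. B i) \<in> sets lborel" by blast
    then have "set_integrable lborel (\<Union>i. B i) u"
      using u integrable_mult_indicator unfolding set_integrable_def by blast
    with Bs B(1) have "(LINT x:(\<Union>i. B i)|lborel. u x) = (\<Sum>i. (LINT x:B i|lborel. u x))"
      by (intro lebesgue_integral_countable_add) (auto simp: disjoint_family_on_def)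
    then show "(LINT x:(\<Union>i. B i)|lborel. u x) = 0"
      using 0 by simp
  qed
  then show "(LINT x:A|lborel. u x) = (LINT x:A|lborel. 0)"
    by (simp add: set_lebesgue_integral_def)
qed

section \<open>Restriction of Lebesgue measure to a subset\<close>

lemma integral_lebesgue_on:
  fixes f :: "'a::euclidean_space \<Rightarrow> real"
  assumes "S \<in> sets lebesgue"
  shows "integral\<^sup>L (lebesgue_on S) f = (\<integral>x. indicator S x * f x \<partial>lebesgue)"
  using assms by (subst integral_restrict_space) auto

lemma integrable_lebesgue_on_iff:
  fixes f :: "'a::euclidean_space \<Rightarrow> real"
  assumes "S \<in> sets lebesgue"
  shows "integrable (lebesgue_on S) f \<longleftrightarrow> integrable lebesgue (\<lambda>x. indicator S x * f x)"
  using assms by (subst integrable_restrict_space) auto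

lemma integrable_lebesgue_on_antimono:
  fixes f :: "'a::euclidean_space \<Rightarrow> real"
  assumes "integrable (lebesgue_on S) f" "S \<in> sets lebesgue" "T \<in> sets lebesgue" "T \<subseteq> S"
  shows "integrable (lebesgue_on T) f"
proof -
  have "integrable lebesgue (\<lambda>x. indicator T x *\<^sub>R (indicator S x * f x))"
    using assms by (intro integrable_mult_indicator) (auto simp: integrable_lebesgue_on_iff)
  moreover have "(\<lambda>x. indicator T x *\<^sub>R (indicator S x * f x)) = (\<lambda>x. indicator T x * f x)"
    using assms(4) by (auto simp: indicator_def fun_eq_iff)
  ultimately show ?thesis
    using assms(3) by (simp add: integrable_lebesgue_on_iff)
qed

text \<open>Dominated convergence passes from the smooth bumps to the indicator of the open box. The
  factor \<open>indicator (cbox a b)\<close> changes nothing, since the bumps vanish off the box,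
  and it supplies an integrable majorant for a function that is only locally integrable.\<close>

lemma integral_box_zero:
  fixes u :: "'a::euclidean_space \<Rightarrow> real"
  assumes U: "open U" and cb: "cbox a b \<subseteq> U" and u: "locally_integrable U u"
    and test: "\<And>\<phi>. test_function U \<phi> \<Longrightarrow> (\<integral>x. u x * \<phi> x \<partial>lebesgue_on U) = 0"
  shows "(\<integral>x. indicator (box a b) x * u x \<partial>lebesgue) = 0"
proof (cases "box a b = {}")
  case False
  then have ab: "a \<bullet> i \<le> b \<bullet> i" if "i \<in> Basis" for i
    using that by (force simp: box_ne_empty)
  have int: "integrable lebesgue (\<lambda>x. indicator (cbox a b) x * u x)"
    using u cb by (auto simp: locally_integrable_def integrable_lebesgue_on_iff[symmetric])
  have "(\<lambda>n. \<integral>x. box_bump a b n x * (indicator (cbox a b) x * u x) \<partial>lebesgue) \<longlonglongrightarrow>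
      (\<integral>x. indicator (box a b) x * (indicator (cbox a b) x * u x) \<partial>lebesgue)"
  proof (rule integral_dominated_convergence[where w = "\<lambda>x. \<bar>indicator (cbox a b) x * u x\<bar>"])
    have "box_bump a b n \<in> borel_measurable lebesgue" for n
      by (intro measurable_completion) (simp add: borel_measurable_continuous_onI Ck_continuous[OF Ck_box_bump])
    then show "(\<lambda>x. box_bump a b n x * (indicator (cbox a b) x * u x)) \<in> borel_measurable lebesgue" for n
      by (rule borel_measurable_times[OF _ borel_measurable_integrable[OF int]])
    show "(\<lambda>x. indicator (box a b) x * (indicator (cbox a b) x * u x)) \<in> borel_measurable lebesgue"
      by (rule borel_measurable_times[OF borel_measurable_indicator borel_measurable_integrable[OF int]]) simp
    show "AE x in lebesgue. (\<lambda>n. box_bump a b n x * (indicator (cbox a b) x * u x)) \<longlonglongrightarrow> indicator (box a b) x * (indicator (cbox a b) x * u x)"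
      using box_bump_tendsto[OF ab] by (intro AE_I2 tendsto_mult tendsto_const)
    show "AE x in lebesgue. norm (box_bump a b n x * (indicator (cbox a b) x * u x)) \<le> \<bar>indicator (cbox a b) x * u x\<bar>" for n
      using box_bump_bounds[of a b n] by (auto simp: abs_mult intro!: mult_left_le_one_le mult_nonneg_nonneg)
  qed (use int in auto)
  moreover have "(\<integral>x. box_bump a b n x * (indicator (cbox a b) x * u x) \<partial>lebesgue) = 0" for n
  proof -
    have "(\<lambda>x. box_bump a b n x * (indicator (cbox a b) x * u x)) = (\<lambda>x. indicator U x * (u x * box_bump a b n x))"
    proof
      fix x
      show "box_bump a b n x * (indicator (cbox a b) x * u x) = indicator U x * (u x * box_bump a b n x)"
        using cb box_bump_eq_0[OF _ ab, of x n] box_subset_cbox[of a b]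
        by (auto simp: indicator_def)
    qed
    then show ?thesis
      using test[OF test_function_box_bump[OF cb ab], of n] U by (simp only: integral_lebesgue_on[OF sets_completionI_sets[of U lborel]] sets_lborel borel_open)
  qed
  ultimately have "(\<integral>x. indicator (box a b) x * (indicator (cbox a b) x * u x) \<partial>lebesgue) = 0"
    using LIMSEQ_unique[OF _ tendsto_const] by force
  moreover have "indicator (box a b) x * (indicator (cbox a b) x * u x) = indicator (box a b) x * u x" for x
    using box_subset_cbox[of a b] by (auto simp: indicator_def)
  ultimately show ?thesis by simp
qed simp

text \<open>On a box with closure in U, the function cut off to that box has zero integral over
  every box, hence vanishes almost everywhere. Countably many such boxes cover U by Lindelof's
  theorem, and countably many null sets remain null.\<close>

lemma fundamental_lemma:
  fixes u :: "'a::euclidean_space \<Rightarrow> real"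
  assumes U: "open U" and u: "locally_integrable U u"
    and test: "\<And>\<phi>. test_function U \<phi> \<Longrightarrow> (\<integral>x. u x * \<phi> x \<partial>lebesgue_on U) = 0"
  shows "AE x in lebesgue_on U. u x = 0"
proof -
  have *: "AE x in lebesgue. x \<in> box c d \<longrightarrow> u x = 0" if cd: "cbox c d \<subseteq> U" for c d
  proof -
    let ?v = "\<lambda>x. indicator (box c d) x * u x"
    have "integrable (lebesgue_on (box c d)) u"
      using u cd
      by (intro integrable_lebesgue_on_antimono[OF _ _ _ box_subset_cbox]) (simp_all add: locally_integrable_def)
    then have v: "integrable lebesgue ?v" by (simp add: integrable_lebesgue_on_iff)
    \<comment> \<open>The Dynkin argument runs over Borel sets, so the cut-off function is replaced
      by a Borel function equal to it almost everywhere.\<close>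
    then obtain v' where v': "v' \<in> borel_measurable lborel" "AE x in lborel. ?v x = v' x"
      using completion_ex_borel_measurable_real[of ?v lborel] by auto
    have int: "integrable lborel v'"
      using v v' integrable_cong_AE[of ?v lebesgue v'] AE_completion[OF v'(2)]
      by (simp add: measurable_completion integrable_completion)
    have zero: "(LINT x:box a b|lborel. v' x) = 0" for a b
    proof -
      \<comment> \<open>Intersections of boxes are boxes, so integrating over \<open>box a b\<close>
        reduces to a smaller box whose closure still lies in U; an empty intersection is encoded by
        the empty box with corners \<open>One\<close> and 0.\<close>
      obtain a' b' where ab: "box a b \<inter> box c d = box a' b'" "cbox a' b' \<subseteq> U"
      proof (cases "box a b \<inter> box c d = {}")
        case True
        show ?thesis
        proof (rule that[of One 0])
          have "box One (0::'a) = {}" "cbox One (0::'a) = {}"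
            using SOME_Basis by (force simp: box_eq_empty)+
          then show "box a b \<inter> box c d = box One 0" "cbox One 0 \<subseteq> U" using True by auto
        qed
      next
        case False
        let ?a = "\<Sum>i\<in>Basis. max (a \<bullet> i) (c \<bullet> i) *\<^sub>R i" and ?b = "\<Sum>i\<in>Basis. min (b \<bullet> i) (d \<bullet> i) *\<^sub>R i"
        have "cbox ?a ?b \<subseteq> cbox c d" by (auto simp: mem_box)
        then show ?thesis
          using that[of ?a ?b] cd by (simp add: box_Int_box)
      qed
      have "(LINT x:box a b|lborel. v' x) = (\<integral>x. indicator (box a b) x * v' x \<partial>lebesgue)"
        using v'(1) by (simp add: set_lebesgue_integral_def integral_completion)
      also have "\<dots> = (\<integral>x. indicator (box a b) x * ?v x \<partial>lebesgue)"
        using v' AE_completion[OF v'(2)] borel_measurable_times[OF _ borel_measurable_integrable[OF v], of "indicator (box a b)"]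
        by (intro integral_cong_AE) (auto simp: measurable_completion)
      also have "\<dots> = (\<integral>x. indicator (box a' b') x * u x \<partial>lebesgue)"
        using ab(1) by (intro Bochner_Integration.integral_cong) (auto simp: indicator_def)
      also have "\<dots> = 0"
        by (rule integral_box_zero[OF U ab(2) u test])
      finally show ?thesis .
    qed
    have "integral\<^sup>L lborel v' = (LINT x:box c d|lborel. v' x)"
      unfolding set_lebesgue_integral_def
      using v' by (intro integral_cong_AE) (auto simp: indicator_def)
    then have "AE x in lborel. v' x = 0"
      using AE_zero_if_integral_box_zero[OF int _ zero] zero by simp
    with v'(2) have "AE x in lborel. x \<in> box c d \<longrightarrow> u x = 0"
      by eventually_elim (auto simp: indicator_def)
    then show ?thesis by (rule AE_completion)
  qed
  let ?F = "{box a b |a b. cbox a b \<subseteq> U}"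
  obtain \<D> where \<D>: "\<D> \<subseteq> ?F" "countable \<D>" "\<Union>\<D> = \<Union>?F"
    by (rule Lindelof[of ?F]) auto
  have "\<exists>X\<in>?F. x \<in> X" if "x \<in> U" for x
  proof -
    obtain a b where "cbox a b \<subseteq> U" "x \<in> box a b"
      by (rule open_contains_cbox[OF U \<open>x \<in> U\<close>])
    then show ?thesis by blast
  qed
  then have cover: "U \<subseteq> \<Union>\<D>" unfolding \<D>(3) by blast
  have "AE x in lebesgue. \<forall>X\<in>\<D>. x \<in> X \<longrightarrow> u x = 0"
    using \<D>(1) * by (subst AE_ball_countable[OF \<D>(2)]) blast
  then have "AE x in lebesgue. x \<in> U \<longrightarrow> u x = 0"
    by eventually_elim (use cover in blast)
  then show ?thesis
    using U by (subst AE_restrict_space_iff) auto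
qed

section \<open>Power means and translations\<close>

text \<open>Convexity of the power is taken on the open half-line, which leaves y = 0 to a direct
  check; there the claim is c^p (1 - p) \<le> 0.\<close>

lemma powr_above_tangent:
  fixes p y c :: real
  assumes "1 \<le> p" "0 \<le> y" "0 < c"
  shows "c powr p + p * c powr (p - 1) * (y - c) \<le> y powr p"
proof (cases "y = 0")
  case True
  have "c powr p = c powr (p - 1) * c"
    using assms(3) powr_mult_base[of c "p - 1"] by (simp add: mult.commute)
  then show ?thesis
    using True assms mult_right_mono[of 1 p "c powr p"] by (simp add: algebra_simps)
next
  case False
  have "y powr p - c powr p \<ge> (p * c powr (p - 1)) * (y - c)"
  proof (rule convex_on_imp_above_tangent[OF powr_convex[OF assms(1)]])
    show "((\<lambda>x. x powr p) has_real_derivative p * c powr (p - 1)) (at c within {0<..})"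
      using assms(3) by (auto intro!: derivative_eq_intros)
  qed (use False assms in \<open>auto simp: interior_open\<close>)
  then show ?thesis by simp
qed

text \<open>Jensen's inequality, by integrating the tangent at the absolute value c of the mean.
  Since c m is at most the integral of |g|, the linear term is nonnegative. Keeping m as a factor
  avoids division in \<open>ennreal\<close>.\<close>

lemma powr_average_le:
  fixes g :: "'b \<Rightarrow> real"
  assumes M: "emeasure M (space M) = ennreal m" and m: "0 < m" and p: "1 \<le> p" and g: "integrable M g"
  shows "ennreal (m * \<bar>(\<integral>x. g x \<partial>M) / m\<bar> powr p) \<le> (\<integral>\<^sup>+x. ennreal (\<bar>g x\<bar> powr p) \<partial>M)"
\<comment> \<open>An infinite right side or a vanishing mean makes the claim trivial; otherwise c is
  positive, as the tangent requires.\<close>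
proof (cases "(\<integral>\<^sup>+x. ennreal (\<bar>g x\<bar> powr p) \<partial>M) = \<infinity> \<or> (\<integral>x. g x \<partial>M) = 0")
  case False
  interpret finite_measure M
    by standard (simp add: M)
  have meas: "measure M (space M) = m"
    using M m by (simp add: measure_def)
  have int: "integrable M (\<lambda>x. \<bar>g x\<bar> powr p)"
    using False g by (intro integrableI_nonneg) (auto simp: top.not_eq_extremum)
  define c where "c = \<bar>(\<integral>x. g x \<partial>M) / m\<bar>"
  have c: "0 < c" using False m by (simp add: c_def)
  have cm: "c * m \<le> (\<integral>x. \<bar>g x\<bar> \<partial>M)"
    using integral_abs_bound[of M g] m by (simp add: c_def abs_divide)
  have "m * c powr p \<le> m * c powr p + p * c powr (p - 1) * ((\<integral>x. \<bar>g x\<bar> \<partial>M) - c * m)"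
    using cm p by simp
  also have "\<dots> = (\<integral>x. c powr p + p * c powr (p - 1) * (\<bar>g x\<bar> - c) \<partial>M)"
    using g meas by (simp add: algebra_simps)
  also have "\<dots> \<le> (\<integral>x. \<bar>g x\<bar> powr p \<partial>M)"
    using g int powr_above_tangent[OF p abs_ge_zero c] by (intro integral_mono) auto
  finally have "ennreal (m * c powr p) \<le> ennreal (\<integral>x. \<bar>g x\<bar> powr p \<partial>M)"
    by (rule ennreal_leI)
  also have "\<dots> = (\<integral>\<^sup>+x. ennreal (\<bar>g x\<bar> powr p) \<partial>M)"
    using int by (intro nn_integral_eq_integral[symmetric]) auto
  finally show ?thesis by (simp add: c_def)
qed auto

section \<open>Translations and Fubini for Lebesgue measure\<close>

lemma lborel_distr_plus_right: "distr lborel borel (\<lambda>x. x + c) = (lborel :: 'a::euclidean_space measure)"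
proof -
  have "(+) c = (\<lambda>x. x + c)"
    by (simp add: fun_eq_iff add.commute)
  then show ?thesis
    using lborel_distr_plus[of c] by simp
qed

lemma nn_integral_lborel_translate:
  fixes c :: "'a::euclidean_space"
  assumes "f \<in> borel_measurable borel"
  shows "(\<integral>\<^sup>+x. f (x + c) \<partial>lborel) = (\<integral>\<^sup>+x. f x \<partial>lborel)"
  using assms by (subst (2) lborel_distr_plus_right[of c, symmetric]) (simp add: nn_integral_distr)

lemma integral_lborel_translate:
  fixes c :: "'a::euclidean_space" and f :: "'a \<Rightarrow> real"
  assumes "f \<in> borel_measurable borel"
  shows "(\<integral>x. f (x + c) \<partial>lborel) = (\<integral>x. f x \<partial>lborel)"
  using assms by (subst (2) lborel_distr_plus_right[of c, symmetric]) (simp add: integral_distr)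

lemma integrable_lborel_translate:
  fixes c :: "'a::euclidean_space" and f :: "'a \<Rightarrow> real"
  assumes "integrable lborel f"
  shows "integrable lborel (\<lambda>x. f (x + c))"
proof -
  have "integrable (distr lborel borel (\<lambda>x. x + c)) f"
    using assms by (simp add: lborel_distr_plus_right)
  then show ?thesis
    using assms by (subst (asm) integrable_distr_eq) auto
qed

lemma AE_lborel_translate:
  fixes c :: "'a::euclidean_space"
  assumes "AE x in lborel. P x"
  shows "AE x in lborel. P (x + c)"
proof -
  obtain N where N: "N \<in> null_sets lborel" "{x. \<not> P x} \<subseteq> N"
    using assms by (auto elim!: AE_E simp: null_sets_def)
  show ?thesis
    by (rule AE_I'[OF null_sets_translation[OF N(1), of "- c"]]) (use N(2) in auto)
qed

text \<open>Provides the hypothesis of Fubini's theorem. Both integrands are dominated by M |A|,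
  translated in the second case, and the interval of t has mass 1. Integrating first in x removes
  the translate.\<close>

lemma integrable_pair_translate:
  fixes A B :: "'a::euclidean_space \<Rightarrow> real"
  assumes A: "integrable lborel A" and B[measurable]: "B \<in> borel_measurable borel" and M: "\<And>x. \<bar>B x\<bar> \<le> M"
  shows "integrable (lborel \<Otimes>\<^sub>M lborel) (\<lambda>(x, t). indicator {0..1::real} t * (A x * B (x - t *\<^sub>R z)))"
    and "integrable (lborel \<Otimes>\<^sub>M lborel) (\<lambda>(x, t). indicator {0..1::real} t * (A (x + t *\<^sub>R z) * B x))"
proof -
  have [measurable]: "A \<in> borel_measurable borel" using A by auto
  have M0: "0 \<le> M" using M[of 0] by linarith
  have fin: "(\<integral>\<^sup>+x. ennreal (\<bar>A x\<bar> * M) \<partial>lborel) < \<infinity>"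
    using A M0 by (subst nn_integral_eq_integral) auto
  have one: "(\<integral>\<^sup>+t. indicator {0..1::real} t * c \<partial>lborel) = c" for c :: ennreal
    by (simp add: nn_integral_multc)
  show "integrable (lborel \<Otimes>\<^sub>M lborel) (\<lambda>(x, t). indicator {0..1::real} t * (A x * B (x - t *\<^sub>R z)))"
  proof (rule integrableI_bounded)
    have "(\<integral>\<^sup>+w. ennreal (norm (case w of (x, t) \<Rightarrow> indicator {0..1::real} t * (A x * B (x - t *\<^sub>R z)))) \<partial>(lborel \<Otimes>\<^sub>M lborel))
      \<le> (\<integral>\<^sup>+(x, t). indicator {0..1::real} t * ennreal (\<bar>A x\<bar> * M) \<partial>(lborel \<Otimes>\<^sub>M lborel))"
      by (rule nn_integral_mono)
        (auto simp: indicator_def abs_mult intro!: ennreal_leI mult_left_mono M)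
    also have "\<dots> = (\<integral>\<^sup>+x. \<integral>\<^sup>+t. indicator {0..1::real} t * ennreal (\<bar>A x\<bar> * M) \<partial>lborel \<partial>lborel)"
      by (subst lborel.nn_integral_fst[symmetric]) auto
    finally show "(\<integral>\<^sup>+w. ennreal (norm (case w of (x, t) \<Rightarrow> indicator {0..1::real} t * (A x * B (x - t *\<^sub>R z)))) \<partial>(lborel \<Otimes>\<^sub>M lborel)) < \<infinity>"
      using fin by (simp add: one)
  qed measurable
  show "integrable (lborel \<Otimes>\<^sub>M lborel) (\<lambda>(x, t). indicator {0..1::real} t * (A (x + t *\<^sub>R z) * B x))"
  proof (rule integrableI_bounded)
    have "(\<integral>\<^sup>+w. ennreal (norm (case w of (x, t) \<Rightarrow> indicator {0..1::real} t * (A (x + t *\<^sub>R z) * B x))) \<partial>(lborel \<Otimes>\<^sub>M lborel))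
      \<le> (\<integral>\<^sup>+(x, t). indicator {0..1::real} t * ennreal (\<bar>A (x + t *\<^sub>R z)\<bar> * M) \<partial>(lborel \<Otimes>\<^sub>M lborel))"
      by (rule nn_integral_mono)
        (auto simp: indicator_def abs_mult intro!: ennreal_leI mult_left_mono M)
    also have "\<dots> = (\<integral>\<^sup>+t. \<integral>\<^sup>+x. indicator {0..1::real} t * ennreal (\<bar>A (x + t *\<^sub>R z)\<bar> * M) \<partial>lborel \<partial>lborel)"
      by (subst lborel_pair.nn_integral_snd[symmetric]) auto
    also have "\<dots> = (\<integral>\<^sup>+t. indicator {0..1::real} t * (\<integral>\<^sup>+x. ennreal (\<bar>A (x + t *\<^sub>R z)\<bar> * M) \<partial>lborel) \<partial>lborel)"
      by (simp add: nn_integral_cmult)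
    also have "\<dots> = (\<integral>\<^sup>+t. indicator {0..1::real} t * (\<integral>\<^sup>+x. ennreal (\<bar>A x\<bar> * M) \<partial>lborel) \<partial>lborel)"
      by (subst nn_integral_lborel_translate[of "\<lambda>x. ennreal (\<bar>A x\<bar> * M)"]) auto
    finally show "(\<integral>\<^sup>+w. ennreal (norm (case w of (x, t) \<Rightarrow> indicator {0..1::real} t * (A (x + t *\<^sub>R z) * B x))) \<partial>(lborel \<Otimes>\<^sub>M lborel)) < \<infinity>"
      using fin by (simp add: one)
  qed measurable
qed

text \<open>Both left sides are reduced to the same t-integral; the second by substituting in x for
  each fixed t, which moves the translation from A to B. The first serves derivatives of test
  functions, the second averaged weak gradients.\<close>

lemma integral_translate_swap:
  fixes A B :: "'a::euclidean_space \<Rightarrow> real"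
  assumes A: "integrable lborel A" and B[measurable]: "B \<in> borel_measurable borel" and M: "\<And>x. \<bar>B x\<bar> \<le> M"
  shows "(\<integral>x. A x * (\<integral>t. indicator {0..1::real} t * B (x - t *\<^sub>R z) \<partial>lborel) \<partial>lborel)
      = (\<integral>t. indicator {0..1} t * (\<integral>x. A x * B (x - t *\<^sub>R z) \<partial>lborel) \<partial>lborel)"
    and "(\<integral>x. (\<integral>t. indicator {0..1::real} t * A (x + t *\<^sub>R z) \<partial>lborel) * B x \<partial>lborel)
      = (\<integral>t. indicator {0..1} t * (\<integral>x. A x * B (x - t *\<^sub>R z) \<partial>lborel) \<partial>lborel)"
proof -
  have [measurable]: "A \<in> borel_measurable borel" using A by auto
  have "(\<integral>x. A x * (\<integral>t. indicator {0..1::real} t * B (x - t *\<^sub>R z) \<partial>lborel) \<partial>lborel)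
      = (\<integral>x. (\<integral>t. indicator {0..1::real} t * (A x * B (x - t *\<^sub>R z)) \<partial>lborel) \<partial>lborel)"
    by (simp add: mult.left_commute flip: integral_mult_right_zero)
  also have "\<dots> = (\<integral>t. (\<integral>x. indicator {0..1} t * (A x * B (x - t *\<^sub>R z)) \<partial>lborel) \<partial>lborel)"
    using lborel_pair.Fubini_integral[OF integrable_pair_translate(1)[OF assms]] by simp
  finally show "(\<integral>x. A x * (\<integral>t. indicator {0..1::real} t * B (x - t *\<^sub>R z) \<partial>lborel) \<partial>lborel)
      = (\<integral>t. indicator {0..1} t * (\<integral>x. A x * B (x - t *\<^sub>R z) \<partial>lborel) \<partial>lborel)"
    by simp
  have "(\<integral>x. (\<integral>t. indicator {0..1::real} t * A (x + t *\<^sub>R z) \<partial>lborel) * B x \<partial>lborel)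
      = (\<integral>x. (\<integral>t. indicator {0..1::real} t * (A (x + t *\<^sub>R z) * B x) \<partial>lborel) \<partial>lborel)"
    by (simp add: mult.assoc flip: integral_mult_left_zero)
  also have "\<dots> = (\<integral>t. (\<integral>x. indicator {0..1} t * (A (x + t *\<^sub>R z) * B x) \<partial>lborel) \<partial>lborel)"
    using lborel_pair.Fubini_integral[OF integrable_pair_translate(2)[OF assms]] by simp
  also have "\<dots> = (\<integral>t. indicator {0..1} t * (\<integral>x. A (x + t *\<^sub>R z) * B (x + t *\<^sub>R z - t *\<^sub>R z) \<partial>lborel) \<partial>lborel)"
    by simp
  also have "\<dots> = (\<integral>t. indicator {0..1} t * (\<integral>x. A x * B (x - t *\<^sub>R z) \<partial>lborel) \<partial>lborel)"
    by (subst integral_lborel_translate[of "\<lambda>x. A x * B (x - _ *\<^sub>R z)"]) auto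
  finally show "(\<integral>x. (\<integral>t. indicator {0..1::real} t * A (x + t *\<^sub>R z) \<partial>lborel) * B x \<partial>lborel)
      = (\<integral>t. indicator {0..1} t * (\<integral>x. A x * B (x - t *\<^sub>R z) \<partial>lborel) \<partial>lborel)" .
qed

text \<open>With t outside, translation invariance removes the shift for each t, and the unit
  interval contributes the factor 1.\<close>

lemma nn_integral_segment_average:
  fixes A :: "'a::euclidean_space \<Rightarrow> ennreal"
  assumes [measurable]: "A \<in> borel_measurable borel"
  shows "(\<integral>\<^sup>+x. (\<integral>\<^sup>+t. indicator {0..1::real} t * A (x + t *\<^sub>R z) \<partial>lborel) \<partial>lborel) = (\<integral>\<^sup>+x. A x \<partial>lborel)"
proof -
  have "(\<integral>\<^sup>+x. (\<integral>\<^sup>+t. indicator {0..1::real} t * A (x + t *\<^sub>R z) \<partial>lborel) \<partial>lborel)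
      = (\<integral>\<^sup>+t. (\<integral>\<^sup>+x. indicator {0..1::real} t * A (x + t *\<^sub>R z) \<partial>lborel) \<partial>lborel)"
    by (rule lborel_pair.Fubini'[symmetric]) measurable
  also have "\<dots> = (\<integral>\<^sup>+t. indicator {0..1::real} t * (\<integral>\<^sup>+x. A (x + t *\<^sub>R z) \<partial>lborel) \<partial>lborel)"
    by (simp add: nn_integral_cmult)
  also have "\<dots> = (\<integral>\<^sup>+x. A x \<partial>lborel)"
    by (simp add: nn_integral_lborel_translate nn_integral_multc)
  finally show ?thesis .
qed

section \<open>Differences of weakly differentiable functions\<close>

lemma abs_bdist_diff_le: "\<bar>bdist \<Omega> x - bdist \<Omega> y\<bar> \<le> dist x y"
  using infdist_triangle[of x "frontier \<Omega>" y] infdist_triangle[of y "frontier \<Omega>" x]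
  by (simp add: bdist_def dist_commute abs_le_iff)

lemma continuous_on_bdist: "continuous_on S (bdist \<Omega>)"
  unfolding bdist_def by (intro continuous_on_infdist continuous_on_id)

lemma borel_measurable_bdist [measurable]: "bdist \<Omega> \<in> borel_measurable borel"
  using continuous_on_bdist by (rule borel_measurable_continuous_onI)

lemma frontier_ne_empty:
  assumes "bounded_domain \<Omega>"
  shows "frontier \<Omega> \<noteq> {}"
  using assms not_bounded_UNIV by (auto simp: bounded_domain_def frontier_eq_empty)

lemma bdist_pos:
  assumes "bounded_domain \<Omega>" "x \<in> \<Omega>"
  shows "0 < bdist \<Omega> x"
proof -
  have "x \<notin> frontier \<Omega>"
    using assms by (auto simp: bounded_domain_def frontier_def interior_open)
  then show ?thesis
    unfolding bdist_def
    using infdist_pos_not_in_closed[OF frontier_closed frontier_ne_empty[OF assms(1)]] by blast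
qed

text \<open>A segment from x to a point of the ball outside \<Omega> would meet the frontier at
  distance less than \<open>bdist \<Omega> x\<close>.\<close>

lemma ball_bdist_subset:
  assumes "x \<in> \<Omega>"
  shows "ball x (bdist \<Omega> x) \<subseteq> \<Omega>"
proof (rule ccontr)
  assume "\<not> ball x (bdist \<Omega> x) \<subseteq> \<Omega>"
  then obtain y where y: "dist x y < bdist \<Omega> x" "y \<notin> \<Omega>" by (auto simp: ball_def)
  then have "closed_segment x y \<inter> frontier \<Omega> \<noteq> {}"
    using assms by (intro connected_Int_frontier connected_segment) auto
  then obtain w where w: "w \<in> closed_segment x y" "w \<in> frontier \<Omega>" by blast
  have "bdist \<Omega> x \<le> dist x w"
    unfolding bdist_def using w(2) by (rule infdist_le)
  also have "\<dots> \<le> dist x y"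
    using segment_bound(1)[OF w(1)] by (simp add: dist_norm norm_minus_commute)
  finally show False using y(1) by simp
qed

lemma bdist_le_diameter:
  assumes "bounded_domain \<Omega>" "x \<in> \<Omega>"
  shows "bdist \<Omega> x \<le> diameter \<Omega>"
proof -
  obtain w where w: "w \<in> frontier \<Omega>" using frontier_ne_empty[OF assms(1)] by blast
  have "bdist \<Omega> x \<le> dist x w" unfolding bdist_def using w by (rule infdist_le)
  also have "\<dots> \<le> diameter (closure \<Omega>)"
    using assms w closure_subset[of \<Omega>]
    by (intro diameter_bounded_bound) (auto simp: bounded_domain_def frontier_def)
  finally show ?thesis
    using assms by (simp add: diameter_closure bounded_domain_def)
qed

section \<open>Test functions, their translates and directional derivatives\<close>

lemma Ck_continuous_partial:
  assumes "\<And>k. Ck k \<phi>"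
  shows "continuous_on UNIV (\<lambda>x. frechet_derivative \<phi> (at x) v)"
  using assms[of "Suc 0"] by simp

lemma frechet_derivative_zero_outside:
  assumes "x \<notin> closure {x. \<phi> x \<noteq> 0}"
  shows "frechet_derivative \<phi> (at x) v = 0"
proof -
  have "((\<lambda>x. 0) has_derivative (\<lambda>v. 0)) (at x)" by simp
  then have "(\<phi> has_derivative (\<lambda>v. 0)) (at x)"
    by (rule has_derivative_transform_within_open[of _ _ _ _ "- closure {x. \<phi> x \<noteq> 0}"])
      (use assms closure_subset[of "{x. \<phi> x \<noteq> 0}"] in auto)
  then show ?thesis
    by (simp add: frechet_derivative_at[symmetric])
qed

lemma bounded_if_zero_outside_compact:
  fixes f :: "'a::euclidean_space \<Rightarrow> real"
  assumes "continuous_on UNIV f" "compact C" "\<And>x. x \<notin> C \<Longrightarrow> f x = 0"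
  obtains M where "\<And>x. \<bar>f x\<bar> \<le> M" "0 \<le> M"
proof -
  have "bounded (f ` C)"
    using assms by (intro compact_imp_bounded compact_continuous_image) (auto intro: continuous_on_subset)
  then obtain M where "\<And>x. x \<in> C \<Longrightarrow> \<bar>f x\<bar> \<le> M" "0 < M"
    by (auto simp: bounded_pos)
  then show thesis
    using that[of M] assms(3) by (metis abs_zero less_eq_real_def)
qed

text \<open>The support lies where the boundary distance exceeds |z|, so moving it by at most |z|
  keeps it inside \<Omega>. This is why identities for differences are localised to that
  set.\<close>

lemma test_function_translate:
  assumes t: "test_function {x \<in> \<Omega>. norm z < bdist \<Omega> x} \<phi>" and "\<bar>t\<bar> \<le> 1"
  shows "test_function \<Omega> (\<lambda>x. \<phi> (x - t *\<^sub>R z))"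
proof -
  let ?K = "closure {x. \<phi> x \<noteq> 0}"
  have "{x. \<phi> (x - t *\<^sub>R z) \<noteq> 0} = (+) (t *\<^sub>R z) ` {x. \<phi> x \<noteq> 0}"
    by (auto simp: image_iff intro!: exI[of _ "_ - t *\<^sub>R z"])
  then have cl: "closure {x. \<phi> (x - t *\<^sub>R z) \<noteq> 0} = (+) (t *\<^sub>R z) ` ?K"
    by (simp add: closure_translation)
  have "t *\<^sub>R z + x \<in> \<Omega>" if "x \<in> ?K" for x
  proof -
    have x: "x \<in> \<Omega>" "norm z < bdist \<Omega> x" using that t by (auto simp: test_function_def)
    have "norm (t *\<^sub>R z) \<le> norm z" using assms(2) by (simp add: mult_left_le_one_le)
    then show ?thesis
      using ball_bdist_subset[OF x(1)] x(2) by (auto simp: subset_eq dist_norm)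
  qed
  then show ?thesis
    using t Ck_translate[of _ \<phi> "- (t *\<^sub>R z)"] unfolding test_function_def cl
    by (auto intro: compact_translation)
qed

lemma frechet_derivative_translate:
  assumes "\<And>k. Ck k \<phi>"
  shows "frechet_derivative (\<lambda>x. \<phi> (x - c)) (at x) v = frechet_derivative \<phi> (at (x - c)) v"
proof -
  have "((\<lambda>x. \<phi> (x - c)) has_derivative frechet_derivative \<phi> (at (x - c))) (at x)"
    by (rule has_derivative_compose[of "\<lambda>x. x - c" "\<lambda>v. v" x UNIV \<phi>, OF _ Ck_Suc_has_derivative[OF assms]])
      (auto intro!: derivative_eq_intros)
  then show ?thesis
    by (simp add: frechet_derivative_at[symmetric])
qed

lemma Ck_partial_expand:
  assumes "\<And>k. Ck k \<phi>"
  shows "frechet_derivative \<phi> (at x) z = (\<Sum>i\<in>Basis. (z \<bullet> i) * frechet_derivative \<phi> (at x) i)"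
proof -
  have "linear (frechet_derivative \<phi> (at x))"
    using Ck_Suc_has_derivative[OF assms, of x] by (simp add: has_derivative_def bounded_linear.linear)
  then have "frechet_derivative \<phi> (at x) (\<Sum>i\<in>Basis. (z \<bullet> i) *\<^sub>R i) = (\<Sum>i\<in>Basis. (z \<bullet> i) * frechet_derivative \<phi> (at x) i)"
    by (simp add: linear_sum linear_cmul)
  then show ?thesis by (simp add: euclidean_representation)
qed

lemma FTC_segment:
  assumes "\<And>k. Ck k \<phi>"
  shows "(\<integral>t. indicator {0..1::real} t * frechet_derivative \<phi> (at (x - t *\<^sub>R z)) z \<partial>lborel) = \<phi> x - \<phi> (x - z)"
proof -
  have "((\<lambda>t. \<phi> (x - t *\<^sub>R z)) has_vector_derivative - frechet_derivative \<phi> (at (x - t *\<^sub>R z)) z) (at t within {0..1})" for t :: real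
  proof -
    have lin: "linear (frechet_derivative \<phi> (at (x - t *\<^sub>R z)))"
      using Ck_Suc_has_derivative[OF assms] by (simp add: has_derivative_def bounded_linear.linear)
    have "((\<lambda>t. \<phi> (x - t *\<^sub>R z)) has_derivative (\<lambda>h. frechet_derivative \<phi> (at (x - t *\<^sub>R z)) (- (h *\<^sub>R z)))) (at t within {0..1})"
      by (rule has_derivative_compose[OF _ Ck_Suc_has_derivative[OF assms]])
        (auto intro!: derivative_eq_intros)
    then show ?thesis
      by (simp add: has_vector_derivative_def linear_neg[OF lin] linear_cmul[OF lin])
  qed
  moreover have "continuous_on {0..1} (\<lambda>t. - frechet_derivative \<phi> (at (x - t *\<^sub>R z)) z)"
    by (intro continuous_on_minus continuous_on_compose2[OF Ck_continuous_partial[OF assms]] continuous_intros) auto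
  ultimately have "(\<integral>t. indicator {0..1::real} t *\<^sub>R (- frechet_derivative \<phi> (at (x - t *\<^sub>R z)) z) \<partial>lborel) = \<phi> (x - 1 *\<^sub>R z) - \<phi> (x - 0 *\<^sub>R z)"
    by (intro integral_FTC_Icc) auto
  then show ?thesis by (simp add: algebra_simps)
qed

lemma integral_test_lborel:
  fixes u :: "'a::euclidean_space \<Rightarrow> real"
  assumes "open U" "u \<in> borel_measurable borel" "\<phi> \<in> borel_measurable borel" "\<And>x. x \<notin> U \<Longrightarrow> \<phi> x = 0"
  shows "(\<integral>x. u x * \<phi> x \<partial>lebesgue_on U) = (\<integral>x. u x * \<phi> x \<partial>lborel)"
proof -
  have "(\<lambda>x. indicator U x * (u x * \<phi> x)) = (\<lambda>x. u x * \<phi> x)"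
    using assms(4) by (auto simp: indicator_def fun_eq_iff)
  then show ?thesis
    using assms(1-3) by (simp add: integral_lebesgue_on integral_completion)
qed

lemma test_functionD:
  assumes "test_function U \<phi>"
  shows "\<And>k. Ck k \<phi>" "continuous_on UNIV \<phi>" "\<phi> \<in> borel_measurable borel" "\<And>x. x \<notin> U \<Longrightarrow> \<phi> x = 0"
  "compact (closure {x. \<phi> x \<noteq> 0})" "closure {x. \<phi> x \<noteq> 0} \<subseteq> U"
proof -
  show *: "\<And>k. Ck k \<phi>" "compact (closure {x. \<phi> x \<noteq> 0})" "closure {x. \<phi> x \<noteq> 0} \<subseteq> U"
    using assms by (auto simp: test_function_def)
  then show "continuous_on UNIV \<phi>" by (intro Ck_continuous)
  then show "\<phi> \<in> borel_measurable borel" by (rule borel_measurable_continuous_onI)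
  show "\<phi> x = 0" if "x \<notin> U" for x
    using * closure_subset[of "{x. \<phi> x \<noteq> 0}"] that by auto
qed

text \<open>
  Testing the difference of both sides against \<open>\<phi>\<close> and moving the translations to \<open>\<phi>\<close> leaves the weak
  derivative tested against the translates of \<open>\<phi>\<close>, so the fundamental lemma applies.
\<close>

lemma translate_eq_integral_weak_derivative:
  fixes H :: "'a::euclidean_space \<Rightarrow> real" and G :: "'a \<Rightarrow> 'a \<Rightarrow> real"
  assumes "open \<Omega>" and H: "integrable lborel H" and G: "\<And>i. i \<in> Basis \<Longrightarrow> integrable lborel (G i)"
    and weak: "\<And>i \<psi>. i \<in> Basis \<Longrightarrow> test_function \<Omega> \<psi> \<Longrightarrow>
      (\<integral>x. H x * frechet_derivative \<psi> (at x) i \<partial>lborel) = - (\<integral>x. G i x * \<psi> x \<partial>lborel)"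
  shows "AE x in lborel. x \<in> \<Omega> \<longrightarrow> norm z < bdist \<Omega> x \<longrightarrow>
    H (x + z) - H x = (\<integral>t. indicator {0..1::real} t * (\<Sum>i\<in>Basis. (z \<bullet> i) * G i (x + t *\<^sub>R z)) \<partial>lborel)"
proof -
  define U where "U = {x \<in> \<Omega>. norm z < bdist \<Omega> x}"
  have U: "open U"
  proof -
    have "open {x. norm z < bdist \<Omega> x}"
      by (intro open_Collect_less continuous_on_const continuous_on_bdist)
    moreover have "U = \<Omega> \<inter> {x. norm z < bdist \<Omega> x}" by (auto simp: U_def)
    ultimately show ?thesis using assms(1) by auto
  qed
  define W where "W x = (\<Sum>i\<in>Basis. (z \<bullet> i) * G i x)" for x
  have W: "integrable lborel W" unfolding W_def using G by auto
  have [measurable]: "H \<in> borel_measurable borel" "W \<in> borel_measurable borel" using H W by auto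
  define V where "V x = (\<integral>t. indicator {0..1::real} t * W (x + t *\<^sub>R z) \<partial>lborel)" for x
  have [measurable]: "V \<in> borel_measurable borel"
    unfolding V_def by measurable
  have V: "integrable lborel V"
    using lborel_pair.integrable_fst[OF integrable_pair_translate(2)[OF W, of "\<lambda>x. 1" 1 z]]
    unfolding V_def by simp
  define u where "u x = H (x + z) - H x - V x" for x
  have u: "integrable lborel u"
    unfolding u_def using H V by (intro Bochner_Integration.integrable_diff integrable_lborel_translate) auto
  have [measurable]: "u \<in> borel_measurable borel" unfolding u_def by measurable
  have "AE x in lebesgue_on U. u x = 0"
  proof (rule fundamental_lemma[OF U])
    show "locally_integrable U u"
      unfolding locally_integrable_def
    proof (intro allI impI)
      fix C assume "compact C \<and> C \<subseteq> U"
      then have "C \<in> sets lborel" by (simp add: compact_imp_closed)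
      moreover from this have "integrable lborel (\<lambda>x. indicator C x * u x)"
        using integrable_mult_indicator[OF _ u] by force
      ultimately show "integrable (lebesgue_on C) u"
        by (simp add: integrable_lebesgue_on_iff integrable_completion)
    qed
  next
    fix \<phi> assume \<phi>: "test_function U \<phi>"
    note \<phi>D = test_functionD[OF \<phi>]
    note [measurable] = \<phi>D(3)
    obtain M where M: "\<And>x. \<bar>\<phi> x\<bar> \<le> M"
      using bounded_if_zero_outside_compact[OF \<phi>D(2) \<phi>D(5)] closure_subset[of "{x. \<phi> x \<noteq> 0}"]
      by (metis (mono_tags, lifting) mem_Collect_eq subsetD)
    let ?D = "\<lambda>x. frechet_derivative \<phi> (at x) z"
    have [measurable]: "?D \<in> borel_measurable borel"
      by (intro borel_measurable_continuous_onI Ck_continuous_partial \<phi>D(1))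
    obtain M' where M': "\<And>x. \<bar>?D x\<bar> \<le> M'"
      using bounded_if_zero_outside_compact[OF Ck_continuous_partial[OF \<phi>D(1)] \<phi>D(5)] frechet_derivative_zero_outside
      by metis
    have int: "integrable lborel (\<lambda>x. A x * B x)" if "integrable lborel A" "B \<in> borel_measurable borel" "\<And>x. \<bar>B x\<bar> \<le> C"
      for A B :: "'a \<Rightarrow> real" and C
    proof (rule Bochner_Integration.integrable_bound[of lborel "\<lambda>x. C * A x"])
      show "AE x in lborel. norm (A x * B x) \<le> norm (C * A x)"
      proof (rule AE_I2)
        fix x
        have "\<bar>B x\<bar> \<le> \<bar>C\<bar>" using that(3)[of x] by linarith
        then show "norm (A x * B x) \<le> norm (C * A x)" by (simp add: abs_mult mult.commute[of "\<bar>C\<bar>"] mult_left_mono)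
      qed
    qed (use that in auto)
    have i1: "integrable lborel (\<lambda>x. H (x + z) * \<phi> x)"
      using M by (intro int integrable_lborel_translate H) auto
    have i2: "integrable lborel (\<lambda>x. H x * \<phi> x)" using M by (intro int H) auto
    have i3: "integrable lborel (\<lambda>x. V x * \<phi> x)" using M by (intro int V) auto
    have i4: "integrable lborel (\<lambda>x. H x * \<phi> (x - z))"
      using M by (intro int[where C = M] H) auto
    \<comment> \<open>Each translate of \<phi> by a fraction of z is a test function on \<Omega>, so
      the weak derivatives may be tested against it; the directional derivative is first expanded in
      coordinates.\<close>
    have eqt: "(\<integral>x. H x * ?D (x - t *\<^sub>R z) \<partial>lborel) = - (\<integral>x. W x * \<phi> (x - t *\<^sub>R z) \<partial>lborel)" if "t \<in> {0..1}" for t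
    proof -
      let ?\<psi> = "\<lambda>x. \<phi> (x - t *\<^sub>R z)"
      have \<psi>: "test_function \<Omega> ?\<psi>"
        using \<phi> that unfolding U_def by (intro test_function_translate) auto
      note \<psi>D = test_functionD[OF \<psi>]
      have bd: "\<exists>C. \<forall>x. \<bar>frechet_derivative ?\<psi> (at x) i\<bar> \<le> C" for i
        using bounded_if_zero_outside_compact[OF Ck_continuous_partial[OF \<psi>D(1)] \<psi>D(5)] frechet_derivative_zero_outside
        by metis
      have "(\<integral>x. H x * ?D (x - t *\<^sub>R z) \<partial>lborel) = (\<integral>x. H x * frechet_derivative ?\<psi> (at x) z \<partial>lborel)"
        by (simp add: frechet_derivative_translate[OF \<phi>D(1)])
      also have "\<dots> = (\<integral>x. (\<Sum>i\<in>Basis. (z \<bullet> i) * (H x * frechet_derivative ?\<psi> (at x) i)) \<partial>lborel)"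
        by (subst Ck_partial_expand[OF \<psi>D(1)]) (simp add: sum_distrib_left mult_ac)
      also have "\<dots> = (\<Sum>i\<in>Basis. (z \<bullet> i) * (\<integral>x. H x * frechet_derivative ?\<psi> (at x) i \<partial>lborel))"
      proof -
        have "integrable lborel (\<lambda>x. H x * frechet_derivative ?\<psi> (at x) i)" for i
          using bd[of i] by (elim exE)
            (rule int[OF H], auto intro!: borel_measurable_continuous_onI Ck_continuous_partial \<psi>D(1))
        then show ?thesis by simp
      qed
      also have "\<dots> = (\<Sum>i\<in>Basis. (z \<bullet> i) * - (\<integral>x. G i x * ?\<psi> x \<partial>lborel))"
        using weak[OF _ \<psi>] by simp
      also have "\<dots> = - (\<Sum>i\<in>Basis. (z \<bullet> i) * (\<integral>x. G i x * ?\<psi> x \<partial>lborel))"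
        by (simp add: sum_negf)
      also have "(\<Sum>i\<in>Basis. (z \<bullet> i) * (\<integral>x. G i x * ?\<psi> x \<partial>lborel)) = (\<integral>x. W x * ?\<psi> x \<partial>lborel)"
      proof -
        have "integrable lborel (\<lambda>x. G i x * ?\<psi> x)" if "i \<in> Basis" for i
          using M G[OF that] by (intro int[where C = M]) auto
        then have "(\<Sum>i\<in>Basis. (z \<bullet> i) * (\<integral>x. G i x * ?\<psi> x \<partial>lborel)) = (\<integral>x. (\<Sum>i\<in>Basis. (z \<bullet> i) * (G i x * ?\<psi> x)) \<partial>lborel)"
          by simp
        then show ?thesis by (simp add: W_def sum_distrib_right mult.assoc)
      qed
      finally show ?thesis .
    qed
    have "(\<integral>x. H (x + z) * \<phi> x \<partial>lborel) = (\<integral>x. H (x + z) * \<phi> (x + z - z) \<partial>lborel)"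
      by simp
    also have "\<dots> = (\<integral>x. H x * \<phi> (x - z) \<partial>lborel)"
      by (subst integral_lborel_translate[of "\<lambda>x. H x * \<phi> (x - z)"]) auto
    finally have "(\<integral>x. H (x + z) * \<phi> x \<partial>lborel) - (\<integral>x. H x * \<phi> x \<partial>lborel) = - (\<integral>x. H x * (\<phi> x - \<phi> (x - z)) \<partial>lborel)"
      using i2 i4 by (simp add: algebra_simps)
    \<comment> \<open>Writing \<phi> x - \<phi> (x - z) as the integral of the directional
      derivative along the segment allows the identity for each t to be inserted.\<close>
    also have "(\<integral>x. H x * (\<phi> x - \<phi> (x - z)) \<partial>lborel) = (\<integral>t. indicator {0..1} t * (\<integral>x. H x * ?D (x - t *\<^sub>R z) \<partial>lborel) \<partial>lborel)"
      unfolding FTC_segment[OF \<phi>D(1), symmetric] by (rule integral_translate_swap(1)[OF H _ M']) measurable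
    also have "\<dots> = (\<integral>t. - (indicator {0..1} t * (\<integral>x. W x * \<phi> (x - t *\<^sub>R z) \<partial>lborel)) \<partial>lborel)"
      using eqt by (intro Bochner_Integration.integral_cong) (auto simp: indicator_def)
    also have "\<dots> = - (\<integral>x. V x * \<phi> x \<partial>lborel)"
      unfolding V_def using integral_translate_swap(2)[OF W _ M, where z = z] by simp
    finally have "(\<integral>x. u x * \<phi> x \<partial>lborel) = 0"
      unfolding u_def using i1 i2 i3 by (simp add: algebra_simps)
    then show "(\<integral>x. u x * \<phi> x \<partial>lebesgue_on U) = 0"
      using integral_test_lborel[OF U _ _ \<phi>D(4)] by simp
  qed
  then have "AE x in lborel. x \<in> U \<longrightarrow> u x = 0"
    using U by (subst (asm) AE_restrict_space_iff) (auto simp: AE_completion_iff)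
  then show ?thesis
    by eventually_elim (auto simp: U_def u_def V_def W_def)
qed

section \<open>Lebesgue and Sobolev norms\<close>

text \<open>The p-th power of the norm as a nonnegative integral over \<open>lborel\<close>: it
  makes sense for every function, and finiteness can be stated and summed in \<open>ennreal\<close>
  before membership in \<open>Lp_space\<close> is known.\<close>

definition Lp_power :: "real \<Rightarrow> 'a::euclidean_space set \<Rightarrow> ('a \<Rightarrow> real) \<Rightarrow> ennreal" where
  "Lp_power p \<Omega> f = (\<integral>\<^sup>+x. indicator \<Omega> x * ennreal (\<bar>f x\<bar> powr p) \<partial>lborel)"

lemma Lp_power_cong:
  assumes "AE x in lborel. x \<in> \<Omega> \<longrightarrow> f x = F x"
  shows "Lp_power p \<Omega> f = Lp_power p \<Omega> F"
  unfolding Lp_power_def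
  by (rule nn_integral_cong_AE) (use assms in eventually_elim, auto simp: indicator_def)

lemma nn_integral_lebesgue_on:
  assumes "\<Omega> \<in> sets lebesgue"
  shows "(\<integral>\<^sup>+x. f x \<partial>lebesgue_on \<Omega>) = (\<integral>\<^sup>+x. indicator \<Omega> x * f x \<partial>lborel)"
  using assms by (subst nn_integral_restrict_space) (auto simp: nn_integral_completion mult.commute)

lemma Lp_space_iff:
  assumes "\<Omega> \<in> sets lebesgue"
  shows "f \<in> Lp_space p \<Omega> \<longleftrightarrow> f \<in> borel_measurable (lebesgue_on \<Omega>) \<and> Lp_power p \<Omega> f < \<infinity>"
proof -
  have "integrable (lebesgue_on \<Omega>) (\<lambda>x. \<bar>f x\<bar> powr p) \<longleftrightarrow> Lp_power p \<Omega> f < \<infinity>"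
    if [measurable]: "f \<in> borel_measurable (lebesgue_on \<Omega>)"
    using that unfolding Lp_power_def nn_integral_lebesgue_on[OF assms, symmetric]
    by (subst integrable_iff_bounded) auto
  then show ?thesis
    unfolding Lp_space_def by auto
qed

lemma Lp_norm_powr:
  assumes "\<Omega> \<in> sets lebesgue" "f \<in> Lp_space p \<Omega>" "0 < p"
  shows "ennreal (Lp_norm p \<Omega> f powr p) = Lp_power p \<Omega> f"
proof -
  have "Lp_norm p \<Omega> f powr p = (\<integral>x. \<bar>f x\<bar> powr p \<partial>lebesgue_on \<Omega>)"
    using assms(3) by (simp add: Lp_norm_def powr_powr Bochner_Integration.integral_nonneg)
  then have "ennreal (Lp_norm p \<Omega> f powr p) = (\<integral>\<^sup>+x. ennreal (\<bar>f x\<bar> powr p) \<partial>lebesgue_on \<Omega>)"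
    using assms(2) by (simp add: nn_integral_eq_integral Lp_space_def)
  then show ?thesis
    unfolding Lp_power_def nn_integral_lebesgue_on[OF assms(1)] .
qed

lemma Lp_norm_nonneg: "0 \<le> Lp_norm p \<Omega> f"
  by (simp add: Lp_norm_def)

lemma W1p_norm_nonneg: "0 \<le> W1p_norm p \<Omega> f"
  by (simp add: W1p_norm_def)

lemma Lp_power_zero_outside:
  assumes "\<And>x. x \<notin> \<Omega> \<Longrightarrow> F x = 0"
  shows "Lp_power p \<Omega> F = (\<integral>\<^sup>+x. ennreal (\<bar>F x\<bar> powr p) \<partial>lborel)"
  unfolding Lp_power_def by (rule nn_integral_cong) (use assms in \<open>auto simp: indicator_def\<close>)

lemma AE_lebesgue_on_open:
  assumes "open \<Omega>"
  shows "(AE x in lebesgue_on \<Omega>. P x) \<longleftrightarrow> (AE x in lborel. x \<in> \<Omega> \<longrightarrow> P x)"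
  using assms by (subst AE_restrict_space_iff) (auto simp: AE_completion_iff)

text \<open>Translation and Fubini arguments need Borel functions on the whole space; extension by
  zero lets integrals over \<Omega> be taken over everything.\<close>

lemma borel_representative:
  fixes f :: "'a::euclidean_space \<Rightarrow> real"
  assumes \<Omega>: "open \<Omega>" and f: "f \<in> borel_measurable (lebesgue_on \<Omega>)"
  obtains F where "F \<in> borel_measurable borel" "\<And>x. x \<notin> \<Omega> \<Longrightarrow> F x = 0"
    "AE x in lborel. x \<in> \<Omega> \<longrightarrow> f x = F x"
proof -
  have "(\<lambda>x. indicator \<Omega> x * f x) \<in> borel_measurable lebesgue"
    using f \<Omega> by (subst (asm) borel_measurable_restrict_space_iff) auto
  then obtain F where F: "F \<in> borel_measurable borel" "AE x in lborel. indicator \<Omega> x * f x = F x"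
    using completion_ex_borel_measurable_real by fastforce
  show thesis
  proof (rule that[of "\<lambda>x. indicator \<Omega> x * F x"])
    show "(\<lambda>x. indicator \<Omega> x * F x) \<in> borel_measurable borel" using F(1) \<Omega> by (intro borel_measurable_times borel_measurable_indicator) auto
    show "AE x in lborel. x \<in> \<Omega> \<longrightarrow> f x = indicator \<Omega> x * F x"
      using F(2) by eventually_elim auto
  qed auto
qed

text \<open>Pointwise |F| \<le> 1 + |F|^p on \<Omega>, a set of finite measure, and F vanishes
  elsewhere.\<close>

lemma integrable_if_Lp_power_finite:
  assumes \<Omega>: "open \<Omega>" "bounded \<Omega>" and p: "1 \<le> p" and F: "F \<in> borel_measurable borel" "\<And>x. x \<notin> \<Omega> \<Longrightarrow> F x = 0"
    and fin: "Lp_power p \<Omega> F < \<infinity>"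
  shows "integrable lborel F"
proof (rule Bochner_Integration.integrable_bound[of lborel "\<lambda>x. indicator \<Omega> x + \<bar>F x\<bar> powr p"])
  have "integrable lborel (\<lambda>x. \<bar>F x\<bar> powr p)"
    using fin F(1) Lp_power_zero_outside[of \<Omega> F p] F(2) by (intro integrableI_nonneg) auto
  moreover have "integrable lborel (indicat_real \<Omega>)"
    using \<Omega> emeasure_bounded_finite[OF \<Omega>(2)] by (intro integrable_real_indicator) auto
  ultimately show "integrable lborel (\<lambda>x. indicator \<Omega> x + \<bar>F x\<bar> powr p)" by auto
  have "norm (F x) \<le> norm (indicator \<Omega> x + \<bar>F x\<bar> powr p)" for x
  proof (cases "x \<in> \<Omega>")
    case True
    have "\<bar>F x\<bar> \<le> 1 + \<bar>F x\<bar> powr p"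
    proof (cases "\<bar>F x\<bar> \<le> 1")
      case False
      then have "\<bar>F x\<bar> powr 1 \<le> \<bar>F x\<bar> powr p" using p by (intro powr_mono) auto
      then show ?thesis using False by simp
    qed (simp add: add_increasing2)
    then show ?thesis using True by simp
  qed (simp add: F(2))
  then show "AE x in lborel. norm (F x) \<le> norm (indicator \<Omega> x + \<bar>F x\<bar> powr p)" by simp
qed (use F in auto)

lemma integrable_test_mult:
  fixes g :: "'a::euclidean_space \<Rightarrow> real"
  assumes \<Omega>: "open \<Omega>" and g: "locally_integrable \<Omega> g"
    and \<phi>: "continuous_on UNIV \<phi>" "compact C" "C \<subseteq> \<Omega>" "\<And>x. x \<notin> C \<Longrightarrow> \<phi> x = 0"
  shows "integrable (lebesgue_on \<Omega>) (\<lambda>x. g x * \<phi> x)"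
proof -
  obtain M where M: "\<And>x. \<bar>\<phi> x\<bar> \<le> M" "0 \<le> M"
    by (rule bounded_if_zero_outside_compact[OF \<phi>(1,2,4)]) auto
  have "C \<in> sets lborel" using \<phi>(2) by (simp add: compact_imp_closed)
  then have C: "C \<in> sets lebesgue" by (rule sets_completionI_sets)
  have gC: "integrable lebesgue (\<lambda>x. indicator C x * g x)"
    using g \<phi>(2,3) by (subst integrable_lebesgue_on_iff[OF C, symmetric]) (auto simp: locally_integrable_def)
  have \<phi>m: "\<phi> \<in> borel_measurable lebesgue"
    using borel_measurable_continuous_onI[OF \<phi>(1)] by (intro measurable_completion) simp
  have eq: "(\<lambda>x. indicator \<Omega> x * (g x * \<phi> x)) = (\<lambda>x. (indicator C x * g x) * \<phi> x)"
    using \<phi>(3,4) by (auto simp: indicator_def fun_eq_iff)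
  have "integrable lebesgue (\<lambda>x. (indicator C x * g x) * \<phi> x)"
  proof (rule Bochner_Integration.integrable_bound[of lebesgue "\<lambda>x. M * (indicator C x * g x)"])
    show "AE x in lebesgue. norm ((indicator C x * g x) * \<phi> x) \<le> norm (M * (indicator C x * g x))"
      using M by (intro AE_I2) (auto simp: abs_mult mult.commute[of M] intro!: mult_left_mono)
    show "(\<lambda>x. indicator C x * g x * \<phi> x) \<in> borel_measurable lebesgue"
      using borel_measurable_integrable[OF gC] \<phi>m by (rule borel_measurable_times)
  qed (use gC in auto)
  then show ?thesis
    using \<Omega> by (subst integrable_lebesgue_on_iff) (simp_all add: eq)
qed

text \<open>The difference of two weak derivatives integrates to zero against every test function,
  so the fundamental lemma applies. This makes the choice in \<open>weak_partial\<close>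
  immaterial.\<close>

lemma is_weak_partial_unique:
  assumes \<Omega>: "open \<Omega>" and g: "is_weak_partial \<Omega> i f g" and g': "is_weak_partial \<Omega> i f g'"
  shows "AE x in lborel. x \<in> \<Omega> \<longrightarrow> g x = g' x"
proof -
  have "AE x in lebesgue_on \<Omega>. g x - g' x = 0"
  proof (rule fundamental_lemma[OF \<Omega>])
    show "locally_integrable \<Omega> (\<lambda>x. g x - g' x)"
      using g g' by (auto simp: is_weak_partial_def locally_integrable_def)
    fix \<phi> assume \<phi>: "test_function \<Omega> \<phi>"
    note \<phi>D = test_functionD[OF \<phi>]
    have 0: "\<phi> x = 0" if "x \<notin> closure {x. \<phi> x \<noteq> 0}" for x
      using that closure_subset[of "{x. \<phi> x \<noteq> 0}"] by auto
    have "integrable (lebesgue_on \<Omega>) (\<lambda>x. g x * \<phi> x)" "integrable (lebesgue_on \<Omega>) (\<lambda>x. g' x * \<phi> x)"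
      using g g' unfolding is_weak_partial_def
      by (blast intro: integrable_test_mult[OF \<Omega> _ \<phi>D(2,5,6) 0])+
    moreover have "(\<integral>x. g x * \<phi> x \<partial>lebesgue_on \<Omega>) = (\<integral>x. g' x * \<phi> x \<partial>lebesgue_on \<Omega>)"
    proof -
      have "(\<integral>x. f x * frechet_derivative \<phi> (at x) i \<partial>lebesgue_on \<Omega>) = - (\<integral>x. g x * \<phi> x \<partial>lebesgue_on \<Omega>)"
        "(\<integral>x. f x * frechet_derivative \<phi> (at x) i \<partial>lebesgue_on \<Omega>) = - (\<integral>x. g' x * \<phi> x \<partial>lebesgue_on \<Omega>)"
        using g g' \<phi> unfolding is_weak_partial_def by blast+
      then show ?thesis by simp
    qed
    ultimately show "(\<integral>x. (g x - g' x) * \<phi> x \<partial>lebesgue_on \<Omega>) = 0"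
      by (simp add: left_diff_distrib)
  qed
  then show ?thesis
    by (simp add: AE_lebesgue_on_open[OF \<Omega>])
qed

text \<open>Completeness of Lebesgue measure carries measurability across the exceptional null
  set.\<close>

lemma Lp_space_cong:
  assumes \<Omega>: "open \<Omega>" and f: "f \<in> Lp_space p \<Omega>" and ae: "AE x in lborel. x \<in> \<Omega> \<longrightarrow> f x = g x"
  shows "g \<in> Lp_space p \<Omega>"
proof -
  have "(\<lambda>x. indicator \<Omega> x * f x) \<in> borel_measurable lebesgue"
    using f \<Omega> unfolding Lp_space_def by (auto simp: borel_measurable_restrict_space_iff)
  moreover have "AE x in lebesgue. indicator \<Omega> x * f x = indicator \<Omega> x * g x"
    using AE_completion[OF ae] by eventually_elim (auto simp: indicator_def)
  ultimately have "(\<lambda>x. indicator \<Omega> x * g x) \<in> borel_measurable lebesgue"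
    by (rule borel_measurable_AE)
  then have "g \<in> borel_measurable (lebesgue_on \<Omega>)"
    using \<Omega> by (auto simp: borel_measurable_restrict_space_iff)
  then show ?thesis
    using f \<Omega> Lp_power_cong[OF ae] by (auto simp: Lp_space_iff)
qed

text \<open>The choice operator returns some weak derivative, not necessarily the p-integrable one
  that is known to exist; uniqueness transfers integrability to it.\<close>

lemma weak_partial_in_Lp:
  assumes \<Omega>: "open \<Omega>" and g: "g \<in> Lp_space p \<Omega>" "is_weak_partial \<Omega> i h g"
  shows "weak_partial \<Omega> i h \<in> Lp_space p \<Omega>" "is_weak_partial \<Omega> i h (weak_partial \<Omega> i h)"
    "Lp_power p \<Omega> (weak_partial \<Omega> i h) = Lp_power p \<Omega> g"
proof -
  show *: "is_weak_partial \<Omega> i h (weak_partial \<Omega> i h)"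
    unfolding weak_partial_def by (rule someI[of _ g]) (rule g(2))
  note ae = is_weak_partial_unique[OF \<Omega> g(2) *]
  show "weak_partial \<Omega> i h \<in> Lp_space p \<Omega>"
    by (rule Lp_space_cong[OF \<Omega> g(1) ae])
  show "Lp_power p \<Omega> (weak_partial \<Omega> i h) = Lp_power p \<Omega> g"
    using Lp_power_cong[OF ae] by simp
qed

lemma W1p_norm_powr:
  assumes \<Omega>: "open \<Omega>" and p: "0 < p" and h: "h \<in> W1p_space p \<Omega>"
  shows "ennreal (W1p_norm p \<Omega> h powr p) =
    Lp_power p \<Omega> h + (\<Sum>i\<in>Basis. Lp_power p \<Omega> (weak_partial \<Omega> i h))"
proof -
  have S: "\<Omega> \<in> sets lebesgue" using \<Omega> by simp
  have wp: "weak_partial \<Omega> i h \<in> Lp_space p \<Omega>" if "i \<in> Basis" for i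
    using h that weak_partial_in_Lp(1)[OF \<Omega>] unfolding W1p_space_def by blast
  have "W1p_norm p \<Omega> h powr p = Lp_norm p \<Omega> h powr p + (\<Sum>i\<in>Basis. Lp_norm p \<Omega> (weak_partial \<Omega> i h) powr p)"
    using p by (simp add: W1p_norm_def powr_powr sum_nonneg)
  then show ?thesis
    using h by (simp add: ennreal_plus sum_nonneg sum_ennreal[symmetric] Lp_norm_powr[OF S wp p] Lp_norm_powr[OF S _ p] W1p_space_def)
qed

text \<open>The sum is at most \<open>card I\<close> times its largest term, whose p-th power is one
  of the summands on the right. The constant is cruder than Jensen's but valid for all p \<ge>
  0.\<close>

lemma sum_powr_le:
  fixes a :: "'b \<Rightarrow> real"
  assumes "finite I" "\<And>i. i \<in> I \<Longrightarrow> 0 \<le> a i" "0 \<le> p"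
  shows "(\<Sum>i\<in>I. a i) powr p \<le> real (card I) powr p * (\<Sum>i\<in>I. a i powr p)"
proof (cases "I = {}")
  case False
  define m where "m = Max (a ` I)"
  have m: "a i \<le> m" if "i \<in> I" for i
    unfolding m_def using assms(1) that by auto
  have "m \<in> a ` I"
    unfolding m_def using assms(1) False by (intro Max_in) auto
  then obtain k where k: "k \<in> I" "m = a k"
    by blast
  have "(\<Sum>i\<in>I. a i) \<le> real (card I) * m"
    using sum_bounded_above[of I a m] m by simp
  then have "(\<Sum>i\<in>I. a i) powr p \<le> (real (card I) * m) powr p"
    using assms by (intro powr_mono2) (auto intro: sum_nonneg)
  also have "\<dots> = real (card I) powr p * a k powr p"
    using k assms by (simp add: powr_mult)
  also have "\<dots> \<le> real (card I) powr p * (\<Sum>i\<in>I. a i powr p)"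
    using k assms by (intro mult_left_mono member_le_sum) auto
  finally show ?thesis .
qed simp

lemma abs_add_powr_le:
  fixes a b :: real
  assumes "0 \<le> p"
  shows "\<bar>a + b\<bar> powr p \<le> 2 powr p * (\<bar>a\<bar> powr p + \<bar>b\<bar> powr p)"
proof -
  have "\<bar>a + b\<bar> powr p \<le> (\<Sum>i\<in>{True, False}. if i then \<bar>a\<bar> else \<bar>b\<bar>) powr p"
    using assms by (intro powr_mono2) auto
  also have "\<dots> \<le> real (card {True, False}) powr p * (\<Sum>i\<in>{True, False}. (if i then \<bar>a\<bar> else \<bar>b\<bar>) powr p)"
    using assms by (intro sum_powr_le) auto
  finally show ?thesis by simp
qed

text \<open>The increment of H is the average over t of the derivative in direction z at x + t z.
  Jensen's inequality in t and integration over x then remove both the average and the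
  shift.\<close>

lemma nn_translate_le_weak_derivative:
  fixes H :: "'a::euclidean_space \<Rightarrow> real" and G :: "'a \<Rightarrow> 'a \<Rightarrow> real"
  assumes "open \<Omega>" and p: "1 \<le> p" and H: "integrable lborel H" and G: "\<And>i. i \<in> Basis \<Longrightarrow> integrable lborel (G i)"
    and weak: "\<And>i \<psi>. i \<in> Basis \<Longrightarrow> test_function \<Omega> \<psi> \<Longrightarrow>
      (\<integral>x. H x * frechet_derivative \<psi> (at x) i \<partial>lborel) = - (\<integral>x. G i x * \<psi> x \<partial>lborel)"
  shows "(\<integral>\<^sup>+x. indicator {x \<in> \<Omega>. norm z < bdist \<Omega> x} x * ennreal (\<bar>H (x + z) - H x\<bar> powr p) \<partial>lborel)
    \<le> ennreal ((real DIM('a) * norm z) powr p) * (\<Sum>i\<in>Basis. \<integral>\<^sup>+x. ennreal (\<bar>G i x\<bar> powr p) \<partial>lborel)"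
proof -
  define W where "W x = (\<Sum>i\<in>Basis. (z \<bullet> i) * G i x)" for x
  have [measurable]: "G i \<in> borel_measurable borel" if "i \<in> Basis" for i using G[OF that] by auto
  have [measurable]: "W \<in> borel_measurable borel"
    unfolding W_def by measurable
  have jensen: "ennreal (\<bar>\<integral>t. indicator {0..1::real} t * W (x + t *\<^sub>R z) \<partial>lborel\<bar> powr p)
     \<le> (\<integral>\<^sup>+t. indicator {0..1::real} t * ennreal (\<bar>W (x + t *\<^sub>R z)\<bar> powr p) \<partial>lborel)" for x
  \<comment> \<open>When the integrand is not integrable in t, its Bochner integral is 0 by
    convention and the bound is trivial.\<close>
  proof (cases "integrable lborel (\<lambda>t. indicator {0..1::real} t * W (x + t *\<^sub>R z))")
    case True
    let ?M = "restrict_space lborel {0..1::real}"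
    have "ennreal (1 * \<bar>(\<integral>t. W (x + t *\<^sub>R z) \<partial>?M) / 1\<bar> powr p) \<le> (\<integral>\<^sup>+t. ennreal (\<bar>W (x + t *\<^sub>R z)\<bar> powr p) \<partial>?M)"
      using True p by (intro powr_average_le) (auto simp: emeasure_restrict_space integrable_restrict_space)
    then show ?thesis
      by (simp add: integral_restrict_space nn_integral_restrict_space mult.commute)
  qed (simp add: not_integrable_integral_eq)
  have Wle: "ennreal (\<bar>W x\<bar> powr p) \<le> ennreal ((real DIM('a) * norm z) powr p) * (\<Sum>i\<in>Basis. ennreal (\<bar>G i x\<bar> powr p))" for x
  proof -
    have "\<bar>W x\<bar> \<le> (\<Sum>i\<in>Basis. norm z * \<bar>G i x\<bar>)"
      unfolding W_def by (rule order_trans[OF sum_abs sum_mono]) (auto simp: abs_mult intro!: mult_right_mono Basis_le_norm)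
    then have "\<bar>W x\<bar> powr p \<le> (norm z * (\<Sum>i\<in>Basis. \<bar>G i x\<bar>)) powr p"
      using p by (intro powr_mono2) (auto simp: sum_distrib_left)
    also have "\<dots> = norm z powr p * (\<Sum>i\<in>Basis. \<bar>G i x\<bar>) powr p"
      by (simp add: powr_mult sum_nonneg)
    also have "\<dots> \<le> norm z powr p * (real DIM('a) powr p * (\<Sum>i\<in>Basis. \<bar>G i x\<bar> powr p))"
      using p by (intro mult_left_mono sum_powr_le) auto
    finally have "\<bar>W x\<bar> powr p \<le> (real DIM('a) * norm z) powr p * (\<Sum>i\<in>Basis. \<bar>G i x\<bar> powr p)"
      by (simp add: powr_mult mult_ac)
    then show ?thesis
      by (simp add: ennreal_mult[symmetric] sum_nonneg ennreal_leI)
  qed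
  note ae = translate_eq_integral_weak_derivative[OF assms(1) H G weak, where z = z]
  have "(\<integral>\<^sup>+x. indicator {x \<in> \<Omega>. norm z < bdist \<Omega> x} x * ennreal (\<bar>H (x + z) - H x\<bar> powr p) \<partial>lborel)
    \<le> (\<integral>\<^sup>+x. (\<integral>\<^sup>+t. indicator {0..1::real} t * ennreal (\<bar>W (x + t *\<^sub>R z)\<bar> powr p) \<partial>lborel) \<partial>lborel)"
  proof (rule nn_integral_mono_AE)
    show "AE x in lborel. indicator {x \<in> \<Omega>. norm z < bdist \<Omega> x} x * ennreal (\<bar>H (x + z) - H x\<bar> powr p)
      \<le> (\<integral>\<^sup>+t. indicator {0..1::real} t * ennreal (\<bar>W (x + t *\<^sub>R z)\<bar> powr p) \<partial>lborel)"
      by (rule eventually_mono[OF ae]) (use jensen in \<open>auto simp: indicator_def W_def\<close>)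
  qed
  also have "\<dots> = (\<integral>\<^sup>+x. ennreal (\<bar>W x\<bar> powr p) \<partial>lborel)"
    by (rule nn_integral_segment_average) measurable
  also have "\<dots> \<le> (\<integral>\<^sup>+x. ennreal ((real DIM('a) * norm z) powr p) * (\<Sum>i\<in>Basis. ennreal (\<bar>G i x\<bar> powr p)) \<partial>lborel)"
    by (rule nn_integral_mono) (rule Wle)
  also have "\<dots> = ennreal ((real DIM('a) * norm z) powr p) * (\<Sum>i\<in>Basis. \<integral>\<^sup>+x. ennreal (\<bar>G i x\<bar> powr p) \<partial>lborel)"
    by (subst nn_integral_cmult) (auto simp: nn_integral_sum simp del: sum_ennreal)
  finally show ?thesis .
qed

text \<open>Borel representatives of h and of its weak derivatives, zero off \<Omega>, leave the
  pairings with test functions and the norms unchanged, so the preceding estimate applies to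
  them.\<close>

lemma nn_translate_le_W1p_norm:
  fixes h :: "'a::euclidean_space \<Rightarrow> real"
  assumes \<Omega>: "open \<Omega>" "bounded \<Omega>" and p: "1 \<le> p" and h: "h \<in> W1p_space p \<Omega>"
    and H: "H \<in> borel_measurable borel" "\<And>x. x \<notin> \<Omega> \<Longrightarrow> H x = 0" "AE x in lborel. x \<in> \<Omega> \<longrightarrow> h x = H x"
  shows "(\<integral>\<^sup>+x. indicator {x \<in> \<Omega>. norm z < bdist \<Omega> x} x * ennreal (\<bar>H (x + z) - H x\<bar> powr p) \<partial>lborel)
    \<le> ennreal ((real DIM('a) * norm z * W1p_norm p \<Omega> h) powr p)"
proof -
  have S: "\<Omega> \<in> sets lebesgue" using \<Omega> by simp
  have hL: "h \<in> Lp_space p \<Omega>" using h by (simp add: W1p_space_def)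
  have intH: "integrable lborel H"
    using hL Lp_power_cong[OF H(3)] by (intro integrable_if_Lp_power_finite[OF \<Omega> p H(1,2)]) (auto simp: Lp_space_iff[OF S])
  let ?w = "\<lambda>i. weak_partial \<Omega> i h"
  have w: "?w i \<in> Lp_space p \<Omega>" "is_weak_partial \<Omega> i h (?w i)" if "i \<in> Basis" for i
    using h that weak_partial_in_Lp(1,2)[OF \<Omega>(1)] unfolding W1p_space_def by blast+
  have "\<exists>G. G \<in> borel_measurable borel \<and> (\<forall>x. x \<notin> \<Omega> \<longrightarrow> G x = 0) \<and> (AE x in lborel. x \<in> \<Omega> \<longrightarrow> ?w i x = G x)" if "i \<in> Basis" for i
  proof -
    have "?w i \<in> borel_measurable (lebesgue_on \<Omega>)" using w(1)[OF that] by (simp add: Lp_space_def)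
    from borel_representative[OF \<Omega>(1) this] show ?thesis by metis
  qed
  then obtain G where G: "\<And>i. i \<in> Basis \<Longrightarrow> G i \<in> borel_measurable borel" "\<And>i x. i \<in> Basis \<Longrightarrow> x \<notin> \<Omega> \<Longrightarrow> G i x = 0"
    "\<And>i. i \<in> Basis \<Longrightarrow> AE x in lborel. x \<in> \<Omega> \<longrightarrow> ?w i x = G i x" by metis
  have pG: "Lp_power p \<Omega> (?w i) = Lp_power p \<Omega> (G i)" if "i \<in> Basis" for i
    by (rule Lp_power_cong[OF G(3)[OF that]])
  have intG: "integrable lborel (G i)" if "i \<in> Basis" for i
    using w(1)[OF that] pG[OF that]
    by (intro integrable_if_Lp_power_finite[OF \<Omega> p G(1,2)[OF that]]) (auto simp: Lp_space_iff[OF S])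
  have conv: "(\<integral>x. k x * \<psi> x \<partial>lebesgue_on \<Omega>) = (\<integral>x. K x * \<psi> x \<partial>lborel)"
    if "k \<in> borel_measurable (lebesgue_on \<Omega>)" "K \<in> borel_measurable borel" "AE x in lborel. x \<in> \<Omega> \<longrightarrow> k x = K x"
      "continuous_on UNIV \<psi>" "\<And>x. x \<notin> \<Omega> \<Longrightarrow> \<psi> x = 0" for k K \<psi> :: "'a \<Rightarrow> real"
  proof -
    have m: "\<psi> \<in> borel_measurable borel" using that(4) by (rule borel_measurable_continuous_onI)
    have "(\<integral>x. k x * \<psi> x \<partial>lebesgue_on \<Omega>) = (\<integral>x. K x * \<psi> x \<partial>lebesgue_on \<Omega>)"
    proof (rule integral_cong_AE)
      have r: "g \<in> borel_measurable (lebesgue_on \<Omega>)" if "g \<in> borel_measurable borel" for g :: "'a \<Rightarrow> real"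
        using that by (intro measurable_restrict_space1 measurable_completion) simp
      show "(\<lambda>x. k x * \<psi> x) \<in> borel_measurable (lebesgue_on \<Omega>)" "(\<lambda>x. K x * \<psi> x) \<in> borel_measurable (lebesgue_on \<Omega>)"
        using r[OF m] r[OF that(2)] that(1) by auto
      show "AE x in lebesgue_on \<Omega>. k x * \<psi> x = K x * \<psi> x"
        unfolding AE_lebesgue_on_open[OF \<Omega>(1)] using that(3) by eventually_elim auto
    qed
    then show ?thesis using integral_test_lborel[OF \<Omega>(1) that(2) m that(5)] by simp
  qed
  have weak: "(\<integral>x. H x * frechet_derivative \<psi> (at x) i \<partial>lborel) = - (\<integral>x. G i x * \<psi> x \<partial>lborel)"
    if i: "i \<in> Basis" and \<psi>: "test_function \<Omega> \<psi>" for i \<psi>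
  proof -
    note \<psi>D = test_functionD[OF \<psi>]
    have "(\<integral>x. H x * frechet_derivative \<psi> (at x) i \<partial>lborel) = (\<integral>x. h x * frechet_derivative \<psi> (at x) i \<partial>lebesgue_on \<Omega>)"
    proof (rule conv[symmetric, OF _ H(1,3) Ck_continuous_partial[OF \<psi>D(1)]])
      show "h \<in> borel_measurable (lebesgue_on \<Omega>)" using hL by (simp add: Lp_space_def)
      show "frechet_derivative \<psi> (at x) i = 0" if "x \<notin> \<Omega>" for x
        using \<psi>D(6) that by (intro frechet_derivative_zero_outside) auto
    qed
    also have "\<dots> = - (\<integral>x. ?w i x * \<psi> x \<partial>lebesgue_on \<Omega>)"
      using w(2)[OF i] \<psi> by (simp add: is_weak_partial_def)
    also have "(\<integral>x. ?w i x * \<psi> x \<partial>lebesgue_on \<Omega>) = (\<integral>x. G i x * \<psi> x \<partial>lborel)"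
      using w(1)[OF i] by (intro conv G i \<psi>D) (simp add: Lp_space_def)
    finally show ?thesis .
  qed
  have "(\<integral>\<^sup>+x. indicator {x \<in> \<Omega>. norm z < bdist \<Omega> x} x * ennreal (\<bar>H (x + z) - H x\<bar> powr p) \<partial>lborel)
    \<le> ennreal ((real DIM('a) * norm z) powr p) * (\<Sum>i\<in>Basis. \<integral>\<^sup>+x. ennreal (\<bar>G i x\<bar> powr p) \<partial>lborel)"
    by (rule nn_translate_le_weak_derivative[OF \<Omega>(1) p intH intG weak])
  also have "(\<Sum>i\<in>Basis. \<integral>\<^sup>+x. ennreal (\<bar>G i x\<bar> powr p) \<partial>lborel) = (\<Sum>i\<in>Basis. Lp_power p \<Omega> (?w i))"
    using pG G(2) by (intro sum.cong) (auto simp: Lp_power_zero_outside)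
  also have "\<dots> \<le> ennreal (W1p_norm p \<Omega> h powr p)"
    using p by (subst W1p_norm_powr[OF \<Omega>(1) _ h]) auto
  finally show ?thesis
    by (auto simp: ennreal_mult[symmetric] powr_mult W1p_norm_nonneg mult_left_mono elim!: order_trans)
qed

section \<open>The K-functional at dyadic scales\<close>

abbreviation K_set :: "real \<Rightarrow> 'a::euclidean_space set \<Rightarrow> real \<Rightarrow> ('a \<Rightarrow> real) \<Rightarrow> real set" where
  "K_set p \<Omega> l f \<equiv> {Lp_norm p \<Omega> g + l * W1p_norm p \<Omega> h | g h.
            decomposes \<Omega> f g h \<and> g \<in> Lp_space p \<Omega> \<and> h \<in> W1p_space p \<Omega>}"

lemma K_set_bdd_below: "0 \<le> l \<Longrightarrow> bdd_below (K_set p \<Omega> l f)"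
  by (rule bdd_belowI[of _ 0]) (auto simp: Lp_norm_nonneg W1p_norm_nonneg)

lemma K_set_memI:
  assumes "decomposes \<Omega> f g h" "g \<in> Lp_space p \<Omega>" "h \<in> W1p_space p \<Omega>"
  shows "Lp_norm p \<Omega> g + l * W1p_norm p \<Omega> h \<in> K_set p \<Omega> l f"
  by (intro CollectI exI[of _ g] exI[of _ h] conjI refl assms)

lemma K_functional_le:
  assumes "decomposes \<Omega> f g h" "g \<in> Lp_space p \<Omega>" "h \<in> W1p_space p \<Omega>" "0 \<le> l"
  shows "K_functional p \<Omega> l f \<le> Lp_norm p \<Omega> g + l * W1p_norm p \<Omega> h"
  unfolding K_functional_def by (rule cInf_lower[OF K_set_memI[OF assms(1-3)] K_set_bdd_below[OF assms(4)]])

lemma K_functional_nonneg: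
  assumes "decomposes \<Omega> f g h" "g \<in> Lp_space p \<Omega>" "h \<in> W1p_space p \<Omega>" "0 \<le> l"
  shows "0 \<le> K_functional p \<Omega> l f"
  unfolding K_functional_def
proof (rule cInf_greatest)
  show "K_set p \<Omega> l f \<noteq> {}" using K_set_memI[OF assms(1-3)] by (rule ex_in_conv[THEN iffD1, OF exI])
qed (use assms(4) in \<open>auto simp: Lp_norm_nonneg W1p_norm_nonneg\<close>)

text \<open>The infimum over decompositions may fail to be attained, hence the slack e; the given
  decomposition ensures that it is taken over a nonempty set.\<close>

lemma K_functional_near:
  assumes "decomposes \<Omega> f g h" "g \<in> Lp_space p \<Omega>" "h \<in> W1p_space p \<Omega>" "0 < e"
  obtains g' h' where "decomposes \<Omega> f g' h'" "g' \<in> Lp_space p \<Omega>" "h' \<in> W1p_space p \<Omega>"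
    "Lp_norm p \<Omega> g' + l * W1p_norm p \<Omega> h' < K_functional p \<Omega> l f + e"
proof -
  have ne: "K_set p \<Omega> l f \<noteq> {}" using K_set_memI[OF assms(1-3)] by (rule ex_in_conv[THEN iffD1, OF exI])
  have "Inf (K_set p \<Omega> l f) < K_functional p \<Omega> l f + e"
    using assms(4) unfolding K_functional_def by simp
  from cInf_lessD[OF ne this] obtain v where "v \<in> K_set p \<Omega> l f" "v < K_functional p \<Omega> l f + e"
    by blast
  then show thesis using that by blast
qed

lemma K_functional_mono:
  assumes "decomposes \<Omega> f g h" "g \<in> Lp_space p \<Omega>" "h \<in> W1p_space p \<Omega>" "0 \<le> l" "l \<le> l'"
  shows "K_functional p \<Omega> l f \<le> K_functional p \<Omega> l' f"
  unfolding K_functional_def[of p \<Omega> l']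
proof (rule cInf_greatest)
  show "K_set p \<Omega> l' f \<noteq> {}" using K_set_memI[OF assms(1-3)] by (rule ex_in_conv[THEN iffD1, OF exI])
  fix v assume "v \<in> K_set p \<Omega> l' f"
  then obtain g' h' where gh: "decomposes \<Omega> f g' h'" "g' \<in> Lp_space p \<Omega>" "h' \<in> W1p_space p \<Omega>"
    "v = Lp_norm p \<Omega> g' + l' * W1p_norm p \<Omega> h'" by blast
  have "K_functional p \<Omega> l f \<le> Lp_norm p \<Omega> g' + l * W1p_norm p \<Omega> h'"
    using gh assms(4) by (intro K_functional_le)
  also have "\<dots> \<le> v"
    using gh(4) assms(5) W1p_norm_nonneg by (auto intro!: mult_right_mono)
  finally show "K_functional p \<Omega> l f \<le> v" .
qed

lemma ennreal_powr_finite_iff: "ennreal_powr x r < top \<longleftrightarrow> x < top"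
  by (auto simp: ennreal_powr_def top.not_eq_extremum)

lemma term_le_suminf: "f k \<le> (\<Sum>k. f k)" for f :: "nat \<Rightarrow> ennreal"
  using sum_le_suminf[of f "{k}"] by simp

lemma suminf_indicator_disjoint:
  fixes c :: "nat \<Rightarrow> ennreal"
  assumes "\<And>j k. j \<noteq> k \<Longrightarrow> A j \<inter> A k = {}" "x \<in> A k"
  shows "(\<Sum>j. indicator (A j) x * c j) = c k"
proof -
  have "(\<Sum>j. indicator (A j) x * c j) = (\<Sum>j\<in>{k}. indicator (A j) x * c j)"
    by (rule suminf_finite) (use assms in \<open>auto simp: indicator_def\<close>)
  then show ?thesis using assms(2) by simp
qed

text \<open>For j < k the right end of the k-th interval is at most the left end of the j-th;
  openness separates neighbours that share an endpoint.\<close>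

lemma dyadic_intervals_disjoint:
  fixes R :: real
  assumes R: "0 < R" and "j \<noteq> k"
  shows "{R / 2 ^ j <..< 2 * (R / 2 ^ j)} \<inter> {R / 2 ^ k <..< 2 * (R / 2 ^ k)} = {}"
proof -
  have *: "{R / 2 ^ j <..< 2 * (R / 2 ^ j)} \<inter> {R / 2 ^ k <..< 2 * (R / 2 ^ k)} = {}" if jk: "j < k" for j k :: nat
  proof -
    obtain d where d: "k = Suc (j + d)" using less_imp_Suc_add[OF jk] by blast
    have "2 * (R / 2 ^ k) = (R / 2 ^ j) / 2 ^ d"
      by (simp add: d power_add field_simps)
    also have "\<dots> \<le> R / 2 ^ j"
      using R by (simp add: divide_le_eq mult_le_cancel_left1 less_imp_le)
    finally show ?thesis by auto
  qed
  show ?thesis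
    using *[of j k] *[of k j] assms(2) by (cases j k rule: linorder_cases) auto
qed

text \<open>Between t_k and 2 t_k the K-functional is at least its value at t_k, while the
  decreasing powers of l are at least their values at 2 t_k. The interval has length t_k, which
  offsets the factor 1 / l up to a constant, so the integral dominates the sum.\<close>

lemma interpolation_seminorm_dyadic_sum:
  assumes dec: "decomposes \<Omega> f g h" "g \<in> Lp_space p \<Omega>" "h \<in> W1p_space p \<Omega>"
    and p: "1 \<le> p" and s: "0 < s" and R: "0 < R"
    and fin: "interpolation_seminorm s p \<Omega> f < \<infinity>"
  shows "(\<Sum>k. ennreal ((R / 2 ^ k) powr (- s * p) * K_functional p \<Omega> (R / 2 ^ k) f powr p)) < \<infinity>"
proof -
  let ?t = "\<lambda>k::nat. R / 2 ^ k"
  let ?K = "\<lambda>l. K_functional p \<Omega> l f"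
  let ?I = "\<lambda>k. {?t k <..< 2 * ?t k}"
  define c where "c k = ((2 * ?t k) powr (- s) * ?K (?t k)) powr p / (2 * ?t k)" for k
  have t: "0 < ?t k" for k using R by simp
  have K0: "0 \<le> ?K (?t k)" for k by (rule K_functional_nonneg[OF dec]) (use t in \<open>simp add: less_imp_le\<close>)
  have "(\<integral>\<^sup>+l. (\<Sum>k. indicator (?I k) l * ennreal (c k)) \<partial>lborel)
     \<le> (\<integral>\<^sup>+l\<in>{0<..}. ennreal ((l powr (- s) * ?K l) powr p / l) \<partial>lborel)"
  proof (rule nn_integral_mono)
    fix l :: real
    show "(\<Sum>k. indicator (?I k) l * ennreal (c k)) \<le> ennreal ((l powr (- s) * ?K l) powr p / l) * indicator {0<..} l"
    proof (cases "\<exists>k. l \<in> ?I k")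
      case True
      then obtain k where k: "l \<in> ?I k" by blast
      then have l: "?t k < l" "l < 2 * ?t k" by auto
      then have l0: "0 < l" using t[of k] by linarith
      have "c k \<le> (l powr (- s) * ?K l) powr p / l"
        unfolding c_def
      proof (rule frac_le)
        show "((2 * ?t k) powr (- s) * ?K (?t k)) powr p \<le> (l powr (- s) * ?K l) powr p"
          using l l0 s p t[of k] K0[of k] K_functional_mono[OF dec, of "?t k" l]
          by (intro powr_mono2 mult_mono powr_mono2') (auto simp: less_imp_le)
      qed (use l l0 in auto)
      then show ?thesis
        using l0 by (subst suminf_indicator_disjoint[where A = ?I and k = k, OF dyadic_intervals_disjoint[OF R] k]) (auto intro: ennreal_leI)
    next
      case False
      then have "(\<lambda>k. indicator (?I k) l * ennreal (c k)) = (\<lambda>k. 0)"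
        by (auto simp: fun_eq_iff indicator_def)
      then show ?thesis by simp
    qed
  qed
  also have "\<dots> < \<infinity>"
    using fin by (simp add: interpolation_seminorm_def ennreal_powr_finite_iff)
  also have "(\<integral>\<^sup>+l. (\<Sum>k. indicator (?I k) l * ennreal (c k)) \<partial>lborel) = (\<Sum>k. ennreal (?t k * c k))"
  proof -
    have *: "(\<integral>\<^sup>+l. indicator (?I k) l * ennreal (c k) \<partial>lborel) = ennreal (?t k * c k)" for k
    proof -
      have "(\<integral>\<^sup>+l. indicator (?I k) l * ennreal (c k) \<partial>lborel) = emeasure lborel (?I k) * ennreal (c k)"
        by (simp only: nn_integral_multc nn_integral_indicator borel_measurable_indicator sets_lborel borel_open open_greaterThanLessThan)
      moreover have "emeasure lborel (?I k) = ennreal (?t k)"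
        using t[of k] by (subst emeasure_lborel_Ioo) auto
      ultimately show ?thesis using t[of k] by (simp only: ennreal_mult' less_imp_le)
    qed
    then show ?thesis
      by (subst nn_integral_suminf) (simp_all only: * borel_measurable_indicator borel_measurable_times_ennreal borel_measurable_const sets_lborel borel_open open_greaterThanLessThan)
  qed
  also have "(\<lambda>k. ennreal (?t k * c k)) = (\<lambda>k. ennreal (2 powr (- s * p - 1)) * ennreal (?t k powr (- s * p) * ?K (?t k) powr p))"
  proof
    fix k
    have "?t k * c k = ((2 * ?t k) powr (- s) * ?K (?t k)) powr p / 2"
      using t[of k] by (simp add: c_def)
    also have "\<dots> = 2 powr (- s * p) / 2 powr 1 * (?t k powr (- s * p) * ?K (?t k) powr p)"
      using t[of k] K0[of k] by (simp only: powr_mult powr_powr mult_nonneg_nonneg powr_ge_zero zero_le_numeral less_imp_le) simp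
    also have "\<dots> = 2 powr (- s * p - 1) * (?t k powr (- s * p) * ?K (?t k) powr p)"
      by (simp only: powr_diff)
    finally show "ennreal (?t k * c k) = ennreal (2 powr (- s * p - 1)) * ennreal (?t k powr (- s * p) * ?K (?t k) powr p)"
      by (simp add: ennreal_mult)
  qed
  finally show ?thesis
    by (simp only: ennreal_suminf_cmult) (auto simp: ennreal_mult_less_top)
qed

text \<open>Here K is taken at the right end of [t_(k+1), t_k] and the decreasing powers at the left
  end; the overlap of these intervals at endpoints only enlarges the upper bound. Above R, the bound
  B and the decay of l^(-s p - 1) give a convergent tail.\<close>

lemma interpolation_seminorm_finite_if_dyadic:
  assumes dec: "decomposes \<Omega> f g h" "g \<in> Lp_space p \<Omega>" "h \<in> W1p_space p \<Omega>"
    and p: "1 \<le> p" and s: "0 < s" and R: "0 < R"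
    and bd: "\<And>l. 0 < l \<Longrightarrow> K_functional p \<Omega> l f \<le> B"
    and fin: "(\<Sum>k. ennreal ((R / 2 ^ k) powr (- s * p) * K_functional p \<Omega> (R / 2 ^ k) f powr p)) < \<infinity>"
  shows "interpolation_seminorm s p \<Omega> f < \<infinity>"
proof -
  let ?t = "\<lambda>k::nat. R / 2 ^ k"
  let ?K = "\<lambda>l. K_functional p \<Omega> l f"
  let ?I = "\<lambda>k. {?t (Suc k) .. ?t k}"
  define c where "c k = (?t (Suc k) powr (- s) * ?K (?t k)) powr p / ?t (Suc k)" for k
  have t: "0 < ?t k" for k using R by simp
  have K0: "0 \<le> ?K l" if "0 < l" for l by (rule K_functional_nonneg[OF dec]) (use that in \<open>simp add: less_imp_le\<close>)
  have B0: "0 \<le> B" using bd[of 1] K0[of 1] by simp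
  let ?tail = "\<lambda>l. ennreal (B powr p * l powr (- s * p - 1))"
  have "(\<integral>\<^sup>+l\<in>{0<..}. ennreal ((l powr (- s) * ?K l) powr p / l) \<partial>lborel)
     \<le> (\<integral>\<^sup>+l. (\<Sum>k. indicator (?I k) l * ennreal (c k)) + ?tail l * indicator {R..} l \<partial>lborel)"
  proof (rule nn_integral_mono)
    fix l :: real
    show "ennreal ((l powr (- s) * ?K l) powr p / l) * indicator {0<..} l
      \<le> (\<Sum>k. indicator (?I k) l * ennreal (c k)) + ?tail l * indicator {R..} l"
    proof (cases "0 < l")
      case l: True
      show ?thesis
      proof (cases "R \<le> l")
        case True
        have "(l powr (- s) * ?K l) powr p / l \<le> (l powr (- s) * B) powr p / l"
          using l bd[OF l] K0[OF l] p by (intro divide_right_mono powr_mono2 mult_left_mono) auto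
        also have "\<dots> = B powr p * l powr (- s * p - 1)"
          using l B0 by (simp add: powr_mult powr_powr powr_diff)
        finally show ?thesis
          using True l by (auto intro!: add_increasing ennreal_leI)
      next
        case False
        have "\<exists>k. l \<in> ?I k"
        proof -
          have "(\<lambda>k. ?t k) \<longlonglongrightarrow> 0"
            by (rule LIMSEQ_divide_realpow_zero) simp
          then have ex: "\<exists>k. ?t k < l"
            using l order_tendstoD(2)[of ?t 0 sequentially l] eventually_happens sequentially_bot by blast
          \<comment> \<open>The first dyadic scale below l. It is not the 0-th since l < R, and its
            predecessor is the required index.\<close>
          define m where "m = (LEAST k. ?t k < l)"
          have m: "?t m < l" unfolding m_def by (rule LeastI_ex[OF ex])
          have "m \<noteq> 0" using m False by (intro notI) simp
          then obtain k where k: "m = Suc k" using not0_implies_Suc by blast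
          have "\<not> ?t k < l" using k not_less_Least[of k "\<lambda>k. ?t k < l"] unfolding m_def by simp
          then show ?thesis using m k by (intro exI[of _ k]) auto
        qed
        then obtain k where k: "l \<in> ?I k" by blast
        then have lk: "?t (Suc k) \<le> l" "l \<le> ?t k" by auto
        have "(l powr (- s) * ?K l) powr p / l \<le> c k"
          unfolding c_def
        proof (rule frac_le)
          show "(l powr (- s) * ?K l) powr p \<le> (?t (Suc k) powr (- s) * ?K (?t k)) powr p"
            using l lk s p t[of "Suc k"] K0[OF l] K_functional_mono[OF dec, of l "?t k"]
            by (intro powr_mono2 mult_mono powr_mono2') (auto simp: less_imp_le)
        qed (use lk t[of "Suc k"] in auto)
        then have "ennreal ((l powr (- s) * ?K l) powr p / l) \<le> indicator (?I k) l * ennreal (c k)"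
          using k by (auto intro: ennreal_leI)
        also have "\<dots> \<le> (\<Sum>k. indicator (?I k) l * ennreal (c k))"
          by (rule term_le_suminf[of "\<lambda>k. indicator (?I k) l * ennreal (c k)"])
        finally show ?thesis using l False by simp
      qed
    qed simp
  qed
  also have "\<dots> = (\<Sum>k. ennreal (?t (Suc k)) * ennreal (c k)) + (\<integral>\<^sup>+l\<in>{R..}. ?tail l \<partial>lborel)"
  proof -
    have "emeasure lborel (?I k) = ennreal (?t (Suc k))" for k
      using t[of "Suc k"] by (subst emeasure_lborel_Icc) (auto simp: field_simps)
    then show ?thesis
      by (subst nn_integral_add) (auto simp: nn_integral_suminf nn_integral_multc)
  qed
  also have "\<dots> < \<infinity>"
  proof -
    have "ennreal (?t (Suc k)) * ennreal (c k) = ennreal (2 powr (s * p)) * ennreal (?t k powr (- s * p) * ?K (?t k) powr p)" for k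
    proof -
      have "?t (Suc k) * c k = ((?t k / 2) powr (- s) * ?K (?t k)) powr p"
        using t[of "Suc k"] by (simp add: c_def mult.commute)
      also have "\<dots> = 2 powr (s * p) * (?t k powr (- s * p) * ?K (?t k) powr p)"
        using t[of k] K0[OF t[of k]]
        by (simp only: powr_mult powr_powr powr_divide mult_nonneg_nonneg powr_ge_zero zero_le_numeral less_imp_le divide_nonneg_nonneg)
          (simp add: powr_minus divide_simps)
      finally show ?thesis
        using t[of "Suc k"] by (simp add: ennreal_mult[symmetric] ennreal_mult'[symmetric] less_imp_le)
    qed
    then have "(\<Sum>k. ennreal (?t (Suc k)) * ennreal (c k)) < \<infinity>"
      using fin by (simp only: ennreal_suminf_cmult) (auto simp: ennreal_mult_less_top)
    moreover have "(\<integral>\<^sup>+l\<in>{R..}. ?tail l \<partial>lborel) < \<infinity>"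
    proof -
      \<comment> \<open>An antiderivative of the tail integrand that vanishes at infinity, since s p
        > 0.\<close>
      let ?F = "\<lambda>l. - (B powr p / (s * p)) * l powr (- s * p)"
      have sp: "0 < s * p" using s p by simp
      have lim: "((\<lambda>l. l powr (- s * p)) \<longlongrightarrow> 0) at_top"
        using tendsto_neg_powr[of "- s * p" "\<lambda>x. x" at_top] sp filterlim_ident by auto
      have "(\<integral>\<^sup>+l\<in>{R..}. ?tail l \<partial>lborel) = ennreal (0 - ?F R)"
      proof (rule nn_integral_FTC_atLeast)
        show "(?F has_real_derivative B powr p * l powr (- s * p - 1)) (at l)" if "R \<le> l" for l
          using that R s p by (auto intro!: derivative_eq_intros)
        show "(?F \<longlongrightarrow> 0) at_top"
          using tendsto_mult[OF tendsto_const[of "- (B powr p / (s * p))"] lim] by simp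
      qed auto
      then show ?thesis by simp
    qed
    ultimately show ?thesis by simp
  qed
  finally show ?thesis
    by (simp add: interpolation_seminorm_def ennreal_powr_finite_iff)
qed

section \<open>From interpolation to restricted differences\<close>

text \<open>The p-th power of the restricted seminorm, with \<open>lborel\<close> in place of its
  completion; only its finiteness matters for membership.\<close>

definition restricted_energy :: "real \<Rightarrow> real \<Rightarrow> 'a::euclidean_space set \<Rightarrow> ('a \<Rightarrow> real) \<Rightarrow> ennreal" where
  "restricted_energy s p \<Omega> f =
     (\<integral>\<^sup>+x. indicator \<Omega> x * (\<integral>\<^sup>+y. indicator {y. norm (x - y) < bdist \<Omega> x / 2} y *
            ennreal (\<bar>f x - f y\<bar> powr p / norm (x - y) powr (real DIM('a) + s * p))
          \<partial>lborel) \<partial>lborel)"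

lemma restricted_seminorm_finite_iff:
  "restricted_seminorm s p \<Omega> f < \<infinity> \<longleftrightarrow> restricted_energy s p \<Omega> f < \<infinity>"
  by (simp add: restricted_seminorm_def restricted_energy_def ennreal_powr_finite_iff nn_integral_completion mult.commute)

text \<open>Changing f on a null set affects x and y alike. For x in \<Omega> the inner ball lies in
  \<Omega>, so the exceptional set for y is null as well.\<close>

lemma restricted_energy_cong:
  fixes f :: "'a::euclidean_space \<Rightarrow> real"
  assumes ae: "AE x in lborel. x \<in> \<Omega> \<longrightarrow> f x = F x"
  shows "restricted_energy s p \<Omega> f = restricted_energy s p \<Omega> F"
  unfolding restricted_energy_def
proof (rule nn_integral_cong_AE, use ae in eventually_elim)
  fix x assume x: "x \<in> \<Omega> \<longrightarrow> f x = F x"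
  show "indicator \<Omega> x * (\<integral>\<^sup>+y. indicator {y. norm (x - y) < bdist \<Omega> x / 2} y *
            ennreal (\<bar>f x - f y\<bar> powr p / norm (x - y) powr (real DIM('a) + s * p)) \<partial>lborel) =
        indicator \<Omega> x * (\<integral>\<^sup>+y. indicator {y. norm (x - y) < bdist \<Omega> x / 2} y *
            ennreal (\<bar>F x - F y\<bar> powr p / norm (x - y) powr (real DIM('a) + s * p)) \<partial>lborel)"
  proof (cases "x \<in> \<Omega>")
    case True
    have "(\<integral>\<^sup>+y. indicator {y. norm (x - y) < bdist \<Omega> x / 2} y *
            ennreal (\<bar>f x - f y\<bar> powr p / norm (x - y) powr (real DIM('a) + s * p)) \<partial>lborel) =
        (\<integral>\<^sup>+y. indicator {y. norm (x - y) < bdist \<Omega> x / 2} y *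
            ennreal (\<bar>F x - F y\<bar> powr p / norm (x - y) powr (real DIM('a) + s * p)) \<partial>lborel)"
    proof (rule nn_integral_cong_AE, use ae in eventually_elim)
      fix y assume y: "y \<in> \<Omega> \<longrightarrow> f y = F y"
      have "y \<in> \<Omega>" if "norm (x - y) < bdist \<Omega> x / 2"
      proof -
        have "norm (x - y) < bdist \<Omega> x" using that norm_ge_zero[of "x - y"] by linarith
        then have "y \<in> ball x (bdist \<Omega> x)" by (simp add: dist_norm)
        then show ?thesis using ball_bdist_subset[OF True] by blast
      qed
      then show "indicator {y. norm (x - y) < bdist \<Omega> x / 2} y *
            ennreal (\<bar>f x - f y\<bar> powr p / norm (x - y) powr (real DIM('a) + s * p)) =
          indicator {y. norm (x - y) < bdist \<Omega> x / 2} y *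
            ennreal (\<bar>F x - F y\<bar> powr p / norm (x - y) powr (real DIM('a) + s * p))"
        using x y True by (auto simp: indicator_def)
    qed
    then show ?thesis by simp
  qed simp
qed

text \<open>The L^p part is estimated at x and x + z separately, translation preserving its norm
  because G vanishes off \<Omega>; the Sobolev part gains the factor |z| \<le> t from its gradient.
  What results is the combination of norms in the K-functional at scale t.\<close>

lemma translate_le_decomposition:
  fixes f :: "'a::euclidean_space \<Rightarrow> real"
  assumes \<Omega>: "open \<Omega>" "bounded \<Omega>" and p: "1 \<le> p"
    and F: "F \<in> borel_measurable borel" "\<And>x. x \<notin> \<Omega> \<Longrightarrow> F x = 0" "AE x in lborel. x \<in> \<Omega> \<longrightarrow> f x = F x"
    and dec: "decomposes \<Omega> f g h" "g \<in> Lp_space p \<Omega>" "h \<in> W1p_space p \<Omega>"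
    and z: "norm z \<le> t"
  shows "(\<integral>\<^sup>+x. indicator {x \<in> \<Omega>. norm z < bdist \<Omega> x} x * ennreal (\<bar>F (x + z) - F x\<bar> powr p) \<partial>lborel)
    \<le> ennreal (4 powr p * (2 + real DIM('a) powr p) * (Lp_norm p \<Omega> g + t * W1p_norm p \<Omega> h) powr p)"
proof -
  have S: "\<Omega> \<in> sets lebesgue" using \<Omega> by simp
  have hL: "h \<in> Lp_space p \<Omega>" using dec(3) by (simp add: W1p_space_def)
  have "g \<in> borel_measurable (lebesgue_on \<Omega>)" using dec(2) by (simp add: Lp_space_def)
  from borel_representative[OF \<Omega>(1) this] obtain G where
    G: "G \<in> borel_measurable borel" "\<And>x. x \<notin> \<Omega> \<Longrightarrow> G x = 0" "AE x in lborel. x \<in> \<Omega> \<longrightarrow> g x = G x" by metis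
  have "h \<in> borel_measurable (lebesgue_on \<Omega>)" using hL by (simp add: Lp_space_def)
  from borel_representative[OF \<Omega>(1) this] obtain H where
    H: "H \<in> borel_measurable borel" "\<And>x. x \<notin> \<Omega> \<Longrightarrow> H x = 0" "AE x in lborel. x \<in> \<Omega> \<longrightarrow> h x = H x" by metis
  note [measurable] = F(1) G(1) H(1)
  have U[measurable]: "{x \<in> \<Omega>. norm z < bdist \<Omega> x} \<in> sets borel"
  proof -
    have "open {x. norm z < bdist \<Omega> x}"
      by (intro open_Collect_less continuous_on_const continuous_on_bdist)
    moreover have "{x \<in> \<Omega>. norm z < bdist \<Omega> x} = \<Omega> \<inter> {x. norm z < bdist \<Omega> x}" by auto
    ultimately show ?thesis using \<Omega>(1) by auto
  qed
  let ?U = "{x \<in> \<Omega>. norm z < bdist \<Omega> x}"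
  \<comment> \<open>All three functions vanish off \<Omega>, so the identity holds almost everywhere
    in the whole space and survives translation.\<close>
  have FGH: "AE x in lborel. F x = G x + H x"
    using dec(1)[unfolded decomposes_def AE_lebesgue_on_open[OF \<Omega>(1)]] F(3) G(3) H(3)
  proof eventually_elim
    case (elim x)
    then show ?case using F(2)[of x] G(2)[of x] H(2)[of x] by (cases "x \<in> \<Omega>") auto
  qed
  \<comment> \<open>Two splittings, each costing \<open>2 powr p\<close>.\<close>
  have pw: "\<bar>(a + b) - (c + d)\<bar> powr p \<le> 4 powr p * (\<bar>c\<bar> powr p + \<bar>a\<bar> powr p + \<bar>b - d\<bar> powr p)" for a b c d :: real
  proof -
    have "\<bar>(a + b) - (c + d)\<bar> powr p \<le> 2 powr p * (\<bar>a - c\<bar> powr p + \<bar>b - d\<bar> powr p)"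
      using abs_add_powr_le[of p "a - c" "b - d"] p by (simp add: algebra_simps)
    also have "\<dots> \<le> 2 powr p * (2 powr p * (\<bar>a\<bar> powr p + \<bar>c\<bar> powr p) + 2 powr p * \<bar>b - d\<bar> powr p)"
      using abs_add_powr_le[of p a "- c"] p mult_right_mono[of 1 "2 powr p" "\<bar>b - d\<bar> powr p"]
      by (intro mult_left_mono add_mono) (auto simp: ge_one_powr_ge_zero)
    also have "\<dots> = (2 powr p * 2 powr p) * (\<bar>c\<bar> powr p + \<bar>a\<bar> powr p + \<bar>b - d\<bar> powr p)"
      by (simp add: algebra_simps)
    also have "2 powr p * 2 powr p = (4::real) powr p"
      by (simp flip: powr_mult)
    finally show ?thesis .
  qed
  let ?A = "Lp_norm p \<Omega> g + t * W1p_norm p \<Omega> h"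
  have t: "0 \<le> t" using z norm_ge_zero[of z] by linarith
  have "(\<integral>\<^sup>+x. indicator ?U x * ennreal (\<bar>F (x + z) - F x\<bar> powr p) \<partial>lborel)
    \<le> (\<integral>\<^sup>+x. ennreal (4 powr p) * ((ennreal (\<bar>G x\<bar> powr p) + ennreal (\<bar>G (x + z)\<bar> powr p)) + indicator ?U x * ennreal (\<bar>H (x + z) - H x\<bar> powr p)) \<partial>lborel)"
  proof (rule nn_integral_mono_AE, use FGH AE_lborel_translate[OF FGH, of z] in eventually_elim)
    fix x assume "F x = G x + H x" "F (x + z) = G (x + z) + H (x + z)"
    then have "ennreal (\<bar>F (x + z) - F x\<bar> powr p) \<le> ennreal (4 powr p) * ((ennreal (\<bar>G x\<bar> powr p) + ennreal (\<bar>G (x + z)\<bar> powr p)) + ennreal (\<bar>H (x + z) - H x\<bar> powr p))"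
      using pw[of "G (x + z)" "H (x + z)" "G x" "H x"] by (simp add: ennreal_mult[symmetric] flip: ennreal_plus)
    then show "indicator ?U x * ennreal (\<bar>F (x + z) - F x\<bar> powr p)
      \<le> ennreal (4 powr p) * ((ennreal (\<bar>G x\<bar> powr p) + ennreal (\<bar>G (x + z)\<bar> powr p)) + indicator ?U x * ennreal (\<bar>H (x + z) - H x\<bar> powr p))"
      by (auto simp: indicator_def)
  qed
  also have "\<dots> = ennreal (4 powr p) * (((\<integral>\<^sup>+x. ennreal (\<bar>G x\<bar> powr p) \<partial>lborel) + (\<integral>\<^sup>+x. ennreal (\<bar>G (x + z)\<bar> powr p) \<partial>lborel))
      + (\<integral>\<^sup>+x. indicator ?U x * ennreal (\<bar>H (x + z) - H x\<bar> powr p) \<partial>lborel))"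
    by (simp add: nn_integral_cmult nn_integral_add)
  also have "(\<integral>\<^sup>+x. ennreal (\<bar>G (x + z)\<bar> powr p) \<partial>lborel) = (\<integral>\<^sup>+x. ennreal (\<bar>G x\<bar> powr p) \<partial>lborel)"
    by (rule nn_integral_lborel_translate) measurable
  also have "(\<integral>\<^sup>+x. ennreal (\<bar>G x\<bar> powr p) \<partial>lborel) = Lp_power p \<Omega> G"
    by (rule Lp_power_zero_outside[symmetric]) (rule G(2))
  also have "Lp_power p \<Omega> G = ennreal (Lp_norm p \<Omega> g powr p)"
    using Lp_norm_powr[OF S dec(2)] p Lp_power_cong[OF G(3)] by simp
  also have "ennreal (4 powr p) * ((ennreal (Lp_norm p \<Omega> g powr p) + ennreal (Lp_norm p \<Omega> g powr p))
      + (\<integral>\<^sup>+x. indicator ?U x * ennreal (\<bar>H (x + z) - H x\<bar> powr p) \<partial>lborel))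
     \<le> ennreal (4 powr p) * ((ennreal (?A powr p) + ennreal (?A powr p)) + ennreal (real DIM('a) powr p * ?A powr p))"
  proof (intro mult_left_mono add_mono ennreal_leI powr_mono2)
    have "real DIM('a) * norm z * W1p_norm p \<Omega> h \<le> real DIM('a) * ?A"
      using z t Lp_norm_nonneg[of p \<Omega> g] W1p_norm_nonneg[of p \<Omega> h] mult_right_mono[OF z W1p_norm_nonneg[of p \<Omega> h]]
      by (simp add: mult.assoc)
    then have "(real DIM('a) * norm z * W1p_norm p \<Omega> h) powr p \<le> (real DIM('a) * ?A) powr p"
      using p by (intro powr_mono2) (auto simp: W1p_norm_nonneg)
    also have "\<dots> = real DIM('a) powr p * ?A powr p"
      using t by (simp add: powr_mult Lp_norm_nonneg W1p_norm_nonneg)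
    finally have "ennreal ((real DIM('a) * norm z * W1p_norm p \<Omega> h) powr p) \<le> ennreal (real DIM('a) powr p * ?A powr p)"
      by (rule ennreal_leI)
    with nn_translate_le_W1p_norm[OF \<Omega> p dec(3) H, of z]
    show "(\<integral>\<^sup>+x. indicator ?U x * ennreal (\<bar>H (x + z) - H x\<bar> powr p) \<partial>lborel) \<le> ennreal (real DIM('a) powr p * ?A powr p)"
      by (rule order_trans)
  qed (use p t in \<open>auto simp: Lp_norm_nonneg W1p_norm_nonneg\<close>)
  also have "\<dots> = ennreal (4 powr p * (2 + real DIM('a) powr p) * ?A powr p)"
    by (simp add: ennreal_mult[symmetric] algebra_simps flip: ennreal_plus)
  finally show ?thesis .
qed

text \<open>The substitution y = x + z and Tonelli's theorem put the displacement outside, where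
  bounds depending only on the size of z can be summed over shells.\<close>

lemma restricted_energy_eq_translates:
  fixes F :: "'a::euclidean_space \<Rightarrow> real"
  assumes \<Omega>: "open \<Omega>" and F[measurable]: "F \<in> borel_measurable borel"
  shows "restricted_energy s p \<Omega> F = (\<integral>\<^sup>+z. ennreal (1 / norm z powr (real DIM('a) + s * p)) *
    (\<integral>\<^sup>+x. indicator {x \<in> \<Omega>. norm z < bdist \<Omega> x / 2} x * ennreal (\<bar>F (x + z) - F x\<bar> powr p) \<partial>lborel) \<partial>lborel)"
proof -
  have [measurable]: "\<Omega> \<in> sets borel" using \<Omega> by auto
  let ?r = "real DIM('a) + s * p"
  have "restricted_energy s p \<Omega> F = (\<integral>\<^sup>+x. (\<integral>\<^sup>+z. ennreal (1 / norm z powr ?r) *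
      (indicator {x \<in> \<Omega>. norm z < bdist \<Omega> x / 2} x * ennreal (\<bar>F (x + z) - F x\<bar> powr p)) \<partial>lborel) \<partial>lborel)"
    unfolding restricted_energy_def
  proof (rule nn_integral_cong)
    fix x :: 'a
    have "(\<integral>\<^sup>+y. indicator {y. norm (x - y) < bdist \<Omega> x / 2} y * ennreal (\<bar>F x - F y\<bar> powr p / norm (x - y) powr ?r) \<partial>lborel)
      = (\<integral>\<^sup>+z. indicator {y. norm (x - y) < bdist \<Omega> x / 2} (z + x) * ennreal (\<bar>F x - F (z + x)\<bar> powr p / norm (x - (z + x)) powr ?r) \<partial>lborel)"
      by (rule nn_integral_lborel_translate[symmetric]) measurable
    also have "\<dots> = (\<integral>\<^sup>+z. indicator {z. norm z < bdist \<Omega> x / 2} z * ennreal (\<bar>F (x + z) - F x\<bar> powr p / norm z powr ?r) \<partial>lborel)"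
      by (simp add: indicator_def add.commute abs_minus_commute)
    finally have "indicator \<Omega> x * (\<integral>\<^sup>+y. indicator {y. norm (x - y) < bdist \<Omega> x / 2} y * ennreal (\<bar>F x - F y\<bar> powr p / norm (x - y) powr ?r) \<partial>lborel)
      = (\<integral>\<^sup>+z. indicator \<Omega> x * (indicator {z. norm z < bdist \<Omega> x / 2} z * ennreal (\<bar>F (x + z) - F x\<bar> powr p / norm z powr ?r)) \<partial>lborel)"
      by (simp add: nn_integral_cmult)
    also have "\<dots> = (\<integral>\<^sup>+z. ennreal (1 / norm z powr ?r) *
      (indicator {x \<in> \<Omega>. norm z < bdist \<Omega> x / 2} x * ennreal (\<bar>F (x + z) - F x\<bar> powr p)) \<partial>lborel)"
      by (rule nn_integral_cong) (auto simp: indicator_def ennreal_mult[symmetric])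
    finally show "indicator \<Omega> x * (\<integral>\<^sup>+y. indicator {y. norm (x - y) < bdist \<Omega> x / 2} y * ennreal (\<bar>F x - F y\<bar> powr p / norm (x - y) powr ?r) \<partial>lborel)
      = (\<integral>\<^sup>+z. ennreal (1 / norm z powr ?r) *
      (indicator {x \<in> \<Omega>. norm z < bdist \<Omega> x / 2} x * ennreal (\<bar>F (x + z) - F x\<bar> powr p)) \<partial>lborel)" .
  qed
  also have "\<dots> = (\<integral>\<^sup>+z. (\<integral>\<^sup>+x. ennreal (1 / norm z powr ?r) *
      (indicator {x \<in> \<Omega>. norm z < bdist \<Omega> x / 2} x * ennreal (\<bar>F (x + z) - F x\<bar> powr p)) \<partial>lborel) \<partial>lborel)"
    by (rule lborel_pair.Fubini'[symmetric]) measurable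
  also have "\<dots> = (\<integral>\<^sup>+z. ennreal (1 / norm z powr ?r) *
      (\<integral>\<^sup>+x. indicator {x \<in> \<Omega>. norm z < bdist \<Omega> x / 2} x * ennreal (\<bar>F (x + z) - F x\<bar> powr p) \<partial>lborel) \<partial>lborel)"
    by (intro nn_integral_cong nn_integral_cmult) measurable
  finally show ?thesis .
qed

lemma suminf_dyadic_powr_finite:
  assumes "0 < q" "0 < R"
  shows "(\<Sum>k. ennreal ((R / 2 ^ k) powr q)) < \<infinity>"
proof -
  have "(R / 2 ^ k) powr q = R powr q * (1 / 2 powr q) ^ k" for k :: nat
  proof -
    have "(2 ^ k) powr q = (2 powr q) ^ k" by (induction k) (simp_all add: powr_mult)
    then show ?thesis using assms by (simp add: powr_divide power_one_over)
  qed
  moreover have "summable (\<lambda>k. R powr q * (1 / 2 powr q) ^ k)"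
    using assms by (intro summable_mult summable_geometric) auto
  ultimately show ?thesis
    by (simp add: ennreal_suminf_neq_top top.not_eq_extremum)
qed

lemma dyadic_shell_exists:
  fixes R l :: real
  assumes "0 < l" "l < R"
  shows "\<exists>k. R / 2 ^ k / 2 \<le> l \<and> l < R / 2 ^ k"
proof -
  have "(\<lambda>k. R / 2 ^ k) \<longlonglongrightarrow> 0"
    by (rule LIMSEQ_divide_realpow_zero) simp
  then have ex: "\<exists>k. R / 2 ^ k \<le> l"
    using assms(1) order_tendstoD(2)[of "\<lambda>k. R / 2 ^ k" 0 sequentially l] eventually_happens sequentially_bot less_imp_le by blast
  define m where "m = (LEAST k. R / 2 ^ k \<le> l)"
  have m: "R / 2 ^ m \<le> l" unfolding m_def by (rule LeastI_ex[OF ex])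
  have "m \<noteq> 0" using m assms(2) by (intro notI) simp
  then obtain k where k: "m = Suc k" using not0_implies_Suc by blast
  have "\<not> R / 2 ^ k \<le> l" using k not_less_Least[of k "\<lambda>k. R / 2 ^ k \<le> l"] unfolding m_def by simp
  then show ?thesis using m k by (intro exI[of _ k]) (auto simp: mult.commute)
qed

lemma interpolation_subset_restricted:
  fixes \<Omega> :: "'a::euclidean_space set"
  assumes \<Omega>: "bounded_domain \<Omega>" and p: "1 \<le> p" and s: "0 < s" "s < 1"
  shows "interpolation_space s p \<Omega> \<subseteq> restricted_space s p \<Omega>"
proof
  fix f assume f: "f \<in> interpolation_space s p \<Omega>"
  have \<Omega>': "open \<Omega>" "bounded \<Omega>" using \<Omega> by (auto simp: bounded_domain_def)
  have S: "\<Omega> \<in> sets lebesgue" using \<Omega>' by simp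
  obtain g h where gh: "decomposes \<Omega> f g h" "g \<in> Lp_space p \<Omega>" "h \<in> W1p_space p \<Omega>"
    and fin: "interpolation_seminorm s p \<Omega> f < \<infinity>"
    using f by (auto simp: interpolation_space_def)
  have hL: "h \<in> Lp_space p \<Omega>" using gh(3) by (simp add: W1p_space_def)
  \<comment> \<open>Elements of the Sobolev space are p-integrable, so the sum space is contained in
    L^p and f belongs to it.\<close>
  have ghL: "(\<lambda>x. g x + h x) \<in> Lp_space p \<Omega>"
    unfolding Lp_space_def
  proof (intro CollectI conjI)
    have m[measurable]: "g \<in> borel_measurable (lebesgue_on \<Omega>)" "h \<in> borel_measurable (lebesgue_on \<Omega>)"
      using gh(2) hL by (auto simp: Lp_space_def)
    show "(\<lambda>x. g x + h x) \<in> borel_measurable (lebesgue_on \<Omega>)" by measurable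
    show "integrable (lebesgue_on \<Omega>) (\<lambda>x. \<bar>g x + h x\<bar> powr p)"
    proof (rule Bochner_Integration.integrable_bound)
      show "integrable (lebesgue_on \<Omega>) (\<lambda>x. 2 powr p * (\<bar>g x\<bar> powr p + \<bar>h x\<bar> powr p))"
        using gh(2) hL by (auto simp: Lp_space_def)
      show "AE x in lebesgue_on \<Omega>. norm (\<bar>g x + h x\<bar> powr p) \<le> norm (2 powr p * (\<bar>g x\<bar> powr p + \<bar>h x\<bar> powr p))"
        using abs_add_powr_le[of p] p by (intro AE_I2) auto
    qed measurable
  qed
  have fL: "f \<in> Lp_space p \<Omega>"
  proof (rule Lp_space_cong[OF \<Omega>'(1) ghL])
    show "AE x in lborel. x \<in> \<Omega> \<longrightarrow> g x + h x = f x"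
      using gh(1)[unfolded decomposes_def AE_lebesgue_on_open[OF \<Omega>'(1)]] by eventually_elim auto
  qed
  then have "f \<in> borel_measurable (lebesgue_on \<Omega>)" by (simp add: Lp_space_def)
  from borel_representative[OF \<Omega>'(1) this] obtain F where
    F: "F \<in> borel_measurable borel" "\<And>x. x \<notin> \<Omega> \<Longrightarrow> F x = 0" "AE x in lborel. x \<in> \<Omega> \<longrightarrow> f x = F x" by metis
  \<comment> \<open>Larger than every boundary distance, so displacements of norm at least R do not
    occur and the shells below R exhaust the energy.\<close>
  define R where "R = diameter \<Omega> + 1"
  have R: "0 < R" using diameter_ge_0[OF \<Omega>'(2)] by (simp add: R_def)
  let ?t = "\<lambda>k::nat. R / 2 ^ k"
  define K where "K k = K_functional p \<Omega> (?t k) f" for k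
  have t: "0 < ?t k" for k using R by simp
  have K0: "0 \<le> K k" for k unfolding K_def by (rule K_functional_nonneg[OF gh]) (use t in \<open>simp add: less_imp_le\<close>)
  define n where "n = real DIM('a)"
  define C where "C = 4 powr p * (2 + n powr p)"
  let ?I = "\<lambda>z. \<integral>\<^sup>+x. indicator {x \<in> \<Omega>. norm z < bdist \<Omega> x / 2} x * ennreal (\<bar>F (x + z) - F x\<bar> powr p) \<partial>lborel"
  have I_le: "?I z \<le> ennreal (C * (K k + ?t k) powr p)" if "norm z < ?t k" for z k
  proof -
    \<comment> \<open>The slack t_k contributes the series of t_k^(p - s p), which converges because
      s < 1.\<close>
    obtain g' h' where gh': "decomposes \<Omega> f g' h'" "g' \<in> Lp_space p \<Omega>" "h' \<in> W1p_space p \<Omega>"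
      "Lp_norm p \<Omega> g' + ?t k * W1p_norm p \<Omega> h' < K k + ?t k"
      using K_functional_near[OF gh t[of k], of "?t k"] unfolding K_def by metis
    have "?I z \<le> (\<integral>\<^sup>+x. indicator {x \<in> \<Omega>. norm z < bdist \<Omega> x} x * ennreal (\<bar>F (x + z) - F x\<bar> powr p) \<partial>lborel)"
    proof (rule nn_integral_mono)
      fix x
      have "norm z < bdist \<Omega> x" if "norm z < bdist \<Omega> x / 2"
        using that norm_ge_zero[of z] by linarith
      then show "indicator {x \<in> \<Omega>. norm z < bdist \<Omega> x / 2} x * ennreal (\<bar>F (x + z) - F x\<bar> powr p)
        \<le> indicator {x \<in> \<Omega>. norm z < bdist \<Omega> x} x * ennreal (\<bar>F (x + z) - F x\<bar> powr p)"
        by (auto simp: indicator_def)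
    qed
    also have "\<dots> \<le> ennreal (C * (Lp_norm p \<Omega> g' + ?t k * W1p_norm p \<Omega> h') powr p)"
      unfolding C_def n_def by (rule translate_le_decomposition[OF \<Omega>' p F gh'(1-3) less_imp_le[OF that]])
    also have "\<dots> \<le> ennreal (C * (K k + ?t k) powr p)"
      using gh'(4) t[of k] p
        add_nonneg_nonneg[OF Lp_norm_nonneg mult_nonneg_nonneg[OF less_imp_le[OF t[of k]] W1p_norm_nonneg], of p \<Omega> g' p \<Omega> h']
      by (intro ennreal_leI mult_left_mono powr_mono2) (auto simp: C_def)
    finally show ?thesis .
  qed
  have I_0: "?I z = 0" if "R \<le> norm z" for z
  proof -
    have "\<not> norm z < bdist \<Omega> x / 2" if "x \<in> \<Omega>" for x
      using bdist_le_diameter[OF \<Omega> that] bdist_pos[OF \<Omega> that] \<open>R \<le> norm z\<close> by (simp add: R_def)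
    then have "{x \<in> \<Omega>. norm z < bdist \<Omega> x / 2} = {}" by blast
    then show ?thesis by (simp only:) simp
  qed
  let ?S = "\<lambda>k. {z::'a. ?t k / 2 \<le> norm z \<and> norm z < ?t k}"
  \<comment> \<open>On the shell the kernel is largest at the inner radius t_k / 2.\<close>
  define c where "c k = (?t k / 2) powr (- (n + s * p)) * (C * (K k + ?t k) powr p)" for k
  define v where "v = unit_ball_vol n"
  have v: "0 \<le> v" by (simp add: v_def n_def)
  have n: "0 \<le> n" by (simp add: n_def)
  have nsp: "- n \<le> s * p" using mult_nonneg_nonneg[of s p] s p n by linarith
  have "restricted_energy s p \<Omega> F = (\<integral>\<^sup>+z. ennreal (1 / norm z powr (n + s * p)) * ?I z \<partial>lborel)"
    unfolding n_def by (rule restricted_energy_eq_translates[OF \<Omega>'(1) F(1)])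
  also have "\<dots> \<le> (\<integral>\<^sup>+z. (\<Sum>k. indicator (?S k) z * ennreal (c k)) \<partial>lborel)"
  proof (rule nn_integral_mono)
    fix z :: 'a
    show "ennreal (1 / norm z powr (n + s * p)) * ?I z \<le> (\<Sum>k. indicator (?S k) z * ennreal (c k))"
    proof (cases "z = 0 \<or> R \<le> norm z")
      case False
      then obtain k where k: "?t k / 2 \<le> norm z" "norm z < ?t k"
        using dyadic_shell_exists[of "norm z" R] by auto
      have "1 / norm z powr (n + s * p) = norm z powr (- (n + s * p))"
        by (simp only: powr_minus_divide)
      also have "\<dots> \<le> (?t k / 2) powr (- (n + s * p))"
        using k t[of k] nsp by (intro powr_mono2') auto
      finally have "ennreal (1 / norm z powr (n + s * p)) * ?I z \<le> ennreal ((?t k / 2) powr (- (n + s * p))) * ennreal (C * (K k + ?t k) powr p)"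
        by (intro mult_mono ennreal_leI I_le k) auto
      also have "\<dots> = indicator (?S k) z * ennreal (c k)"
        using k by (simp add: c_def C_def ennreal_mult)
      also have "\<dots> \<le> (\<Sum>k. indicator (?S k) z * ennreal (c k))"
        by (rule term_le_suminf[of "\<lambda>k. indicator (?S k) z * ennreal (c k)"])
      finally show ?thesis .
    next
      case True
      then show ?thesis
      proof
        assume "R \<le> norm z"
        from I_0[OF this] show ?thesis by (simp only: mult_zero_right zero_le)
      qed simp
    qed
  qed
  also have "\<dots> = (\<Sum>k. emeasure lborel (?S k) * ennreal (c k))"
  proof -
    have [measurable]: "?S k \<in> sets borel" for k by measurable
    show ?thesis
      by (subst nn_integral_suminf) (simp_all add: nn_integral_multc)
  qed
  also have "\<dots> \<le> (\<Sum>k. ennreal (v * 2 powr (n + s * p) * C * 2 powr p) *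
      (ennreal (?t k powr (- s * p) * K k powr p) + ennreal (?t k powr (p - s * p))))"
  proof (intro suminf_le summableI)
    fix k
    have "emeasure lborel (?S k) \<le> emeasure lborel (ball (0::'a) (?t k))"
      by (intro emeasure_mono) auto
    also have "\<dots> = ennreal (v * ?t k powr n)"
      using t[of k] by (simp add: emeasure_ball v_def n_def less_imp_le powr_realpow)
    finally have "emeasure lborel (?S k) * ennreal (c k) \<le> ennreal (v * ?t k powr n) * ennreal (c k)"
      by (rule mult_right_mono) simp
    also have "\<dots> = ennreal (v * ?t k powr n * c k)"
      using v by (simp add: c_def C_def ennreal_mult[symmetric])
    also have "\<dots> \<le> ennreal ((v * 2 powr (n + s * p) * C * 2 powr p) * (?t k powr (- s * p) * K k powr p + ?t k powr (p - s * p)))"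
    proof (rule ennreal_leI)
      have "v * ?t k powr n * c k = v * C * (?t k powr n * (?t k / 2) powr (- (n + s * p))) * (K k + ?t k) powr p"
        by (simp add: c_def)
      \<comment> \<open>The bound t_k^n for the volume of the shell cancels the n-th power in the
        kernel, leaving the weight t_k^(-s p) up to a constant.\<close>
      also have "?t k powr n * (?t k / 2) powr (- (n + s * p)) = 2 powr (n + s * p) * ?t k powr (- s * p)"
      proof -
        have e1: "(?t k / 2) powr (- (n + s * p)) = ?t k powr (- (n + s * p)) * 2 powr (n + s * p)"
          using t[of k] by (simp only: powr_divide powr_minus_divide less_imp_le zero_le_numeral) simp
        have e2: "?t k powr n * ?t k powr (- (n + s * p)) = ?t k powr (- s * p)"
          using t[of k] by (simp flip: powr_add)
        show ?thesis unfolding e1 mult.assoc[symmetric] e2 by (rule mult.commute)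
      qed
      also have "v * C * (2 powr (n + s * p) * ?t k powr (- s * p)) * (K k + ?t k) powr p
        \<le> v * C * (2 powr (n + s * p) * ?t k powr (- s * p)) * (2 powr p * (K k powr p + ?t k powr p))"
        using abs_add_powr_le[of p "K k" "?t k"] K0[of k] R p v
        by (intro mult_left_mono) (auto simp: C_def)
      also have "\<dots> = (v * 2 powr (n + s * p) * C * 2 powr p) * (?t k powr (- s * p) * K k powr p + ?t k powr (- s * p) * ?t k powr p)"
        by (simp add: algebra_simps)
      also have "?t k powr (- s * p) * ?t k powr p = ?t k powr (p - s * p)"
        using t[of k] by (simp flip: powr_add)
      finally show "v * ?t k powr n * c k \<le> (v * 2 powr (n + s * p) * C * 2 powr p) * (?t k powr (- s * p) * K k powr p + ?t k powr (p - s * p))" .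
    qed
    also have "\<dots> = ennreal (v * 2 powr (n + s * p) * C * 2 powr p) *
      (ennreal (?t k powr (- s * p) * K k powr p) + ennreal (?t k powr (p - s * p)))"
      using v by (simp add: ennreal_mult C_def ennreal_plus)
    finally show "emeasure lborel (?S k) * ennreal (c k) \<le> ennreal (v * 2 powr (n + s * p) * C * 2 powr p) *
      (ennreal (?t k powr (- s * p) * K k powr p) + ennreal (?t k powr (p - s * p)))" .
  qed
  also have "\<dots> = ennreal (v * 2 powr (n + s * p) * C * 2 powr p) *
      ((\<Sum>k. ennreal (?t k powr (- s * p) * K k powr p)) + (\<Sum>k. ennreal (?t k powr (p - s * p))))"
    by (simp only: ennreal_suminf_cmult suminf_add[OF summableI summableI])
  also have "\<dots> < \<infinity>"
  proof -
    have "(\<Sum>k. ennreal (?t k powr (- s * p) * K k powr p)) < \<infinity>"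
      unfolding K_def by (rule interpolation_seminorm_dyadic_sum[OF gh p s(1) R fin])
    moreover have "(\<Sum>k. ennreal (?t k powr (p - s * p))) < \<infinity>"
      using p s by (intro suminf_dyadic_powr_finite R) (simp add: mult_less_cancel_right1)
    ultimately show ?thesis by (auto simp: ennreal_mult_less_top)
  qed
  finally have "restricted_seminorm s p \<Omega> f < \<infinity>"
    by (simp only: restricted_seminorm_finite_iff restricted_energy_cong[OF F(3)])
  then show "f \<in> restricted_space s p \<Omega>"
    using fL by (simp add: restricted_space_def)
qed

section \<open>Chains in uniform domains\<close>

lemma path_length_ge_sum:
  assumes "mono t" "range t \<subseteq> {0..1}"
  shows "ennreal (\<Sum>i<n. dist (g (t i)) (g (t (Suc i)))) \<le> path_length g"
  unfolding path_length_def
  by (rule SUP_upper2[of "(n, t)"]) (use assms in auto)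

lemma path_length_ge_dist:
  assumes "0 \<le> u" "u \<le> v" "v \<le> 1"
  shows "ennreal (dist (g u) (g v)) \<le> path_length g"
proof -
  \<comment> \<open>Sampling sequences are indexed by all naturals, so this one rests at v after its
    first step.\<close>
  let ?t = "\<lambda>i::nat. if i = 0 then u else v"
  have "mono ?t" "range ?t \<subseteq> {0..1}"
    using assms by (auto simp: mono_def)
  from path_length_ge_sum[OF this, where n = 1 and g = g] show ?thesis by simp
qed

text \<open>
  Lengths of subarcs are bounded below by distances of endpoints, which is all that is used of the
  second uniformity condition; enlarging the constants to at least \<open>1\<close> is harmless.
\<close>

definition uniform_with :: "real \<Rightarrow> real \<Rightarrow> 'a::euclidean_space set \<Rightarrow> bool" where
  "uniform_with a b \<Omega> \<longleftrightarrow> 1 \<le> a \<and> 1 \<le> b \<and> (\<forall>x\<in>\<Omega>. \<forall>y\<in>\<Omega>. x \<noteq> y \<longrightarrow>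
     (\<exists>\<gamma>. path \<gamma> \<and> path_image \<gamma> \<subseteq> \<Omega> \<and> pathstart \<gamma> = x \<and> pathfinish \<gamma> = y \<and>
        path_length \<gamma> \<le> ennreal (a * dist x y) \<and>
        (\<forall>u\<in>{0..1}. min (dist x (\<gamma> u)) (dist (\<gamma> u) y) \<le> b * bdist \<Omega> (\<gamma> u))))"

lemma bdist_nonneg: "0 \<le> bdist \<Omega> x"
  by (simp add: bdist_def infdist_nonneg)

lemma uniform_domain_imp_uniform_with:
  assumes "uniform_domain \<Omega>"
  obtains a b where "uniform_with a b \<Omega>"
proof -
  obtain a b :: real where ab: "\<And>x y. x \<in> \<Omega> \<Longrightarrow> y \<in> \<Omega> \<Longrightarrow> x \<noteq> y \<Longrightarrow>
        (\<exists>\<gamma>. arc \<gamma> \<and> path_image \<gamma> \<subseteq> \<Omega> \<and> pathstart \<gamma> = x \<and> pathfinish \<gamma> = y \<and>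
           path_length \<gamma> \<le> ennreal (a * dist x y) \<and>
           (\<forall>u\<in>{0..1}.
              min (path_length (subpath 0 u \<gamma>)) (path_length (subpath u 1 \<gamma>))
                \<le> ennreal (b * bdist \<Omega> (\<gamma> u))))"
    using assms unfolding uniform_domain_def by blast
  have "uniform_with (max a 1) (max b 1) \<Omega>"
    unfolding uniform_with_def
  proof (intro conjI ballI impI)
    fix x y assume xy: "x \<in> \<Omega>" "y \<in> \<Omega>" "x \<noteq> y"
    obtain \<gamma> where \<gamma>: "arc \<gamma>" "path_image \<gamma> \<subseteq> \<Omega>" "pathstart \<gamma> = x" "pathfinish \<gamma> = y"
      "path_length \<gamma> \<le> ennreal (a * dist x y)"
      "\<And>u. u \<in> {0..1} \<Longrightarrow> min (path_length (subpath 0 u \<gamma>)) (path_length (subpath u 1 \<gamma>)) \<le> ennreal (b * bdist \<Omega> (\<gamma> u))"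
      using ab[OF xy] by blast
    have "path_length \<gamma> \<le> ennreal (max a 1 * dist x y)"
      by (rule order_trans[OF \<gamma>(5)]) (auto intro!: ennreal_leI mult_right_mono)
    moreover have "min (dist x (\<gamma> u)) (dist (\<gamma> u) y) \<le> max b 1 * bdist \<Omega> (\<gamma> u)" if u: "u \<in> {0..1}" for u
    proof -
      have "ennreal (dist x (\<gamma> u)) \<le> path_length (subpath 0 u \<gamma>)"
        using path_length_ge_dist[of 0 1 "subpath 0 u \<gamma>"] \<gamma>(3) by (simp add: subpath_def pathstart_def)
      moreover have "ennreal (dist (\<gamma> u) y) \<le> path_length (subpath u 1 \<gamma>)"
        using path_length_ge_dist[of 0 1 "subpath u 1 \<gamma>"] \<gamma>(4) by (simp add: subpath_def pathfinish_def)
      ultimately have "min (ennreal (dist x (\<gamma> u))) (ennreal (dist (\<gamma> u) y)) \<le> ennreal (b * bdist \<Omega> (\<gamma> u))"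
        using \<gamma>(6)[OF u] by (meson min.mono order_trans)
      also have "\<dots> \<le> ennreal (max b 1 * bdist \<Omega> (\<gamma> u))"
        by (intro ennreal_leI mult_right_mono) (auto simp: bdist_nonneg)
      finally have "ennreal (min (dist x (\<gamma> u)) (dist (\<gamma> u) y)) \<le> ennreal (max b 1 * bdist \<Omega> (\<gamma> u))"
        by (auto simp: min_def split: if_splits)
      then show ?thesis by (subst (asm) ennreal_le_iff) (auto simp: bdist_nonneg)
    qed
    ultimately show "\<exists>\<gamma>. path \<gamma> \<and> path_image \<gamma> \<subseteq> \<Omega> \<and> pathstart \<gamma> = x \<and> pathfinish \<gamma> = y \<and>
        path_length \<gamma> \<le> ennreal (max a 1 * dist x y) \<and>
        (\<forall>u\<in>{0..1}. min (dist x (\<gamma> u)) (dist (\<gamma> u) y) \<le> max b 1 * bdist \<Omega> (\<gamma> u))"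
      using \<gamma>(1-4) arc_imp_path by blast
  qed auto
  then show thesis by (rule that)
qed

text \<open>Two points of \<Omega> at distance D leave every x a partner at distance at least D / 2.
  The path between them has a point at distance t from x; for t \<le> D / 4 its distance to the
  partner is at least t too, and the second uniformity condition turns this into boundary distance t
  / b.\<close>

lemma corkscrew:
  fixes \<Omega> :: "'a::euclidean_space set"
  assumes dom: "bounded_domain \<Omega>" and U: "uniform_with a b \<Omega>"
  obtains t0 where "0 < t0" "\<And>x t. x \<in> \<Omega> \<Longrightarrow> 0 < t \<Longrightarrow> t \<le> t0 \<Longrightarrow> \<exists>z\<in>\<Omega>. dist x z \<le> t \<and> t / b \<le> bdist \<Omega> z"
proof -
  have b: "1 \<le> b" using U by (simp add: uniform_with_def)
  obtain q where q: "q \<in> \<Omega>" using dom by (auto simp: bounded_domain_def)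
  have "open \<Omega>" using dom by (simp add: bounded_domain_def)
  then have "\<not> \<Omega> \<subseteq> {q}"
    using q not_open_singleton[of q] by (metis subset_singleton_iff empty_iff)
  then obtain q' where q': "q' \<in> \<Omega>" "q' \<noteq> q" by blast
  define D where "D = dist q q'"
  have D: "0 < D" using q'(2) by (simp add: D_def)
  have "\<exists>z\<in>\<Omega>. dist x z \<le> t \<and> t / b \<le> bdist \<Omega> z" if x: "x \<in> \<Omega>" and t: "0 < t" "t \<le> D / 4" for x t
  proof -
    have "\<exists>y\<in>\<Omega>. D / 2 \<le> dist x y"
    proof (rule ccontr)
      assume "\<not> ?thesis"
      then have "dist x q < D / 2" "dist x q' < D / 2" using q q' by auto
      then show False using dist_triangle[of q q' x] by (simp add: D_def dist_commute)
    qed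
    then obtain y where y: "y \<in> \<Omega>" "D / 2 \<le> dist x y" by blast
    then have "x \<noteq> y" using D by auto
    then obtain \<gamma> where \<gamma>: "path \<gamma>" "path_image \<gamma> \<subseteq> \<Omega>" "pathstart \<gamma> = x" "pathfinish \<gamma> = y"
      "\<And>u. u \<in> {0..1} \<Longrightarrow> min (dist x (\<gamma> u)) (dist (\<gamma> u) y) \<le> b * bdist \<Omega> (\<gamma> u)"
      using U x y(1) unfolding uniform_with_def by metis
    have "continuous_on {0..1} (\<lambda>u. dist x (\<gamma> u))"
      using \<gamma>(1) unfolding path_def by (intro continuous_intros)
    then obtain u where u: "u \<in> {0..1}" "dist x (\<gamma> u) = t"
      using IVT'[of "\<lambda>u. dist x (\<gamma> u)" 0 t 1] \<gamma>(3,4) t y(2) D by (auto simp: pathstart_def pathfinish_def)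
    have "D / 2 - t \<le> dist (\<gamma> u) y"
      using dist_triangle[of x y "\<gamma> u"] u(2) y(2) by simp
    then have "t \<le> min (dist x (\<gamma> u)) (dist (\<gamma> u) y)" using u(2) t(2) by simp
    also have "\<dots> \<le> b * bdist \<Omega> (\<gamma> u)" by (rule \<gamma>(5)[OF u(1)])
    finally have "t / b \<le> bdist \<Omega> (\<gamma> u)" using b by (simp add: divide_le_eq mult.commute)
    moreover have "\<gamma> u \<in> \<Omega>" using \<gamma>(2) u(1) by (auto simp: path_image_def)
    ultimately show ?thesis using u(2) by auto
  qed
  then show thesis using that[of "D / 4"] D by auto
qed

text \<open>One greedy step: jump to the end if it is within e, and otherwise move on until the
  distance is exactly e.\<close>

lemma next_point_on_path:
  fixes \<gamma> :: "real \<Rightarrow> 'a::metric_space"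
  assumes "path \<gamma>" "u \<in> {0..1}" "0 < e"
  shows "\<exists>v\<in>{u..1}. dist (\<gamma> u) (\<gamma> v) \<le> e \<and> (v \<noteq> 1 \<longrightarrow> dist (\<gamma> u) (\<gamma> v) = e)"
proof (cases "dist (\<gamma> u) (\<gamma> 1) \<le> e")
  case False
  have "continuous_on {u..1} \<gamma>"
    using assms(1,2) unfolding path_def by (auto intro: continuous_on_subset)
  then have "continuous_on {u..1} (\<lambda>v. dist (\<gamma> u) (\<gamma> v))"
    by (intro continuous_intros)
  then obtain v where "u \<le> v" "v \<le> 1" "dist (\<gamma> u) (\<gamma> v) = e"
    using IVT'[of "\<lambda>v. dist (\<gamma> u) (\<gamma> v)" u e 1] assms(2,3) False by auto
  then show ?thesis by (intro bexI[of _ v]) auto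
qed (use assms in auto)

text \<open>A step that stops before the end covers distance exactly e, so N of them would inscribe
  a polygon of length N e > L. The number of steps thus depends on L and e alone; the sequence rests
  at 1 once it arrives there.\<close>

lemma path_greedy_partition:
  fixes \<gamma> :: "real \<Rightarrow> 'a::metric_space"
  assumes \<gamma>: "path \<gamma>" and len: "path_length \<gamma> \<le> ennreal L" and e: "0 < e" and N: "L < real N * e" and L: "0 \<le> L"
  obtains T where "T 0 = 0" "T N = 1" "\<And>i. T i \<in> {0..1}" "\<And>i. dist (\<gamma> (T i)) (\<gamma> (T (Suc i))) \<le> e"
proof -
  obtain nxt where nxt: "\<And>u. u \<in> {0..1} \<Longrightarrow> nxt u \<in> {u..1} \<and> dist (\<gamma> u) (\<gamma> (nxt u)) \<le> e \<and> (nxt u \<noteq> 1 \<longrightarrow> dist (\<gamma> u) (\<gamma> (nxt u)) = e)"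
    using next_point_on_path[OF \<gamma> _ e] by metis
  define T where "T i = (nxt ^^ i) 0" for i
  have T0: "T 0 = 0" and TS: "T (Suc i) = nxt (T i)" for i by (simp_all add: T_def)
  have T01: "T i \<in> {0..1}" for i
  proof (induction i)
    case (Suc i)
    then show ?case using nxt[OF Suc] by (auto simp: TS)
  qed (simp add: T0)
  have mono: "mono T"
    by (rule incseq_SucI) (use nxt[OF T01] in \<open>auto simp: TS\<close>)
  have step: "dist (\<gamma> (T i)) (\<gamma> (T (Suc i))) \<le> e" for i
    using nxt[OF T01] by (simp add: TS)
  have "T N = 1"
  proof (rule ccontr)
    assume "T N \<noteq> 1"
    then have lt: "T N < 1" using T01[of N] by auto
    have "dist (\<gamma> (T i)) (\<gamma> (T (Suc i))) = e" if "i < N" for i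
    proof -
      have "T (Suc i) \<le> T N" using that mono by (simp add: monoD)
      then show ?thesis using nxt[OF T01[of i]] lt by (auto simp: TS)
    qed
    then have "(\<Sum>i<N. dist (\<gamma> (T i)) (\<gamma> (T (Suc i)))) = real N * e" by simp
    then have "ennreal (real N * e) \<le> ennreal L"
      using path_length_ge_sum[OF mono, where n = N and g = \<gamma>] T01 len by (auto simp: image_subset_iff elim: order_trans)
    then show False using N L by (simp add: ennreal_le_iff)
  qed
  then show thesis using that[of T] T0 T01 step by blast
qed

text \<open>The length N depends on a, \<Lambda> and \<delta> but not on t or the endpoints, which
  makes later constants scale-invariant. Path points within \<kappa> t / 2 of an endpoint keep
  boundary distance \<kappa> t / 2; elsewhere both distances are at least \<kappa> t / 2 and the
  second uniformity condition divides this by b.\<close>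

lemma uniform_chain:
  fixes \<Omega> :: "'a::euclidean_space set"
  assumes U: "uniform_with a b \<Omega>" and \<kappa>: "0 < \<kappa>" and \<Lambda>: "0 < \<Lambda>" and \<delta>: "0 < \<delta>" and N: "a * \<Lambda> < real N * \<delta>"
    and t: "0 < t" and PQ: "P \<in> \<Omega>" "Q \<in> \<Omega>" "dist P Q \<le> \<Lambda> * t" "\<kappa> * t \<le> bdist \<Omega> P" "\<kappa> * t \<le> bdist \<Omega> Q"
  shows "\<exists>w. w 0 = P \<and> w N = Q \<and> (\<forall>i. w i \<in> \<Omega> \<and> \<kappa> / (2 * b) * t \<le> bdist \<Omega> (w i) \<and> dist P (w i) \<le> a * \<Lambda> * t) \<and>
    (\<forall>i. dist (w i) (w (Suc i)) \<le> \<delta> * t)"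
proof -
  have ab: "1 \<le> a" "1 \<le> b" using U by (auto simp: uniform_with_def)
  have k2: "\<kappa> / (2 * b) * t \<le> \<kappa> * t / 2"
    using ab \<kappa> t by (simp add: field_simps mult_le_cancel_left1)
  have aL: "0 \<le> a * \<Lambda> * t" using ab \<Lambda> t by simp
  show ?thesis
  \<comment> \<open>Paths are provided for distinct points; for equal ones the constant chain
    serves.\<close>
  proof (cases "P = Q")
    case True
    have "\<kappa> / (2 * b) * t \<le> bdist \<Omega> P"
      using k2 PQ(4) \<kappa> t mult_pos_pos[OF \<kappa> t] by linarith
    then show ?thesis
      using True PQ(1) aL \<delta> t by (intro exI[of _ "\<lambda>_. P"]) auto
  next
    case False
    then obtain \<gamma> where \<gamma>: "path \<gamma>" "path_image \<gamma> \<subseteq> \<Omega>" "pathstart \<gamma> = P" "pathfinish \<gamma> = Q"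
      "path_length \<gamma> \<le> ennreal (a * dist P Q)"
      "\<And>u. u \<in> {0..1} \<Longrightarrow> min (dist P (\<gamma> u)) (dist (\<gamma> u) Q) \<le> b * bdist \<Omega> (\<gamma> u)"
      using U PQ(1,2) unfolding uniform_with_def by metis
    have "a * dist P Q \<le> a * (\<Lambda> * t)"
      using PQ(3) ab by (intro mult_left_mono) auto
    then have len: "path_length \<gamma> \<le> ennreal (a * \<Lambda> * t)"
      using \<gamma>(5) by (auto simp: mult.assoc intro: order_trans ennreal_leI)
    have "a * \<Lambda> * t < real N * (\<delta> * t)"
      using N t by (simp add: mult.assoc[symmetric])
    from path_greedy_partition[OF \<gamma>(1) len mult_pos_pos[OF \<delta> t] this aL]
    obtain T where T: "T 0 = 0" "T N = 1" "\<And>i. T i \<in> {0..1}"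
      "\<And>i. dist (\<gamma> (T i)) (\<gamma> (T (Suc i))) \<le> \<delta> * t" by metis
    have "\<gamma> u \<in> \<Omega> \<and> \<kappa> / (2 * b) * t \<le> bdist \<Omega> (\<gamma> u) \<and> dist P (\<gamma> u) \<le> a * \<Lambda> * t" if u: "u \<in> {0..1}" for u
    proof (intro conjI)
      show "\<gamma> u \<in> \<Omega>" using \<gamma>(2) u by (auto simp: path_image_def)
      have "ennreal (dist P (\<gamma> u)) \<le> ennreal (a * \<Lambda> * t)"
        using path_length_ge_dist[of 0 u \<gamma>] u \<gamma>(3) len by (auto simp: pathstart_def elim: order_trans)
      then show "dist P (\<gamma> u) \<le> a * \<Lambda> * t"
        using aL by (simp add: ennreal_le_iff)
      show "\<kappa> / (2 * b) * t \<le> bdist \<Omega> (\<gamma> u)"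
      proof (cases "dist P (\<gamma> u) < \<kappa> * t / 2 \<or> dist (\<gamma> u) Q < \<kappa> * t / 2")
        case True
        then show ?thesis
          using k2 PQ(4,5) abs_bdist_diff_le[of \<Omega> P "\<gamma> u"] abs_bdist_diff_le[of \<Omega> "\<gamma> u" Q] by argo
      next
        case False
        then have "\<kappa> * t / 2 \<le> b * bdist \<Omega> (\<gamma> u)"
          using \<gamma>(6)[OF u] by linarith
        then show ?thesis using ab by (simp add: field_simps)
      qed
    qed
    then show ?thesis
      using T \<gamma>(3,4) by (intro exI[of _ "\<lambda>i. \<gamma> (T i)"]) (auto simp: pathstart_def pathfinish_def)
  qed
qed

section \<open>Smooth partitions of unity on grids\<close>

text \<open>The truncated square is C^1, and that much smoothness suffices for the Sobolev parts of
  the decompositions.\<close>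

definition pos_sq :: "real \<Rightarrow> real" where
  "pos_sq u = (max 0 u)\<^sup>2"

lemma pos_sq_has_derivative: "(pos_sq has_real_derivative 2 * max 0 u) (at u)"
proof (cases "u = 0")
  case True
  have "((\<lambda>h::real. (max 0 h)\<^sup>2 / h) \<longlongrightarrow> 0) (at 0)"
  proof (rule Lim_null_comparison)
    show "\<forall>\<^sub>F h in at 0. norm ((max 0 h)\<^sup>2 / h) \<le> \<bar>h::real\<bar>"
      by (rule always_eventually) (auto simp: max_def power2_eq_square)
    show "((\<lambda>h::real. \<bar>h\<bar>) \<longlongrightarrow> 0) (at 0)"
      by (rule tendsto_rabs_zero) simp
  qed
  then show ?thesis
    using True by (simp add: DERIV_def pos_sq_def)
next
  case False
  show ?thesis
  proof (cases "0 < u")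
    case True
    have "((\<lambda>u. u\<^sup>2) has_real_derivative 2 * max 0 u) (at u)"
      using True by (auto intro!: derivative_eq_intros)
    then show ?thesis
      by (rule DERIV_cong_ev[THEN iffD1, rotated 3])
        (auto simp: pos_sq_def True intro!: eventually_mono[OF eventually_nhds_in_open[of "{0<..}" u]])
  next
    case F: False
    then have u: "u < 0" using False by simp
    have "((\<lambda>u. 0) has_real_derivative 2 * max 0 u) (at u)"
      using u by auto
    then show ?thesis
      by (rule DERIV_cong_ev[THEN iffD1, rotated 3])
        (auto simp: pos_sq_def u max_def intro!: eventually_mono[OF eventually_nhds_in_open[of "{..<0}" u]])
  qed
qed

text \<open>Sums of integer translates of \<open>step_fun u - step_fun (u - 1)\<close> telescope to \<open>1\<close>.\<close>

definition step_fun :: "real \<Rightarrow> real" where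
  "step_fun u = 2 * pos_sq u - 4 * pos_sq (u - 1/2) + 2 * pos_sq (u - 1)"

text \<open>A tent over [0, 1] with peak 2 at 1/2, hence of area 1, so that its primitive climbs
  from 0 to 1.\<close>

definition step_deriv :: "real \<Rightarrow> real" where
  "step_deriv u = 4 * max 0 u - 8 * max 0 (u - 1/2) + 4 * max 0 (u - 1)"

lemma step_fun_has_derivative: "(step_fun has_real_derivative step_deriv u) (at u)"
proof -
  have *: "((\<lambda>u. pos_sq (u - c)) has_real_derivative 2 * max 0 (u - c)) (at u)" for c
    using DERIV_shift[of pos_sq "2 * max 0 (u - c)" u "- c"] pos_sq_has_derivative[of "u - c"] by simp
  have "((\<lambda>u. 2 * pos_sq u - 4 * pos_sq (u - 1/2) + 2 * pos_sq (u - 1)) has_real_derivative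
      2 * (2 * max 0 u) - 4 * (2 * max 0 (u - 1/2)) + 2 * (2 * max 0 (u - 1))) (at u)"
    by (intro DERIV_add DERIV_diff DERIV_cmult pos_sq_has_derivative *)
  then show ?thesis
    by (simp add: step_fun_def[abs_def] step_deriv_def)
qed

lemma step_fun_simps: "u \<le> 0 \<Longrightarrow> step_fun u = 0" "1 \<le> u \<Longrightarrow> step_fun u = 1"
  by (auto simp: step_fun_def pos_sq_def max_def power2_eq_square algebra_simps)

lemma step_deriv_bounds: "0 \<le> step_deriv u" "step_deriv u \<le> 2"
  by (auto simp: step_deriv_def max_def)

lemma step_deriv_eq_0: "u \<le> 0 \<or> 1 \<le> u \<Longrightarrow> step_deriv u = 0"
  by (auto simp: step_deriv_def max_def)

lemma continuous_on_step: "continuous_on A step_fun" "continuous_on A step_deriv"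
  by (auto simp: step_fun_def[abs_def] pos_sq_def step_deriv_def[abs_def] intro!: continuous_intros)

lemma step_fun_mono: "u \<le> v \<Longrightarrow> step_fun u \<le> step_fun v"
  by (rule DERIV_nonneg_imp_nondecreasing) (use step_fun_has_derivative step_deriv_bounds in blast)+

lemma step_fun_bounds: "0 \<le> step_fun u" "step_fun u \<le> 1"
  using step_fun_mono[of "min u 0" u] step_fun_mono[of u "max u 1"] step_fun_simps by auto

definition hat :: "real \<Rightarrow> real" where
  "hat u = step_fun u - step_fun (u - 1)"

definition hat_deriv :: "real \<Rightarrow> real" where
  "hat_deriv u = step_deriv u - step_deriv (u - 1)"

lemma hat_has_derivative: "(hat has_real_derivative hat_deriv u) (at u)"
proof -
  have "((\<lambda>u. step_fun (u - 1)) has_real_derivative step_deriv (u - 1)) (at u)"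
    using DERIV_shift[of step_fun "step_deriv (u - 1)" u "- 1"] step_fun_has_derivative[of "u - 1"] by simp
  then show ?thesis
    unfolding hat_def[abs_def] hat_deriv_def by (intro DERIV_diff step_fun_has_derivative)
qed

lemma hat_bounds: "0 \<le> hat u" "hat u \<le> 1"
  using step_fun_mono[of "u - 1" u] step_fun_bounds[of u] step_fun_bounds[of "u - 1"] by (auto simp: hat_def)

lemma hat_eq_0: "\<not> (0 < u \<and> u < 2) \<Longrightarrow> hat u = 0"
  by (auto simp: hat_def step_fun_simps)

lemma hat_deriv_bound: "\<bar>hat_deriv u\<bar> \<le> 2"
  using step_deriv_bounds[of u] step_deriv_bounds[of "u - 1"] by (auto simp: hat_deriv_def)

lemma hat_deriv_eq_0: "\<not> (0 < u \<and> u < 2) \<Longrightarrow> hat_deriv u = 0"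
  by (auto simp: hat_deriv_def step_deriv_eq_0)

lemma continuous_on_hat: "continuous_on A hat" "continuous_on A hat_deriv"
  unfolding hat_def[abs_def] hat_deriv_def[abs_def]
  by (intro continuous_intros continuous_on_compose2[OF continuous_on_step(1)[of UNIV]] continuous_on_compose2[OF continuous_on_step(2)[of UNIV]]; simp)+

lemma sum_telescope_int:
  fixes f :: "real \<Rightarrow> real"
  shows "(\<Sum>m\<in>{- int M..int M}. f (u - real_of_int m) - f (u - real_of_int m - 1)) = f (u + M) - f (u - M - 1)"
proof (induction M)
  case (Suc M)
  have "{- int (Suc M)..int (Suc M)} = insert (- int (Suc M)) (insert (int (Suc M)) {- int M..int M})"
    by auto
  then show ?case using Suc by (simp add: algebra_simps)
qed simp

lemma sum_hat: "1 \<le> u + real M \<Longrightarrow> u \<le> real M + 1 \<Longrightarrow> (\<Sum>m\<in>{- int M..int M}. hat (u - real_of_int m)) = 1"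
  using sum_telescope_int[of step_fun u M] by (simp add: hat_def step_fun_simps)

lemma sum_hat_deriv: "1 \<le> u + real M \<Longrightarrow> u \<le> real M + 1 \<Longrightarrow> (\<Sum>m\<in>{- int M..int M}. hat_deriv (u - real_of_int m)) = 0"
  using sum_telescope_int[of step_deriv u M] by (simp add: hat_deriv_def step_deriv_eq_0)

definition bump :: "real \<Rightarrow> ('a::euclidean_space \<Rightarrow> int) \<Rightarrow> 'a \<Rightarrow> real" where
  "bump t m x = (\<Prod>i\<in>Basis. hat (x \<bullet> i / t - of_int (m i)))"

definition bump_deriv :: "real \<Rightarrow> ('a::euclidean_space \<Rightarrow> int) \<Rightarrow> 'a \<Rightarrow> 'a \<Rightarrow> real" where
  "bump_deriv t m i x = hat_deriv (x \<bullet> i / t - of_int (m i)) / t * (\<Prod>j\<in>Basis - {i}. hat (x \<bullet> j / t - of_int (m j)))"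

text \<open>A finite piece of the lattice. \<open>PiE\<close> fixes values outside
  \<open>Basis\<close>, so an index is determined by its coordinates; M is later taken so large that
  the bumps kept here still sum to 1 on \<Omega>.\<close>

definition grid :: "nat \<Rightarrow> ('a::euclidean_space \<Rightarrow> int) set" where
  "grid M = PiE Basis (\<lambda>_. {- int M..int M})"

text \<open>For positive t, membership in the open cube with lower corner t m and side 2 t, off
  which the bump of index m and its partial derivatives vanish.\<close>

definition active :: "real \<Rightarrow> ('a::euclidean_space \<Rightarrow> int) \<Rightarrow> 'a \<Rightarrow> bool" where
  "active t m x \<longleftrightarrow> (\<forall>i\<in>Basis. 0 < x \<bullet> i / t - of_int (m i) \<and> x \<bullet> i / t - of_int (m i) < 2)"

lemma finite_grid [simp]: "finite (grid M)"
  by (simp add: grid_def finite_PiE)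

lemma bump_has_derivative:
  assumes "t \<noteq> 0"
  shows "(bump t m has_derivative (\<lambda>v. \<Sum>i\<in>Basis. (v \<bullet> i) * bump_deriv t m i x)) (at x)"
proof -
  have "((\<lambda>x. hat (x \<bullet> i / t - of_int (m i))) has_derivative (\<lambda>v. hat_deriv (x \<bullet> i / t - of_int (m i)) * (v \<bullet> i / t))) (at x)" for i
    by (rule has_derivative_compose[OF _ hat_has_derivative[unfolded has_field_derivative_def]])
      (auto intro!: derivative_eq_intros simp: assms)
  then have "(bump t m has_derivative (\<lambda>v. \<Sum>i\<in>Basis. hat_deriv (x \<bullet> i / t - of_int (m i)) * (v \<bullet> i / t) *
      (\<Prod>j\<in>Basis - {i}. hat (x \<bullet> j / t - of_int (m j))))) (at x)"
    unfolding bump_def[abs_def] by (rule has_derivative_prod)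
  moreover have "(\<lambda>v. \<Sum>i\<in>Basis. hat_deriv (x \<bullet> i / t - of_int (m i)) * (v \<bullet> i / t) *
      (\<Prod>j\<in>Basis - {i}. hat (x \<bullet> j / t - of_int (m j)))) = (\<lambda>v. \<Sum>i\<in>Basis. (v \<bullet> i) * bump_deriv t m i x)"
    by (auto simp: fun_eq_iff bump_deriv_def intro!: sum.cong)
  ultimately show ?thesis by simp
qed

lemma continuous_on_bump_deriv: "t \<noteq> 0 \<Longrightarrow> continuous_on A (bump_deriv t m i)"
  unfolding bump_deriv_def[abs_def]
  by (intro continuous_intros continuous_on_compose2[OF continuous_on_hat(1)[of UNIV]] continuous_on_compose2[OF continuous_on_hat(2)[of UNIV]]) auto

lemma bump_nonneg: "0 \<le> bump t m x"
  unfolding bump_def by (intro prod_nonneg) (simp add: hat_bounds)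

lemma bump_inactive:
  assumes "\<not> active t m x"
  shows "bump t m x = 0"
proof -
  obtain j where j: "j \<in> Basis" "\<not> (0 < x \<bullet> j / t - of_int (m j) \<and> x \<bullet> j / t - of_int (m j) < 2)"
    using assms by (auto simp: active_def)
  from hat_eq_0[OF j(2)] show ?thesis
    unfolding bump_def by (intro prod_zero finite_Basis bexI[OF _ j(1)])
qed

lemma bump_deriv_inactive:
  assumes "\<not> active t m x" "i \<in> Basis"
  shows "bump_deriv t m i x = 0"
proof -
  obtain j where j: "j \<in> Basis" "\<not> (0 < x \<bullet> j / t - of_int (m j) \<and> x \<bullet> j / t - of_int (m j) < 2)"
    using assms(1) by (auto simp: active_def)
  show ?thesis
  proof (cases "j = i")
    case True
    then show ?thesis using hat_deriv_eq_0[OF j(2)] by (simp add: bump_deriv_def)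
  next
    case False
    then have "(\<Prod>j\<in>Basis - {i}. hat (x \<bullet> j / t - of_int (m j))) = 0"
      using j hat_eq_0[OF j(2)] by (intro prod_zero) auto
    then show ?thesis by (simp add: bump_deriv_def)
  qed
qed

lemma bump_deriv_bound:
  assumes "0 < t"
  shows "\<bar>bump_deriv t m i x\<bar> \<le> 2 / t"
proof -
  have "\<bar>bump_deriv t m i x\<bar> = \<bar>hat_deriv (x \<bullet> i / t - of_int (m i))\<bar> / t * (\<Prod>j\<in>Basis - {i}. hat (x \<bullet> j / t - of_int (m j)))"
    using assms by (simp add: bump_deriv_def abs_mult abs_prod hat_bounds prod_nonneg)
  also have "\<dots> \<le> 2 / t * 1"
    using assms hat_deriv_bound by (intro mult_mono divide_right_mono prod_le_1) (auto simp: hat_bounds intro!: prod_nonneg)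
  finally show ?thesis by simp
qed

lemma sum_bump:
  assumes "\<And>i. i \<in> Basis \<Longrightarrow> \<bar>x \<bullet> i / t\<bar> + 1 \<le> real M"
  shows "(\<Sum>m\<in>grid M. bump t m x) = 1"
proof -
  have "(\<Sum>m\<in>grid M. bump t m x) = (\<Prod>i\<in>Basis. \<Sum>m\<in>{- int M..int M}. hat (x \<bullet> i / t - of_int m))"
    unfolding grid_def bump_def by (subst prod_sum_PiE) auto
  also have "\<dots> = (\<Prod>i\<in>(Basis::'a set). 1)"
  proof (intro prod.cong refl sum_hat)
    fix i :: 'a assume "i \<in> Basis"
    from assms[OF this] show "1 \<le> x \<bullet> i / t + real M" "x \<bullet> i / t \<le> real M + 1"
      by linarith+
  qed
  finally show ?thesis by simp
qed

text \<open>The sum factorises over the coordinates, and the factor of the differentiated coordinate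
  telescopes to 0.\<close>

lemma sum_bump_deriv:
  assumes "\<And>i. i \<in> Basis \<Longrightarrow> \<bar>x \<bullet> i / t\<bar> + 1 \<le> real M" and i: "i \<in> Basis"
  shows "(\<Sum>m\<in>grid M. bump_deriv t m i x) = 0"
proof -
  let ?f = "\<lambda>j m. if j = i then hat_deriv (x \<bullet> i / t - of_int m) / t else hat (x \<bullet> j / t - of_int m)"
  have "bump_deriv t m i x = (\<Prod>j\<in>Basis. ?f j (m j))" for m
  proof -
    have "(\<Prod>j\<in>Basis. ?f j (m j)) = ?f i (m i) * (\<Prod>j\<in>Basis - {i}. ?f j (m j))"
      using i by (intro prod.remove) auto
    also have "(\<Prod>j\<in>Basis - {i}. ?f j (m j)) = (\<Prod>j\<in>Basis - {i}. hat (x \<bullet> j / t - of_int (m j)))"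
      by (intro prod.cong) auto
    finally show ?thesis by (simp add: bump_deriv_def)
  qed
  then have "(\<Sum>m\<in>grid M. bump_deriv t m i x) = (\<Prod>j\<in>Basis. \<Sum>m\<in>{- int M..int M}. ?f j m)"
    unfolding grid_def by (subst prod_sum_PiE) auto
  also have "\<dots> = 0"
  proof (rule prod_zero)
    have "(\<Sum>m\<in>{- int M..int M}. hat_deriv (x \<bullet> i / t - of_int m)) = 0"
      using assms(1)[OF i] by (intro sum_hat_deriv) linarith+
    then have "(\<Sum>m\<in>{- int M..int M}. ?f i m) = 0"
      by (simp flip: sum_divide_distrib)
    then show "\<exists>j\<in>Basis. (\<Sum>m\<in>{- int M..int M}. ?f j m) = 0"
      using i by blast
  qed simp
  finally show ?thesis .
qed

text \<open>In each coordinate an active index lies strictly between x / t - 2 and x / t, which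
  leaves two integers.\<close>

lemma card_active:
  "card {m \<in> grid M. active t m x} \<le> 2 ^ DIM('a)" for x :: "'a::euclidean_space"
proof -
  let ?A = "\<lambda>i. {\<lceil>x \<bullet> i / t\<rceil> - 2, \<lceil>x \<bullet> i / t\<rceil> - 1}"
  have "{m \<in> grid M. active t m x} \<subseteq> PiE Basis ?A"
  proof
    fix m assume m: "m \<in> {m \<in> grid M. active t m x}"
    have "m i \<in> ?A i" if "i \<in> Basis" for i
    proof -
      have "0 < x \<bullet> i / t - of_int (m i)" "x \<bullet> i / t - of_int (m i) < 2"
        using m that by (auto simp: active_def)
      then have "m i < \<lceil>x \<bullet> i / t\<rceil>" "\<lceil>x \<bullet> i / t\<rceil> \<le> m i + 2"
        by (auto simp: less_ceiling_iff ceiling_le_iff)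
      then show ?thesis by auto
    qed
    then show "m \<in> PiE Basis ?A"
      using m by (auto simp: grid_def PiE_def)
  qed
  then have "card {m \<in> grid M. active t m x} \<le> card (PiE Basis ?A)"
    by (intro card_mono finite_PiE) auto
  also have "\<dots> = 2 ^ DIM('a)"
    by (simp add: card_PiE numeral_2_eq_2)
  finally show ?thesis .
qed

lemma exists_active:
  assumes "\<And>i. i \<in> Basis \<Longrightarrow> \<bar>x \<bullet> i / t\<bar> + 1 \<le> real M"
  obtains m where "m \<in> grid M" "active t m x"
proof -
  have "(\<Sum>m\<in>grid M. bump t m x) \<noteq> 0" using sum_bump[OF assms] by simp
  then obtain m where "m \<in> grid M" "bump t m x \<noteq> 0" by (meson sum.neutral)
  then show thesis using that bump_inactive by blast
qed

text \<open>The sum is a convex combination of active coefficients. Naming one worst index, instead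
  of a maximum, lets its p-th power be estimated later by comparing just two averages.\<close>

lemma sum_bump_deviation:
  fixes x :: "'a::euclidean_space"
  assumes M: "\<And>i. i \<in> Basis \<Longrightarrow> \<bar>x \<bullet> i / t\<bar> + 1 \<le> real M"
  shows "\<exists>m\<in>grid M. active t m x \<and> \<bar>(\<Sum>m\<in>grid M. c m * bump t m x) - c0\<bar> \<le> \<bar>c m - c0\<bar>"
proof -
  let ?A = "{m \<in> grid M. active t m x}"
  have A: "finite ?A" "?A \<noteq> {}" using exists_active[OF M] by auto
  define e where "e = Max ((\<lambda>m. \<bar>c m - c0\<bar>) ` ?A)"
  have "e \<in> (\<lambda>m. \<bar>c m - c0\<bar>) ` ?A" unfolding e_def using A by (intro Max_in) auto
  then obtain m where m: "m \<in> ?A" "e = \<bar>c m - c0\<bar>" by blast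
  have le: "\<bar>c k - c0\<bar> \<le> e" if "k \<in> ?A" for k
    unfolding e_def using A(1) that by (intro Max_ge) auto
  have "(\<Sum>m\<in>grid M. c m * bump t m x) - c0 = (\<Sum>m\<in>grid M. (c m - c0) * bump t m x)"
    using sum_bump[OF M] by (simp add: left_diff_distrib sum_subtractf flip: sum_distrib_left)
  also have "\<bar>\<dots>\<bar> \<le> (\<Sum>m\<in>grid M. \<bar>c m - c0\<bar> * bump t m x)"
    by (rule order_trans[OF sum_abs]) (simp add: abs_mult bump_nonneg)
  also have "\<dots> \<le> (\<Sum>m\<in>grid M. e * bump t m x)"
  proof (rule sum_mono)
    fix k :: "'a \<Rightarrow> int" assume k: "k \<in> grid M"
    show "\<bar>c k - c0\<bar> * bump t k x \<le> e * bump t k x"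
      using le[of k] k bump_inactive[of t k x] bump_nonneg[of t k x]
      by (cases "active t k x") (auto intro: mult_right_mono)
  qed
  also have "\<dots> = e" using sum_bump[OF M] by (simp flip: sum_distrib_left)
  finally show ?thesis using m by auto
qed

text \<open>Since the derivatives sum to zero, c0 may be subtracted from all coefficients; the at
  most 2^n active terms are each bounded by 2 / t times the worst deviation.\<close>

lemma sum_bump_deriv_deviation:
  fixes x :: "'a::euclidean_space"
  assumes M: "\<And>i. i \<in> Basis \<Longrightarrow> \<bar>x \<bullet> i / t\<bar> + 1 \<le> real M" and t: "0 < t" and i: "i \<in> Basis"
  shows "\<exists>m\<in>grid M. active t m x \<and> \<bar>\<Sum>m\<in>grid M. c m * bump_deriv t m i x\<bar> \<le> 2 ^ DIM('a) * (2 / t) * \<bar>c m - c0\<bar>"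
proof -
  let ?A = "{m \<in> grid M. active t m x}"
  have A: "finite ?A" "?A \<noteq> {}" using exists_active[OF M] by auto
  define e where "e = Max ((\<lambda>m. \<bar>c m - c0\<bar>) ` ?A)"
  have "e \<in> (\<lambda>m. \<bar>c m - c0\<bar>) ` ?A" unfolding e_def using A by (intro Max_in) auto
  then obtain m where m: "m \<in> ?A" "e = \<bar>c m - c0\<bar>" by blast
  have le: "\<bar>c k - c0\<bar> \<le> e" if "k \<in> ?A" for k
    unfolding e_def using A(1) that by (intro Max_ge) auto
  have "(\<Sum>m\<in>grid M. c m * bump_deriv t m i x) = (\<Sum>m\<in>grid M. (c m - c0) * bump_deriv t m i x)"
    using sum_bump_deriv[OF M i] by (simp add: left_diff_distrib sum_subtractf flip: sum_distrib_left)
  also have "\<dots> = (\<Sum>m\<in>?A. (c m - c0) * bump_deriv t m i x)"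
    by (rule sum.mono_neutral_right) (auto simp: bump_deriv_inactive i)
  also have "\<bar>\<dots>\<bar> \<le> (\<Sum>m\<in>?A. e * (2 / t))"
  proof (rule order_trans[OF sum_abs sum_mono])
    fix k assume "k \<in> ?A"
    then show "\<bar>(c k - c0) * bump_deriv t k i x\<bar> \<le> e * (2 / t)"
      unfolding abs_mult using m(2) by (intro mult_mono le bump_deriv_bound t) auto
  qed
  also have "\<dots> \<le> 2 ^ DIM('a) * (e * (2 / t))"
    using card_active[of M t x] t m(2) by (simp add: mult_right_mono divide_right_mono)
  finally show ?thesis using m by (auto simp: mult_ac)
qed

section \<open>Weak derivatives of C^1 functions\<close>

text \<open>By translation invariance f (x + z) - f x integrates to 0. By the segment formula its
  integral is also the t-average of shifted integrals of the z-derivative, all of which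
  coincide.\<close>

lemma integral_partial_compact_support:
  fixes f :: "'a::euclidean_space \<Rightarrow> real"
  assumes f: "\<And>x. (f has_derivative f' x) (at x)" and c: "continuous_on UNIV (\<lambda>x. f' x z)"
    and C: "compact C" "\<And>x. x \<notin> C \<Longrightarrow> f x = 0" "\<And>x. x \<notin> C \<Longrightarrow> f' x z = 0"
  shows "(\<integral>x. f' x z \<partial>lborel) = 0"
proof -
  have int: "integrable lborel g" if "continuous_on UNIV g" "\<And>x. x \<notin> C \<Longrightarrow> g x = 0" for g :: "'a \<Rightarrow> real"
  proof -
    have "integrable lborel (\<lambda>x. indicator C x *\<^sub>R g x)"
      using that(1) by (intro borel_integrable_compact C(1)) (auto intro: continuous_on_subset)
    moreover have "(\<lambda>x. indicator C x *\<^sub>R g x) = g" using that(2) by (auto simp: indicator_def fun_eq_iff)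
    ultimately show ?thesis by simp
  qed
  have intf: "integrable lborel f"
    using has_derivative_continuous[OF f] by (intro int C(2)) (simp add: continuous_on_eq_continuous_at)
  have intD: "integrable lborel (\<lambda>x. f' x z)" by (intro int c C(3))
  have FTC: "(\<integral>t. indicator {0..1::real} t * f' (x + t *\<^sub>R z) z \<partial>lborel) = f (x + z) - f x" for x
  proof -
    have "((\<lambda>t. f (x + t *\<^sub>R z)) has_vector_derivative f' (x + t *\<^sub>R z) z) (at t within {0..1})" for t :: real
    proof -
      have lin: "linear (f' (x + t *\<^sub>R z))"
        using f by (simp add: has_derivative_def bounded_linear.linear)
      have "((\<lambda>t. f (x + t *\<^sub>R z)) has_derivative (\<lambda>h. f' (x + t *\<^sub>R z) (h *\<^sub>R z))) (at t within {0..1})"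
        by (rule has_derivative_compose[OF _ f]) (auto intro!: derivative_eq_intros)
      then show ?thesis
        by (simp add: has_vector_derivative_def linear_cmul[OF lin])
    qed
    moreover have "continuous_on {0..1} (\<lambda>t. f' (x + t *\<^sub>R z) z)"
      by (intro continuous_on_compose2[OF c] continuous_intros) auto
    ultimately have "(\<integral>t. indicator {0..1::real} t *\<^sub>R f' (x + t *\<^sub>R z) z \<partial>lborel) = f (x + 1 *\<^sub>R z) - f (x + 0 *\<^sub>R z)"
      by (intro integral_FTC_Icc) auto
    then show ?thesis by simp
  qed
  have "(\<integral>x. f (x + z) - f x \<partial>lborel) = (\<integral>t. indicator {0..1::real} t * (\<integral>x. f' x z \<partial>lborel) \<partial>lborel)"
    using integral_translate_swap(2)[OF intD, of "\<lambda>x. 1" 1, where z = z] by (simp add: FTC)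
  moreover have "(\<integral>x. f (x + z) - f x \<partial>lborel) = 0"
    using intf integrable_lborel_translate[OF intf] by (simp add: integral_lborel_translate)
  ultimately show ?thesis by simp
qed

text \<open>Integration by parts: the product of h and \<phi> is C^1 with compact support, so its
  partial derivative has integral zero.\<close>

lemma is_weak_partial_C1:
  fixes h :: "'a::euclidean_space \<Rightarrow> real"
  assumes \<Omega>: "open \<Omega>" and h: "\<And>x. (h has_derivative (\<lambda>v. \<Sum>i\<in>Basis. (v \<bullet> i) * dh i x)) (at x)"
    and dh: "\<And>i. i \<in> Basis \<Longrightarrow> continuous_on UNIV (dh i)" and i: "i \<in> Basis"
  shows "is_weak_partial \<Omega> i h (dh i)"
proof -
  have hc: "continuous_on UNIV h"
    using has_derivative_continuous[OF h] by (simp add: continuous_on_eq_continuous_at)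
  have loc: "locally_integrable \<Omega> g" if "continuous_on UNIV g" for g :: "'a \<Rightarrow> real"
    unfolding locally_integrable_def
  proof (intro allI impI)
    fix C assume C: "compact C \<and> C \<subseteq> \<Omega>"
    then have Cb: "C \<in> sets lborel" by (simp add: compact_imp_closed)
    have "integrable lborel (\<lambda>x. indicator C x *\<^sub>R g x)"
      using that C by (intro borel_integrable_compact) (auto intro: continuous_on_subset)
    then show "integrable (lebesgue_on C) g"
      using Cb by (simp add: integrable_lebesgue_on_iff integrable_completion)
  qed
  have hb: "h \<in> borel_measurable borel" "dh i \<in> borel_measurable borel"
    using hc dh[OF i] by (auto intro: borel_measurable_continuous_onI)
  show ?thesis
    unfolding is_weak_partial_def
  proof (intro conjI allI impI loc hc dh i)
    fix \<phi> assume \<phi>: "test_function \<Omega> \<phi>"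
    note \<phi>D = test_functionD[OF \<phi>]
    let ?K = "closure {x. \<phi> x \<noteq> 0}"
    let ?D = "\<lambda>x. frechet_derivative \<phi> (at x) i"
    have 0: "\<phi> x = 0" "?D x = 0" if "x \<notin> ?K" for x
      using that closure_subset[of "{x. \<phi> x \<noteq> 0}"] by (blast, intro frechet_derivative_zero_outside)
    have Dc: "continuous_on UNIV ?D" by (rule Ck_continuous_partial[OF \<phi>D(1)])
    have int: "integrable lborel g" if "continuous_on UNIV g" "\<And>x. x \<notin> ?K \<Longrightarrow> g x = 0" for g :: "'a \<Rightarrow> real"
    proof -
      have "integrable lborel (\<lambda>x. indicator ?K x *\<^sub>R g x)"
        using that(1) by (intro borel_integrable_compact \<phi>D(5)) (auto intro: continuous_on_subset)
      moreover have "(\<lambda>x. indicator ?K x *\<^sub>R g x) = g" using that(2) by (auto simp: indicator_def fun_eq_iff)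
      ultimately show ?thesis by simp
    qed
    have i1: "integrable lborel (\<lambda>x. h x * ?D x)"
    proof (rule int[OF continuous_on_mult[OF hc Dc]])
      show "h x * ?D x = 0" if "x \<notin> ?K" for x using 0(2)[OF that] by simp
    qed
    have i2: "integrable lborel (\<lambda>x. dh i x * \<phi> x)"
    proof (rule int[OF continuous_on_mult[OF dh[OF i] \<phi>D(2)]])
      show "dh i x * \<phi> x = 0" if "x \<notin> ?K" for x using 0(1)[OF that] by simp
    qed
    let ?f' = "\<lambda>x v. h x * frechet_derivative \<phi> (at x) v + (\<Sum>i\<in>Basis. (v \<bullet> i) * dh i x) * \<phi> x"
    have ev: "(\<Sum>j\<in>Basis. (i \<bullet> j) * dh j x) = dh i x" for x
    proof -
      have "(\<Sum>j\<in>Basis. (i \<bullet> j) * dh j x) = (\<Sum>j\<in>Basis. if j = i then dh j x else 0)"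
        using i by (intro sum.cong) (auto simp: inner_Basis)
      then show ?thesis using i by simp
    qed
    have "(\<integral>x. ?f' x i \<partial>lborel) = 0"
    proof (rule integral_partial_compact_support[where f = "\<lambda>x. h x * \<phi> x" and C = ?K])
      show "((\<lambda>x. h x * \<phi> x) has_derivative ?f' x) (at x)" for x
        by (rule has_derivative_mult[OF h Ck_Suc_has_derivative[OF \<phi>D(1)]])
      show "continuous_on UNIV (\<lambda>x. ?f' x i)"
        unfolding ev by (intro continuous_on_add continuous_on_mult hc Dc dh i \<phi>D(2))
      show "compact ?K" by (rule \<phi>D(5))
      show "h x * \<phi> x = 0" "?f' x i = 0" if "x \<notin> ?K" for x
        using 0[OF that] by simp_all
    qed
    then have "(\<integral>x. h x * ?D x \<partial>lborel) = - (\<integral>x. dh i x * \<phi> x \<partial>lborel)"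
      unfolding ev using i1 i2 by simp
    moreover have "(\<integral>x. h x * ?D x \<partial>lebesgue_on \<Omega>) = (\<integral>x. h x * ?D x \<partial>lborel)"
      by (rule integral_test_lborel[OF \<Omega> hb(1) borel_measurable_continuous_onI[OF Dc] 0(2)]) (use \<phi>D(6) in blast)
    moreover have "(\<integral>x. dh i x * \<phi> x \<partial>lebesgue_on \<Omega>) = (\<integral>x. dh i x * \<phi> x \<partial>lborel)"
      by (rule integral_test_lborel[OF \<Omega> hb(2) \<phi>D(3) \<phi>D(4)])
    ultimately show "(\<integral>x. h x * ?D x \<partial>lebesgue_on \<Omega>) = - (\<integral>x. dh i x * \<phi> x \<partial>lebesgue_on \<Omega>)"
      by simp
  qed
qed

lemma continuous_in_Lp:
  fixes h :: "'a::euclidean_space \<Rightarrow> real"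
  assumes \<Omega>: "open \<Omega>" "bounded \<Omega>" and h: "continuous_on UNIV h" and p: "0 \<le> p"
  shows "h \<in> Lp_space p \<Omega>"
proof -
  have hb: "h \<in> borel_measurable borel" using h by (rule borel_measurable_continuous_onI)
  have "bounded (h ` closure \<Omega>)"
    using h \<Omega>(2) by (intro compact_imp_bounded compact_continuous_image) (auto intro: continuous_on_subset simp: compact_closure)
  then obtain B where B: "\<And>x. x \<in> closure \<Omega> \<Longrightarrow> \<bar>h x\<bar> \<le> B" by (auto simp: bounded_iff)
  have "Lp_power p \<Omega> h \<le> (\<integral>\<^sup>+x. ennreal (B powr p) * indicator \<Omega> x \<partial>lborel)"
    unfolding Lp_power_def using B closure_subset[of \<Omega>] p
    by (intro nn_integral_mono) (auto simp: indicator_def intro!: ennreal_leI powr_mono2)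
  also have "\<dots> = ennreal (B powr p) * emeasure lborel \<Omega>"
    using \<Omega>(1) by (intro nn_integral_cmult_indicator) auto
  also have "\<dots> < \<infinity>"
    using emeasure_bounded_finite[OF \<Omega>(2)] by (auto simp: ennreal_mult_less_top)
  finally have "Lp_power p \<Omega> h < \<infinity>" .
  moreover have "h \<in> borel_measurable (lebesgue_on \<Omega>)"
    using hb by (intro measurable_restrict_space1 measurable_completion) simp
  ultimately show ?thesis using \<Omega>(1) by (simp add: Lp_space_iff)
qed

text \<open>By uniqueness the derivative picked by \<open>weak_partial\<close> agrees almost
  everywhere with the classical one, so the norm can be computed from \<open>dh\<close>.\<close>

lemma C1_in_W1p:
  fixes h :: "'a::euclidean_space \<Rightarrow> real"
  assumes \<Omega>: "open \<Omega>" "bounded \<Omega>" and p: "0 < p"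
    and h: "\<And>x. (h has_derivative (\<lambda>v. \<Sum>i\<in>Basis. (v \<bullet> i) * dh i x)) (at x)"
    and dh: "\<And>i. i \<in> Basis \<Longrightarrow> continuous_on UNIV (dh i)"
  shows "h \<in> W1p_space p \<Omega>"
    and "ennreal (W1p_norm p \<Omega> h powr p) = Lp_power p \<Omega> h + (\<Sum>i\<in>Basis. Lp_power p \<Omega> (dh i))"
proof -
  have hc: "continuous_on UNIV h"
    using has_derivative_continuous[OF h] by (simp add: continuous_on_eq_continuous_at)
  have L: "dh i \<in> Lp_space p \<Omega>" "is_weak_partial \<Omega> i h (dh i)" if "i \<in> Basis" for i
    using that p by (auto intro!: continuous_in_Lp[OF \<Omega> dh] is_weak_partial_C1[OF \<Omega>(1) h dh])
  show W: "h \<in> W1p_space p \<Omega>"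
    unfolding W1p_space_def using continuous_in_Lp[OF \<Omega> hc] p L by auto
  show "ennreal (W1p_norm p \<Omega> h powr p) = Lp_power p \<Omega> h + (\<Sum>i\<in>Basis. Lp_power p \<Omega> (dh i))"
    unfolding W1p_norm_powr[OF \<Omega>(1) p W] using weak_partial_in_Lp(3)[OF \<Omega>(1) L] by simp
qed

section \<open>Averages over balls\<close>

text \<open>The inner integral of the restricted seminorm, cut off at separation r and without its
  kernel, which is recovered later by summing over dyadic r.\<close>

definition local_osc :: "real \<Rightarrow> 'a::euclidean_space set \<Rightarrow> ('a \<Rightarrow> real) \<Rightarrow> real \<Rightarrow> 'a \<Rightarrow> ennreal" where
  "local_osc p \<Omega> F r y = (\<integral>\<^sup>+y'. indicator {y'. norm (y - y') < r \<and> norm (y - y') < bdist \<Omega> y / 2} y' *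
     ennreal (\<bar>F y - F y'\<bar> powr p) \<partial>lborel)"

text \<open>Gathers the oscillation over a neighbourhood of x, later taken large enough to contain
  the chains of balls used at x.\<close>

definition local_energy :: "real \<Rightarrow> 'a::euclidean_space set \<Rightarrow> ('a \<Rightarrow> real) \<Rightarrow> real \<Rightarrow> real \<Rightarrow> 'a \<Rightarrow> ennreal" where
  "local_energy p \<Omega> F \<rho> r x = (\<integral>\<^sup>+y. indicator {y \<in> \<Omega>. dist x y < \<rho>} y * local_osc p \<Omega> F r y \<partial>lborel)"

definition ball_vol :: "'a::euclidean_space itself \<Rightarrow> real \<Rightarrow> real" where
  "ball_vol _ r = unit_ball_vol (real DIM('a)) * r ^ DIM('a)"

definition ball_avg :: "('a::euclidean_space \<Rightarrow> real) \<Rightarrow> 'a \<Rightarrow> real \<Rightarrow> real" where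
  "ball_avg F w r = (\<integral>y. indicator (ball w r) y * F y \<partial>lborel) / ball_vol TYPE('a) r"

lemma emeasure_ball_vol: "0 \<le> r \<Longrightarrow> emeasure lborel (ball (w::'a::euclidean_space) r) = ennreal (ball_vol TYPE('a) r)"
  by (simp add: emeasure_ball ball_vol_def)

lemma ball_vol_pos: "0 < r \<Longrightarrow> 0 < ball_vol TYPE('a::euclidean_space) r"
  by (simp add: ball_vol_def)

lemma ball_vol_mono: "0 \<le> r \<Longrightarrow> r \<le> r' \<Longrightarrow> ball_vol TYPE('a::euclidean_space) r \<le> ball_vol TYPE('a) r'"
  by (auto simp: ball_vol_def intro!: mult_left_mono power_mono)

lemma ball_vol_mult: "ball_vol TYPE('a::euclidean_space) (c * t) = ball_vol TYPE('a) c * t ^ DIM('a)"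
  by (simp add: ball_vol_def power_mult_distrib)

lemma borel_measurable_local_osc [measurable]:
  assumes [measurable]: "F \<in> borel_measurable borel"
  shows "local_osc p \<Omega> F r \<in> borel_measurable borel"
  unfolding local_osc_def[abs_def] by measurable

lemma ball_avg_deviation:
  fixes F :: "'a::euclidean_space \<Rightarrow> real"
  assumes F: "integrable lborel F" and r: "0 < r" and p: "1 \<le> p"
  shows "ennreal (ball_vol TYPE('a) r) * ennreal (\<bar>ball_avg F w r - c\<bar> powr p)
    \<le> (\<integral>\<^sup>+y. indicator (ball w r) y * ennreal (\<bar>F y - c\<bar> powr p) \<partial>lborel)"
proof -
  let ?M = "restrict_space lborel (ball w r)" and ?V = "ball_vol TYPE('a) r"
  have V: "0 < ?V" using r by (rule ball_vol_pos)
  have em: "emeasure ?M (space ?M) = ennreal ?V"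
    using r by (simp add: emeasure_restrict_space emeasure_ball_vol)
  interpret finite_measure ?M by standard (subst em, simp)
  have iF: "integrable ?M F"
    using integrable_mult_indicator[of "ball w r" lborel F] F by (simp add: integrable_restrict_space)
  have mV: "measure ?M (space ?M) = ?V" using em V by (simp add: measure_def)
  have avg: "(\<integral>y. F y - c \<partial>?M) / ?V = ball_avg F w r - c"
    using iF V mV by (simp add: ball_avg_def integral_restrict_space diff_divide_distrib)
  have "ennreal (?V * \<bar>(\<integral>y. F y - c \<partial>?M) / ?V\<bar> powr p) \<le> (\<integral>\<^sup>+y. ennreal (\<bar>F y - c\<bar> powr p) \<partial>?M)"
    by (rule powr_average_le[OF em V p]) (use iF in auto)
  then show ?thesis
    using V unfolding avg by (simp add: nn_integral_restrict_space mult.commute ennreal_mult'[symmetric])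
qed

text \<open>Jensen's inequality twice: over the first ball with the second average as the constant,
  then over the second ball with constant F y.\<close>

lemma ball_avg_diff:
  fixes F :: "'a::euclidean_space \<Rightarrow> real"
  assumes F: "integrable lborel F" and r: "0 < r" "0 < r'" and p: "1 \<le> p"
  shows "ennreal (ball_vol TYPE('a) r * ball_vol TYPE('a) r') * ennreal (\<bar>ball_avg F w r - ball_avg F w' r'\<bar> powr p)
    \<le> (\<integral>\<^sup>+y. indicator (ball w r) y * (\<integral>\<^sup>+y'. indicator (ball w' r') y' * ennreal (\<bar>F y - F y'\<bar> powr p) \<partial>lborel) \<partial>lborel)"
proof -
  let ?V = "ball_vol TYPE('a) r" and ?V' = "ball_vol TYPE('a) r'"
  have [measurable]: "F \<in> borel_measurable borel" using F by auto
  have V: "0 < ?V" "0 < ?V'" using r by (simp_all add: ball_vol_pos)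
  have m: "(\<lambda>y. indicator (ball w r) y * ennreal (\<bar>F y - c\<bar> powr p)) \<in> borel_measurable lborel" for c
  proof (rule borel_measurable_times_ennreal)
    show "(\<lambda>y. ennreal (\<bar>F y - c\<bar> powr p)) \<in> borel_measurable lborel" by measurable
  qed (rule borel_measurable_indicator, simp)
  have "ennreal (?V * ?V') * ennreal (\<bar>ball_avg F w r - ball_avg F w' r'\<bar> powr p)
    = ennreal ?V' * (ennreal ?V * ennreal (\<bar>ball_avg F w r - ball_avg F w' r'\<bar> powr p))"
    using V by (simp add: ennreal_mult'' mult_ac)
  also have "\<dots> \<le> ennreal ?V' * (\<integral>\<^sup>+y. indicator (ball w r) y * ennreal (\<bar>F y - ball_avg F w' r'\<bar> powr p) \<partial>lborel)"
    by (intro mult_left_mono ball_avg_deviation F r p) simp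
  also have "\<dots> = (\<integral>\<^sup>+y. indicator (ball w r) y * (ennreal ?V' * ennreal (\<bar>ball_avg F w' r' - F y\<bar> powr p)) \<partial>lborel)"
    by (subst nn_integral_cmult[OF m, symmetric]) (simp add: mult_ac abs_minus_commute)
  also have "\<dots> \<le> (\<integral>\<^sup>+y. indicator (ball w r) y * (\<integral>\<^sup>+y'. indicator (ball w' r') y' * ennreal (\<bar>F y' - F y\<bar> powr p) \<partial>lborel) \<partial>lborel)"
    by (intro nn_integral_mono mult_left_mono ball_avg_deviation F r p) simp
  finally show ?thesis by (simp add: abs_minus_commute)
qed

lemma ball_avg_step:
  fixes F :: "'a::euclidean_space \<Rightarrow> real"
  assumes F: "integrable lborel F" and p: "1 \<le> p" and d: "0 < d"
    and w: "w \<in> \<Omega>" "8 * d \<le> bdist \<Omega> w" "dist w w' \<le> d" "dist x w \<le> R"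
    and r: "d / 2 \<le> r" "r \<le> d" "d / 2 \<le> r'" "r' \<le> d"
  shows "ennreal (\<bar>ball_avg F w r - ball_avg F w' r'\<bar> powr p)
    \<le> ennreal (1 / (ball_vol TYPE('a) (d / 2))\<^sup>2) * local_energy p \<Omega> F (R + d) (3 * d) x"
proof -
  let ?V = "ball_vol TYPE('a) (d / 2)" and ?A = "\<bar>ball_avg F w r - ball_avg F w' r'\<bar> powr p"
  have r0: "0 < r" "0 < r'" using r d by auto
  have V: "0 < ?V" using d by (simp add: ball_vol_pos)
  have "ennreal (?V\<^sup>2) * ennreal ?A \<le> ennreal (ball_vol TYPE('a) r * ball_vol TYPE('a) r') * ennreal ?A"
    using r d V unfolding power2_eq_square
    by (intro mult_right_mono ennreal_leI mult_mono ball_vol_mono) (auto intro: less_imp_le ball_vol_pos r0)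
  also have "\<dots> \<le> (\<integral>\<^sup>+y. indicator (ball w r) y * (\<integral>\<^sup>+y'. indicator (ball w' r') y' * ennreal (\<bar>F y - F y'\<bar> powr p) \<partial>lborel) \<partial>lborel)"
    by (rule ball_avg_diff[OF F r0 p])
  also have "\<dots> \<le> local_energy p \<Omega> F (R + d) (3 * d) x"
    unfolding local_energy_def
  proof (rule nn_integral_mono)
    fix y
    show "indicator (ball w r) y * (\<integral>\<^sup>+y'. indicator (ball w' r') y' * ennreal (\<bar>F y - F y'\<bar> powr p) \<partial>lborel)
      \<le> indicator {y \<in> \<Omega>. dist x y < R + d} y * local_osc p \<Omega> F (3 * d) y"
    proof (cases "y \<in> ball w r")
      case True
      then have y: "dist w y < d" using r by simp
      have "y \<in> ball w (bdist \<Omega> w)" using y w(2) d by simp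
      then have "y \<in> \<Omega>" using ball_bdist_subset[OF w(1)] by blast
      moreover have "dist x y < R + d" using dist_triangle[of x y w] y w(4) by linarith
      moreover have "(\<integral>\<^sup>+y'. indicator (ball w' r') y' * ennreal (\<bar>F y - F y'\<bar> powr p) \<partial>lborel) \<le> local_osc p \<Omega> F (3 * d) y"
        unfolding local_osc_def
      proof (rule nn_integral_mono)
        fix y'
        have "norm (y - y') < 3 * d \<and> norm (y - y') < bdist \<Omega> y / 2" if "y' \<in> ball w' r'"
        proof -
          have "dist w' y' < d" using that r by simp
          then have *: "dist y y' < 3 * d"
            using dist_triangle[of y y' w] dist_triangle[of w y' w'] y w(3) by (simp add: dist_commute)
          moreover have "7 * d < bdist \<Omega> y"
            using abs_bdist_diff_le[of \<Omega> w y] y w(2) by linarith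
          ultimately show ?thesis using d by (simp add: dist_norm)
        qed
        then show "indicator (ball w' r') y' * ennreal (\<bar>F y - F y'\<bar> powr p)
          \<le> indicator {y'. norm (y - y') < 3 * d \<and> norm (y - y') < bdist \<Omega> y / 2} y' * ennreal (\<bar>F y - F y'\<bar> powr p)"
          by (auto simp: indicator_def)
      qed
      ultimately show ?thesis using True by simp
    qed simp
  qed
  finally have *: "ennreal (?V\<^sup>2) * ennreal ?A \<le> local_energy p \<Omega> F (R + d) (3 * d) x" .
  have "ennreal ?A = ennreal (1 / ?V\<^sup>2) * (ennreal (?V\<^sup>2) * ennreal ?A)"
    using V by (simp add: mult.assoc[symmetric] ennreal_mult'[symmetric])
  also have "\<dots> \<le> ennreal (1 / ?V\<^sup>2) * local_energy p \<Omega> F (R + d) (3 * d) x"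
    by (intro mult_left_mono *) simp
  finally show ?thesis .
qed

text \<open>The value of \<delta> makes 8 \<delta> t equal to the boundary distance guaranteed along
  the chain, so \<open>ball_avg_step\<close> applies to each link. The telescoping sum has a fixed
  number of terms, whence C is independent of the scale.\<close>

lemma ball_avg_chain:
  fixes \<Omega> :: "'a::euclidean_space set"
  assumes U: "uniform_with a b \<Omega>" and \<kappa>: "0 < \<kappa>" and \<Lambda>: "0 < \<Lambda>" and p: "1 \<le> p" and \<delta>: "\<delta> = \<kappa> / (16 * b)"
  obtains C \<rho> where "0 \<le> C" "0 < \<rho>"
    "\<And>F x t P Q r r'. integrable lborel F \<Longrightarrow> 0 < t \<Longrightarrow> P \<in> \<Omega> \<Longrightarrow> Q \<in> \<Omega> \<Longrightarrow>
      dist x P \<le> \<Lambda> * t \<Longrightarrow> dist x Q \<le> \<Lambda> * t \<Longrightarrow> \<kappa> * t \<le> bdist \<Omega> P \<Longrightarrow> \<kappa> * t \<le> bdist \<Omega> Q \<Longrightarrow>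
      \<delta> * t / 2 \<le> r \<Longrightarrow> r \<le> \<delta> * t \<Longrightarrow> \<delta> * t / 2 \<le> r' \<Longrightarrow> r' \<le> \<delta> * t \<Longrightarrow>
      ennreal (\<bar>ball_avg F P r - ball_avg F Q r'\<bar> powr p)
        \<le> ennreal (C / (t ^ DIM('a))\<^sup>2) * local_energy p \<Omega> F (\<rho> * t) (3 * (\<delta> * t)) x"
proof -
  have ab: "1 \<le> a" "1 \<le> b" using U by (auto simp: uniform_with_def)
  have \<delta>0: "0 < \<delta>" using \<kappa> ab \<delta> by simp
  obtain N :: nat where N: "a * (2 * \<Lambda>) / \<delta> < real N" using reals_Archimedean2 by blast
  have N': "a * (2 * \<Lambda>) < real N * \<delta>" using N \<delta>0 by (simp add: pos_divide_less_eq)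
  have N0: "0 < N"
  proof (rule ccontr)
    assume "\<not> 0 < N"
    moreover have "0 < a * (2 * \<Lambda>)" using ab \<Lambda> by simp
    ultimately show False using N' by simp
  qed
  \<comment> \<open>P is within \<Lambda> t of x, chain points are within 2 a \<Lambda> t of P, and
    balls have radius at most \<delta> t.\<close>
  define \<rho> where "\<rho> = \<Lambda> + a * (2 * \<Lambda>) + \<delta>"
  define V where "V = ball_vol TYPE('a) (\<delta> / 2)"
  have V: "0 < V" unfolding V_def using \<delta>0 by (simp add: ball_vol_pos)
  define C where "C = real N powr p * real N / V\<^sup>2"
  show thesis
  proof (rule that)
    show "0 \<le> C" by (simp add: C_def)
    show "0 < \<rho>" using ab \<Lambda> \<delta>0 by (simp add: \<rho>_def add_pos_pos)
    fix F :: "'a \<Rightarrow> real" and x P Q t r r'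
    assume F: "integrable lborel F" and t: "0 < t" and PQ: "P \<in> \<Omega>" "Q \<in> \<Omega>"
      and dP: "dist x P \<le> \<Lambda> * t" and dQ: "dist x Q \<le> \<Lambda> * t"
      and bPQ: "\<kappa> * t \<le> bdist \<Omega> P" "\<kappa> * t \<le> bdist \<Omega> Q"
      and r: "\<delta> * t / 2 \<le> r" "r \<le> \<delta> * t" and r': "\<delta> * t / 2 \<le> r'" "r' \<le> \<delta> * t"
    have "dist P Q \<le> 2 * \<Lambda> * t"
      using dist_triangle[of P Q x] dP dQ by (simp add: dist_commute)
    from uniform_chain[OF U \<kappa> _ \<delta>0 N' t PQ this bPQ] \<Lambda> obtain w where
      w: "w 0 = P" "w N = Q" "\<And>i. w i \<in> \<Omega>" "\<And>i. \<kappa> / (2 * b) * t \<le> bdist \<Omega> (w i)"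
      "\<And>i. dist P (w i) \<le> a * (2 * \<Lambda>) * t" "\<And>i. dist (w i) (w (Suc i)) \<le> \<delta> * t"
      by auto
    \<comment> \<open>Every ball of the chain has radius r except the last; N > 0 keeps the last
      apart from the first.\<close>
    define R where "R i = (if i < N then r else r')" for i
    have R: "\<delta> * t / 2 \<le> R i" "R i \<le> \<delta> * t" for i using r r' by (auto simp: R_def)
    define A where "A i = ball_avg F (w i) (R i)" for i
    let ?E = "local_energy p \<Omega> F (\<rho> * t) (3 * (\<delta> * t)) x"
    have step: "ennreal (\<bar>A i - A (Suc i)\<bar> powr p) \<le> ennreal (1 / (V * t ^ DIM('a))\<^sup>2) * ?E" for i
    proof -
      have "8 * (\<delta> * t) = \<kappa> / (2 * b) * t" using ab by (simp add: \<delta>)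
      then have 8: "8 * (\<delta> * t) \<le> bdist \<Omega> (w i)" using w(4) by simp
      have "dist x (w i) \<le> \<Lambda> * t + a * (2 * \<Lambda>) * t"
        using dist_triangle[of x "w i" P] dP w(5)[of i] by linarith
      from ball_avg_step[OF F p mult_pos_pos[OF \<delta>0 t] w(3) 8 w(6) this R R]
      show ?thesis
        unfolding A_def V_def ball_vol_mult[symmetric] \<rho>_def by (simp add: algebra_simps)
    qed
    have "\<bar>A 0 - A N\<bar> \<le> (\<Sum>i<N. \<bar>A i - A (Suc i)\<bar>)"
      using sum_abs[of "\<lambda>i. A i - A (Suc i)" "{..<N}"] by (simp add: sum_lessThan_telescope')
    then have "\<bar>A 0 - A N\<bar> powr p \<le> (\<Sum>i<N. \<bar>A i - A (Suc i)\<bar>) powr p"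
      using p by (intro powr_mono2) auto
    also have "\<dots> \<le> real N powr p * (\<Sum>i<N. \<bar>A i - A (Suc i)\<bar> powr p)"
      using sum_powr_le[of "{..<N}" "\<lambda>i. \<bar>A i - A (Suc i)\<bar>" p] p by simp
    finally have "ennreal (\<bar>A 0 - A N\<bar> powr p) \<le> ennreal (real N powr p) * (\<Sum>i<N. ennreal (\<bar>A i - A (Suc i)\<bar> powr p))"
      by (simp add: ennreal_mult[symmetric] sum_nonneg ennreal_leI)
    also have "\<dots> \<le> ennreal (real N powr p) * (\<Sum>i<N. ennreal (1 / (V * t ^ DIM('a))\<^sup>2) * ?E)"
      by (intro mult_left_mono sum_mono step) simp
    also have "\<dots> = ennreal (C / (t ^ DIM('a))\<^sup>2) * ?E"
    proof -
      have "(\<Sum>i<N. ennreal (1 / (V * t ^ DIM('a))\<^sup>2) * ?E) = ennreal (real N) * (ennreal (1 / (V * t ^ DIM('a))\<^sup>2) * ?E)"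
        by (simp add: ennreal_of_nat_eq_real_of_nat)
      moreover have "ennreal (real N powr p) * (ennreal (real N) * (ennreal (1 / (V * t ^ DIM('a))\<^sup>2) * ?E))
        = ennreal (real N powr p * real N * (1 / (V * t ^ DIM('a))\<^sup>2)) * ?E"
        by (subst ennreal_mult, simp, simp, subst ennreal_mult, simp, simp, simp only: mult.assoc)
      ultimately show ?thesis
        by (simp add: C_def power_mult_distrib)
    qed
    finally show "ennreal (\<bar>ball_avg F P r - ball_avg F Q r'\<bar> powr p) \<le> ennreal (C / (t ^ DIM('a))\<^sup>2) * ?E"
      using N0 w(1,2) by (simp add: A_def R_def)
  qed
qed

text \<open>By Tonelli's theorem each y is counted once for every x in the ball of radius \<rho>
  around it.\<close>

lemma nn_integral_local_energy:
  fixes F :: "'a::euclidean_space \<Rightarrow> real"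
  assumes \<Omega>: "open \<Omega>" and [measurable]: "F \<in> borel_measurable borel" and \<rho>: "0 \<le> \<rho>"
  shows "(\<integral>\<^sup>+x. local_energy p \<Omega> F \<rho> r x \<partial>lborel) = ennreal (ball_vol TYPE('a) \<rho>) * (\<integral>\<^sup>+y. indicator \<Omega> y * local_osc p \<Omega> F r y \<partial>lborel)"
proof -
  have [measurable]: "\<Omega> \<in> sets borel" using \<Omega> by auto
  have "(\<integral>\<^sup>+x. local_energy p \<Omega> F \<rho> r x \<partial>lborel)
    = (\<integral>\<^sup>+y. (\<integral>\<^sup>+x. indicator {y \<in> \<Omega>. dist x y < \<rho>} y * local_osc p \<Omega> F r y \<partial>lborel) \<partial>lborel)"
    unfolding local_energy_def by (rule lborel_pair.Fubini'[symmetric]) measurable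
  also have "\<dots> = (\<integral>\<^sup>+y. ennreal (ball_vol TYPE('a) \<rho>) * (indicator \<Omega> y * local_osc p \<Omega> F r y) \<partial>lborel)"
  proof (rule nn_integral_cong)
    fix y :: 'a
    have "(\<integral>\<^sup>+x. indicator {y \<in> \<Omega>. dist x y < \<rho>} y * local_osc p \<Omega> F r y \<partial>lborel)
      = (\<integral>\<^sup>+x. (indicator \<Omega> y * local_osc p \<Omega> F r y) * indicator (ball y \<rho>) x \<partial>lborel)"
      by (rule nn_integral_cong) (auto simp: indicator_def dist_commute)
    also have "\<dots> = (indicator \<Omega> y * local_osc p \<Omega> F r y) * emeasure lborel (ball y \<rho>)"
      by (rule nn_integral_cmult_indicator) simp
    finally show "(\<integral>\<^sup>+x. indicator {y \<in> \<Omega>. dist x y < \<rho>} y * local_osc p \<Omega> F r y \<partial>lborel)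
      = ennreal (ball_vol TYPE('a) \<rho>) * (indicator \<Omega> y * local_osc p \<Omega> F r y)"
      using \<rho> by (simp add: emeasure_ball_vol mult.commute)
  qed
  also have "\<dots> = ennreal (ball_vol TYPE('a) \<rho>) * (\<integral>\<^sup>+y. indicator \<Omega> y * local_osc p \<Omega> F r y \<partial>lborel)"
    by (rule nn_integral_cmult) measurable
  finally show ?thesis .
qed

text \<open>The weights grow geometrically with k, so the sum is controlled by its last term, whose
  scale still exceeds \<rho> / c. A last term exists because the scales tend to 0.\<close>

lemma dyadic_tail_sum:
  fixes \<beta> T c \<rho> :: real
  assumes \<beta>: "0 < \<beta>" and T: "0 < T" and c: "0 < c" and \<rho>: "0 < \<rho>"
  shows "(\<Sum>k. indicator {k. \<rho> < c * (T / 2 ^ k)} k * ennreal ((T / 2 ^ k) powr (- \<beta>)))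
    \<le> ennreal (c powr \<beta> * (2 powr \<beta> / (2 powr \<beta> - 1)) * \<rho> powr (- \<beta>))"
proof -
  let ?A = "{k::nat. \<rho> < c * (T / 2 ^ k)}"
  define x where "x = (2::real) powr \<beta>"
  have x: "1 < x" unfolding x_def using \<beta> by simp
  have pw: "(T / 2 ^ k) powr (- \<beta>) = T powr (- \<beta>) * x ^ k" for k :: nat
  proof -
    have "(2 ^ k) powr \<beta> = (2 powr \<beta>) ^ k" by (induction k) (simp_all add: powr_mult)
    then show ?thesis using T by (simp add: x_def powr_divide powr_minus_divide)
  qed
  show ?thesis
  proof (cases "?A = {}")
    case True
    then have "(\<lambda>k. indicator ?A k * ennreal ((T / 2 ^ k) powr (- \<beta>))) = (\<lambda>k. 0)" by (auto simp: fun_eq_iff)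
    then show ?thesis by simp
  next
    case False
    have "(\<lambda>k. c * T / 2 ^ k) \<longlonglongrightarrow> 0" by (rule LIMSEQ_divide_realpow_zero) simp
    then have "eventually (\<lambda>k. c * T / 2 ^ k < \<rho>) sequentially" using \<rho> by (rule order_tendstoD(2))
    then obtain n where n: "\<And>k. n \<le> k \<Longrightarrow> c * T / 2 ^ k < \<rho>" by (auto simp: eventually_sequentially)
    have fin: "finite ?A"
    proof (rule finite_subset[of _ "{..<n}"])
      show "?A \<subseteq> {..<n}" using n by (force simp: not_less[symmetric])
    qed simp
    define K where "K = Max ?A"
    have K: "K \<in> ?A" unfolding K_def using fin False by (rule Max_in)
    have sub: "?A \<subseteq> {..K}" using fin by (auto simp: K_def)
    have "(\<Sum>k. indicator ?A k * ennreal ((T / 2 ^ k) powr (- \<beta>))) = (\<Sum>k\<le>K. indicator ?A k * ennreal ((T / 2 ^ k) powr (- \<beta>)))"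
      by (rule suminf_finite) (use sub in \<open>auto simp: indicator_def\<close>)
    also have "\<dots> \<le> (\<Sum>k\<le>K. ennreal ((T / 2 ^ k) powr (- \<beta>)))"
      by (rule sum_mono) (auto simp: indicator_def)
    also have "\<dots> = ennreal (\<Sum>k\<le>K. T powr (- \<beta>) * x ^ k)"
      unfolding pw using x by (intro sum_ennreal) auto
    also have "\<dots> \<le> ennreal (T powr (- \<beta>) * (x ^ K * (x / (x - 1))))"
    proof (rule ennreal_leI)
      have "(\<Sum>k\<le>K. x ^ k) = (x ^ Suc K - 1) / (x - 1)"
        using x geometric_sum[of x "Suc K"] by (simp add: lessThan_Suc_atMost)
      also have "\<dots> \<le> x ^ Suc K / (x - 1)"
        using x by (intro divide_right_mono) auto
      finally have "(\<Sum>k\<le>K. x ^ k) \<le> x ^ K * (x / (x - 1))" by (simp add: mult.commute)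
      then show "(\<Sum>k\<le>K. T powr (- \<beta>) * x ^ k) \<le> T powr (- \<beta>) * (x ^ K * (x / (x - 1)))"
        unfolding sum_distrib_left[symmetric] by (rule mult_left_mono) simp
    qed
    also have "T powr (- \<beta>) * (x ^ K * (x / (x - 1))) = (T / 2 ^ K) powr (- \<beta>) * (x / (x - 1))"
      by (simp add: pw)
    also have "ennreal \<dots> \<le> ennreal ((\<rho> / c) powr (- \<beta>) * (x / (x - 1)))"
    proof (intro ennreal_leI mult_right_mono powr_mono2')
      show "\<rho> / c \<le> T / 2 ^ K" using K c by (simp add: divide_le_eq mult.commute)
    qed (use \<beta> \<rho> c x in auto)
    also have "(\<rho> / c) powr (- \<beta>) * (x / (x - 1)) = c powr \<beta> * (2 powr \<beta> / (2 powr \<beta> - 1)) * \<rho> powr (- \<beta>)"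
      using \<rho> c by (simp add: x_def powr_divide powr_minus_divide)
    finally show ?thesis .
  qed
qed

text \<open>A fixed pair is seen by the scales with |y - y'| < c t_k, and the weights of these add
  up to at most a multiple of the kernel of the restricted seminorm.\<close>

lemma sum_local_osc_le_energy:
  fixes F :: "'a::euclidean_space \<Rightarrow> real"
  assumes \<Omega>: "open \<Omega>" and [measurable]: "F \<in> borel_measurable borel" and p: "1 \<le> p" and s: "0 < s" and T: "0 < T" and c: "0 < c"
  shows "\<exists>C. (\<Sum>k. ennreal ((T / 2 ^ k) powr (- (real DIM('a) + s * p))) *
      (\<integral>\<^sup>+y. indicator \<Omega> y * local_osc p \<Omega> F (c * (T / 2 ^ k)) y \<partial>lborel)) \<le> ennreal C * restricted_energy s p \<Omega> F"
proof -
  have [measurable]: "\<Omega> \<in> sets borel" using \<Omega> by auto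
  let ?\<beta> = "real DIM('a) + s * p" and ?t = "\<lambda>k::nat. T / 2 ^ k"
  have \<beta>: "0 < ?\<beta>" using s p by (simp add: add_pos_pos)
  define C where "C = c powr ?\<beta> * (2 powr ?\<beta> / (2 powr ?\<beta> - 1))"
  have C: "0 \<le> C" unfolding C_def using ge_one_powr_ge_zero[of 2 ?\<beta>] \<beta> by (intro mult_nonneg_nonneg divide_nonneg_nonneg) auto
  let ?S = "\<lambda>k y. {y'. norm (y - y') < c * ?t k \<and> norm (y - y') < bdist \<Omega> y / 2}"
  have pt: "(\<Sum>k. ennreal (?t k powr (- ?\<beta>)) * local_osc p \<Omega> F (c * ?t k) y)
     \<le> ennreal C * (\<integral>\<^sup>+y'. indicator {y'. norm (y - y') < bdist \<Omega> y / 2} y' * ennreal (\<bar>F y - F y'\<bar> powr p / norm (y - y') powr ?\<beta>) \<partial>lborel)" for y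
  proof -
    have "(\<Sum>k. ennreal (?t k powr (- ?\<beta>)) * local_osc p \<Omega> F (c * ?t k) y)
      = (\<Sum>k. \<integral>\<^sup>+y'. ennreal (?t k powr (- ?\<beta>)) * (indicator (?S k y) y' * ennreal (\<bar>F y - F y'\<bar> powr p)) \<partial>lborel)"
      unfolding local_osc_def by (subst nn_integral_cmult) measurable
    also have "\<dots> = (\<integral>\<^sup>+y'. (\<Sum>k. ennreal (?t k powr (- ?\<beta>)) * (indicator (?S k y) y' * ennreal (\<bar>F y - F y'\<bar> powr p))) \<partial>lborel)"
      by (rule nn_integral_suminf[symmetric]) measurable
    also have "\<dots> \<le> (\<integral>\<^sup>+y'. ennreal C * (indicator {y'. norm (y - y') < bdist \<Omega> y / 2} y' * ennreal (\<bar>F y - F y'\<bar> powr p / norm (y - y') powr ?\<beta>)) \<partial>lborel)"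
    proof (rule nn_integral_mono)
      fix y' :: 'a
      show "(\<Sum>k. ennreal (?t k powr (- ?\<beta>)) * (indicator (?S k y) y' * ennreal (\<bar>F y - F y'\<bar> powr p)))
        \<le> ennreal C * (indicator {y'. norm (y - y') < bdist \<Omega> y / 2} y' * ennreal (\<bar>F y - F y'\<bar> powr p / norm (y - y') powr ?\<beta>))"
      \<comment> \<open>\<open>dyadic_tail_sum\<close> requires positive separation; on the diagonal
        the difference of values is 0, and outside the half-distance ball both sides are 0.\<close>
      proof (cases "y = y' \<or> \<not> norm (y - y') < bdist \<Omega> y / 2")
        case True
        then have "(\<lambda>k. ennreal (?t k powr (- ?\<beta>)) * (indicator (?S k y) y' * ennreal (\<bar>F y - F y'\<bar> powr p))) = (\<lambda>k. 0)"
          by (auto simp: fun_eq_iff indicator_def)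
        then show ?thesis by (simp only:) simp
      next
        case False
        let ?P = "ennreal (\<bar>F y - F y'\<bar> powr p)"
        have "(\<Sum>k. ennreal (?t k powr (- ?\<beta>)) * (indicator (?S k y) y' * ?P))
          = (\<Sum>k. (indicator {k. norm (y - y') < c * ?t k} k * ennreal (?t k powr (- ?\<beta>))) * ?P)"
          using False by (intro suminf_cong) (auto simp: indicator_def)
        also have "\<dots> = (\<Sum>k. indicator {k. norm (y - y') < c * ?t k} k * ennreal (?t k powr (- ?\<beta>))) * ?P"
          by (rule ennreal_suminf_multc)
        also have "\<dots> \<le> ennreal (C * norm (y - y') powr (- ?\<beta>)) * ?P"
          unfolding C_def using False by (intro mult_right_mono dyadic_tail_sum \<beta> T c) auto
        also have "\<dots> = ennreal C * ennreal (\<bar>F y - F y'\<bar> powr p / norm (y - y') powr ?\<beta>)"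
          using C unfolding powr_minus_divide by (simp add: ennreal_mult[symmetric])
        finally show ?thesis using False by simp
      qed
    qed
    also have "\<dots> = ennreal C * (\<integral>\<^sup>+y'. indicator {y'. norm (y - y') < bdist \<Omega> y / 2} y' * ennreal (\<bar>F y - F y'\<bar> powr p / norm (y - y') powr ?\<beta>) \<partial>lborel)"
      by (rule nn_integral_cmult) measurable
    finally show ?thesis .
  qed
  have "(\<Sum>k. ennreal (?t k powr (- ?\<beta>)) * (\<integral>\<^sup>+y. indicator \<Omega> y * local_osc p \<Omega> F (c * ?t k) y \<partial>lborel))
    = (\<Sum>k. \<integral>\<^sup>+y. ennreal (?t k powr (- ?\<beta>)) * (indicator \<Omega> y * local_osc p \<Omega> F (c * ?t k) y) \<partial>lborel)"
    by (subst nn_integral_cmult) measurable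
  also have "\<dots> = (\<integral>\<^sup>+y. (\<Sum>k. ennreal (?t k powr (- ?\<beta>)) * (indicator \<Omega> y * local_osc p \<Omega> F (c * ?t k) y)) \<partial>lborel)"
    by (rule nn_integral_suminf[symmetric]) measurable
  also have "\<dots> \<le> (\<integral>\<^sup>+y. ennreal C * (indicator \<Omega> y * (\<integral>\<^sup>+y'. indicator {y'. norm (y - y') < bdist \<Omega> y / 2} y' * ennreal (\<bar>F y - F y'\<bar> powr p / norm (y - y') powr ?\<beta>) \<partial>lborel)) \<partial>lborel)"
    by (rule nn_integral_mono) (use pt in \<open>auto simp: indicator_def\<close>)
  also have "\<dots> = ennreal C * restricted_energy s p \<Omega> F"
    unfolding restricted_energy_def by (rule nn_integral_cmult) measurable
  finally show ?thesis by blast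
qed

section \<open>A dyadic Hardy inequality\<close>

lemma le_if_powr_le:
  fixes x y p :: real
  assumes "x powr p \<le> y powr p" "0 < p" "0 \<le> y"
  shows "x \<le> y"
  using assms powr_less_mono2[of p y x] by (meson not_le)

text \<open>Tonelli's theorem for double series, with one sum read as an integral over counting
  measure.\<close>

lemma suminf_swap:
  fixes f :: "nat \<Rightarrow> nat \<Rightarrow> ennreal"
  shows "(\<Sum>i. \<Sum>j. f i j) = (\<Sum>j. \<Sum>i. f i j)"
  using nn_integral_suminf[of "\<lambda>i j. f i j" "count_space UNIV"]
  by (simp add: nn_integral_count_space_nat)

text \<open>
  Each increment of index \<open>k \<ge> j\<close> is at most \<open>\<sigma> / \<mu> ^ k\<close>, where \<open>\<sigma> powr p\<close> is the weighted sum on the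
  right; summing the geometric series replaces Hoelder's inequality.
\<close>

lemma limit_deviation_le:
  fixes a :: "nat \<Rightarrow> real" and \<nu> p :: real
  assumes \<nu>: "1 < \<nu>" and p: "0 < p" and L: "a \<longlonglongrightarrow> L"
  defines "\<mu> \<equiv> \<nu> powr (1 / p)"
  shows "ennreal (\<bar>L - a j\<bar> powr p) \<le> ennreal ((\<mu> / (\<mu> - 1)) powr p / \<nu> ^ j) *
    (\<Sum>k. if j \<le> k then ennreal (\<nu> ^ k) * ennreal (\<bar>a (Suc k) - a k\<bar> powr p) else 0)" (is "_ \<le> _ * ?S")
proof -
  have \<mu>: "1 < \<mu>" unfolding \<mu>_def using \<nu> p by simp
  have \<mu>p: "(\<mu> ^ k) powr p = \<nu> ^ k" for k :: nat
  proof (induction k)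
    case (Suc k)
    have "\<mu> powr p = \<nu>" unfolding \<mu>_def using \<nu> p by (simp add: powr_powr)
    then show ?case using Suc \<mu> by (simp add: powr_mult)
  qed simp
  define C1 where "C1 = \<mu> / (\<mu> - 1)"
  have C1: "0 < C1" unfolding C1_def using \<mu> by simp
  show ?thesis
  proof (cases "?S = \<infinity>")
    case True
    have "0 < C1 powr p / \<nu> ^ j" using C1 \<nu> by simp
    then show ?thesis unfolding C1_def[symmetric] True using C1 \<nu> by (simp add: ennreal_mult_top)
  next
    case False
    define \<sigma> where "\<sigma> = (enn2real ?S) powr (1 / p)"
    have \<sigma>p: "\<sigma> powr p = enn2real ?S" unfolding \<sigma>_def using p by (simp add: powr_powr)
    have D: "\<bar>a (Suc k) - a k\<bar> \<le> \<sigma> / \<mu> ^ k" if "j \<le> k" for k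
    proof -
      have "ennreal (\<nu> ^ k) * ennreal (\<bar>a (Suc k) - a k\<bar> powr p) \<le> ?S"
        using term_le_suminf[of "\<lambda>k. if j \<le> k then ennreal (\<nu> ^ k) * ennreal (\<bar>a (Suc k) - a k\<bar> powr p) else 0" k] that by simp
      then have "ennreal (\<nu> ^ k * \<bar>a (Suc k) - a k\<bar> powr p) \<le> ennreal (enn2real ?S)"
        using False \<nu> by (simp add: ennreal_mult top.not_eq_extremum)
      then have "\<nu> ^ k * \<bar>a (Suc k) - a k\<bar> powr p \<le> \<sigma> powr p"
        unfolding \<sigma>p by (subst (asm) ennreal_le_iff) auto
      then have "(\<mu> ^ k * \<bar>a (Suc k) - a k\<bar>) powr p \<le> \<sigma> powr p"
        using \<mu> by (simp add: powr_mult \<mu>p)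
      then have "\<mu> ^ k * \<bar>a (Suc k) - a k\<bar> \<le> \<sigma>"
        by (rule le_if_powr_le[OF _ p]) (simp add: \<sigma>_def)
      then show ?thesis using \<mu> by (simp add: pos_le_divide_eq mult.commute)
    qed
    have \<sigma>0: "0 \<le> \<sigma>" by (simp add: \<sigma>_def)
    \<comment> \<open>C1 satisfies C1 (1 - 1 / \<mu>) = 1, so the majorant grows in each step by
      exactly the bound for the increment.\<close>
    have "\<bar>a (j + n) - a j\<bar> \<le> \<sigma> * C1 * (1 / \<mu> ^ j - 1 / \<mu> ^ (j + n))" for n
    proof (induction n)
      case (Suc n)
      have "\<bar>a (j + Suc n) - a j\<bar> \<le> \<bar>a (Suc (j + n)) - a (j + n)\<bar> + \<bar>a (j + n) - a j\<bar>" by simp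
      also have "\<dots> \<le> \<sigma> / \<mu> ^ (j + n) + \<sigma> * C1 * (1 / \<mu> ^ j - 1 / \<mu> ^ (j + n))"
        by (intro add_mono D Suc) simp
      also have "\<sigma> / \<mu> ^ (j + n) = \<sigma> * C1 * (1 / \<mu> ^ (j + n) - 1 / \<mu> ^ (j + Suc n))"
      proof -
        have "C1 * (1 / \<mu> ^ (j + n) - 1 / \<mu> ^ (j + Suc n)) = 1 / \<mu> ^ (j + n) * (C1 * (1 - 1 / \<mu>))"
          by (simp add: algebra_simps diff_divide_distrib)
        also have "C1 * (1 - 1 / \<mu>) = 1" unfolding C1_def using \<mu> by (simp add: field_simps)
        finally show ?thesis by (simp add: mult.assoc)
      qed
      finally show ?case by (simp add: algebra_simps)
    qed simp
    then have bd: "\<bar>a (j + n) - a j\<bar> \<le> \<sigma> * C1 / \<mu> ^ j" for n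
    proof (rule order_trans)
      have "\<sigma> * C1 * (1 / \<mu> ^ j - 1 / \<mu> ^ (j + n)) \<le> \<sigma> * C1 * (1 / \<mu> ^ j)"
        using \<sigma>0 C1 \<mu> by (intro mult_left_mono) auto
      then show "\<sigma> * C1 * (1 / \<mu> ^ j - 1 / \<mu> ^ (j + n)) \<le> \<sigma> * C1 / \<mu> ^ j" by simp
    qed
    have "(\<lambda>n. a (j + n)) \<longlonglongrightarrow> L"
      using LIMSEQ_ignore_initial_segment[OF L, of j] by (simp add: add.commute)
    then have "(\<lambda>n. \<bar>a (j + n) - a j\<bar>) \<longlonglongrightarrow> \<bar>L - a j\<bar>" by (intro tendsto_intros)
    then have "\<bar>L - a j\<bar> \<le> \<sigma> * C1 / \<mu> ^ j"
      by (rule LIMSEQ_le_const2) (use bd in auto)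
    then have "\<bar>L - a j\<bar> powr p \<le> (\<sigma> * C1 / \<mu> ^ j) powr p"
      using p by (intro powr_mono2) auto
    also have "\<dots> = C1 powr p / \<nu> ^ j * enn2real ?S"
      using \<sigma>0 C1 \<mu> by (simp add: powr_mult powr_divide \<mu>p \<sigma>p)
    finally have "ennreal (\<bar>L - a j\<bar> powr p) \<le> ennreal (C1 powr p / \<nu> ^ j) * ennreal (enn2real ?S)"
      using \<nu> by (simp add: ennreal_mult[symmetric] ennreal_leI)
    then show ?thesis
      using False by (simp add: C1_def top.not_eq_extremum)
  qed
qed

text \<open>One factor \<nu>^j of the weight is cancelled by \<open>limit_deviation_le\<close>.
  After exchanging the sums, the remaining factors with j \<le> k add up to at most a multiple of
  \<nu>^k, which restores the square.\<close>

lemma sum_limit_deviation_le: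
  fixes a :: "nat \<Rightarrow> real" and \<nu> p :: real
  assumes \<nu>: "1 < \<nu>" and p: "0 < p" and L: "a \<longlonglongrightarrow> L"
  defines "\<mu> \<equiv> \<nu> powr (1 / p)"
  shows "(\<Sum>j. ennreal ((\<nu> ^ j)\<^sup>2) * ennreal (\<bar>L - a j\<bar> powr p))
    \<le> ennreal ((\<mu> / (\<mu> - 1)) powr p * (\<nu> / (\<nu> - 1))) * (\<Sum>k. ennreal ((\<nu> ^ k)\<^sup>2) * ennreal (\<bar>a (Suc k) - a k\<bar> powr p))"
proof -
  define A where "A = (\<mu> / (\<mu> - 1)) powr p"
  have A: "0 \<le> A" by (simp add: A_def)
  let ?d = "\<lambda>k. ennreal (\<bar>a (Suc k) - a k\<bar> powr p)"
  have "(\<Sum>j. ennreal ((\<nu> ^ j)\<^sup>2) * ennreal (\<bar>L - a j\<bar> powr p))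
    \<le> (\<Sum>j. ennreal ((\<nu> ^ j)\<^sup>2) * (ennreal (A / \<nu> ^ j) * (\<Sum>k. if j \<le> k then ennreal (\<nu> ^ k) * ?d k else 0)))"
    unfolding A_def \<mu>_def by (intro suminf_le summableI mult_left_mono limit_deviation_le \<nu> p L) simp
  also have "\<dots> = (\<Sum>j. \<Sum>k. ennreal A * (if j \<le> k then ennreal (\<nu> ^ j) * ennreal (\<nu> ^ k) * ?d k else 0))"
  proof (intro suminf_cong)
    fix j
    have "ennreal ((\<nu> ^ j)\<^sup>2) * ennreal (A / \<nu> ^ j) = ennreal A * ennreal (\<nu> ^ j)"
      using \<nu> A by (simp add: ennreal_mult[symmetric] power2_eq_square)
    then have "ennreal ((\<nu> ^ j)\<^sup>2) * (ennreal (A / \<nu> ^ j) * (\<Sum>k. if j \<le> k then ennreal (\<nu> ^ k) * ?d k else 0))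
      = (ennreal A * ennreal (\<nu> ^ j)) * (\<Sum>k. if j \<le> k then ennreal (\<nu> ^ k) * ?d k else 0)"
      by (simp only: mult.assoc[symmetric])
    also have "\<dots> = (\<Sum>k. (ennreal A * ennreal (\<nu> ^ j)) * (if j \<le> k then ennreal (\<nu> ^ k) * ?d k else 0))"
      by (rule ennreal_suminf_cmult[symmetric])
    also have "\<dots> = (\<Sum>k. ennreal A * (if j \<le> k then ennreal (\<nu> ^ j) * ennreal (\<nu> ^ k) * ?d k else 0))"
      by (intro suminf_cong) (simp add: mult.assoc)
    finally show "ennreal ((\<nu> ^ j)\<^sup>2) * (ennreal (A / \<nu> ^ j) * (\<Sum>k. if j \<le> k then ennreal (\<nu> ^ k) * ?d k else 0))
      = (\<Sum>k. ennreal A * (if j \<le> k then ennreal (\<nu> ^ j) * ennreal (\<nu> ^ k) * ?d k else 0))" .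
  qed
  also have "\<dots> = (\<Sum>k. \<Sum>j. ennreal A * (if j \<le> k then ennreal (\<nu> ^ j) * ennreal (\<nu> ^ k) * ?d k else 0))"
    by (rule suminf_swap)
  also have "\<dots> \<le> (\<Sum>k. ennreal (A * (\<nu> / (\<nu> - 1))) * (ennreal ((\<nu> ^ k)\<^sup>2) * ?d k))"
  proof (intro suminf_le summableI)
    fix k
    have "(\<Sum>j. ennreal A * (if j \<le> k then ennreal (\<nu> ^ j) * ennreal (\<nu> ^ k) * ?d k else 0))
      = (\<Sum>j\<le>k. ennreal A * (if j \<le> k then ennreal (\<nu> ^ j) * ennreal (\<nu> ^ k) * ?d k else 0))"
      by (rule suminf_finite) auto
    also have "\<dots> = (\<Sum>j\<le>k. ennreal (\<nu> ^ j) * (ennreal A * ennreal (\<nu> ^ k) * ?d k))"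
      by (intro sum.cong refl) (simp add: mult_ac)
    also have "\<dots> = (\<Sum>j\<le>k. ennreal (\<nu> ^ j)) * (ennreal A * ennreal (\<nu> ^ k) * ?d k)"
      by (rule sum_distrib_right[symmetric])
    also have "(\<Sum>j\<le>k. ennreal (\<nu> ^ j)) = ennreal (\<Sum>j\<le>k. \<nu> ^ j)"
      using \<nu> by (intro sum_ennreal) auto
    also have "\<dots> * (ennreal A * ennreal (\<nu> ^ k) * ?d k) \<le> ennreal (\<nu> ^ k * (\<nu> / (\<nu> - 1))) * (ennreal A * ennreal (\<nu> ^ k) * ?d k)"
    proof (intro mult_right_mono ennreal_leI)
      have "(\<Sum>j\<le>k. \<nu> ^ j) = (\<nu> ^ Suc k - 1) / (\<nu> - 1)"
        using \<nu> geometric_sum[of \<nu> "Suc k"] by (simp add: lessThan_Suc_atMost)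
      also have "\<dots> \<le> \<nu> ^ Suc k / (\<nu> - 1)"
        using \<nu> by (intro divide_right_mono) auto
      finally show "(\<Sum>j\<le>k. \<nu> ^ j) \<le> \<nu> ^ k * (\<nu> / (\<nu> - 1))" by (simp add: mult.commute)
    qed simp
    also have "\<dots> = ennreal (A * (\<nu> / (\<nu> - 1))) * (ennreal ((\<nu> ^ k)\<^sup>2) * ?d k)"
    proof -
      have "ennreal (\<nu> ^ k * (\<nu> / (\<nu> - 1))) * ennreal A * ennreal (\<nu> ^ k) = ennreal (A * (\<nu> / (\<nu> - 1))) * ennreal ((\<nu> ^ k)\<^sup>2)"
        using \<nu> A by (simp add: ennreal_mult[symmetric] power2_eq_square mult_ac)
      then show ?thesis by (simp only: mult.assoc[symmetric])
    qed
    finally show "(\<Sum>j. ennreal A * (if j \<le> k then ennreal (\<nu> ^ j) * ennreal (\<nu> ^ k) * ?d k else 0))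
      \<le> ennreal (A * (\<nu> / (\<nu> - 1))) * (ennreal ((\<nu> ^ k)\<^sup>2) * ?d k)" .
  qed
  also have "\<dots> = ennreal (A * (\<nu> / (\<nu> - 1))) * (\<Sum>k. ennreal ((\<nu> ^ k)\<^sup>2) * ?d k)"
    by (rule ennreal_suminf_cmult)
  finally show ?thesis unfolding A_def .
qed

text \<open>Consecutive weights have ratio 2^(s p), and \<nu> is its square root: half of the growth
  pays for the bound on the tail, the other half for the sum over j.\<close>

lemma dyadic_Hardy:
  fixes s p T :: real
  assumes s: "0 < s" and p: "0 < p" and T: "0 < T"
  obtains C where "0 \<le> C" "\<And>a L. a \<longlonglongrightarrow> L \<Longrightarrow>
    (\<Sum>j. ennreal ((T / 2 ^ j) powr (- s * p)) * ennreal (\<bar>L - a j\<bar> powr p))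
    \<le> ennreal C * (\<Sum>k. ennreal ((T / 2 ^ k) powr (- s * p)) * ennreal (\<bar>a (Suc k) - a k\<bar> powr p))"
proof -
  define \<nu> where "\<nu> = (2::real) powr (s * p / 2)"
  have \<nu>: "1 < \<nu>" unfolding \<nu>_def using s p by simp
  have \<nu>2: "\<nu>\<^sup>2 = 2 powr (s * p)" by (simp add: \<nu>_def power2_eq_square mult.commute flip: powr_add)
  have t: "(T / 2 ^ j) powr (- s * p) = T powr (- s * p) * (\<nu> ^ j)\<^sup>2" for j :: nat
  proof -
    have "(2 ^ j) powr (s * p) = (2 powr (s * p)) ^ j" by (induction j) (simp_all add: powr_mult)
    moreover have "(\<nu> ^ j)\<^sup>2 = (\<nu>\<^sup>2) ^ j" by (simp add: power_mult[symmetric] mult.commute)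
    ultimately have "(\<nu> ^ j)\<^sup>2 = (2 ^ j) powr (s * p)" by (simp add: \<nu>2)
    then show ?thesis using T by (simp add: powr_divide powr_minus_divide)
  qed
  define \<mu> where "\<mu> = \<nu> powr (1 / p)"
  have \<mu>: "1 < \<mu>" unfolding \<mu>_def using \<nu> p by simp
  show thesis
  proof (rule that)
    show "0 \<le> (\<mu> / (\<mu> - 1)) powr p * (\<nu> / (\<nu> - 1))" using \<nu> by simp
    fix a :: "nat \<Rightarrow> real" and L assume L: "a \<longlonglongrightarrow> L"
    have "(\<Sum>j. ennreal ((T / 2 ^ j) powr (- s * p)) * ennreal (\<bar>L - a j\<bar> powr p))
      = ennreal (T powr (- s * p)) * (\<Sum>j. ennreal ((\<nu> ^ j)\<^sup>2) * ennreal (\<bar>L - a j\<bar> powr p))"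
      unfolding t by (simp add: ennreal_mult mult.assoc)
    also have "\<dots> \<le> ennreal (T powr (- s * p)) * (ennreal ((\<mu> / (\<mu> - 1)) powr p * (\<nu> / (\<nu> - 1))) *
        (\<Sum>k. ennreal ((\<nu> ^ k)\<^sup>2) * ennreal (\<bar>a (Suc k) - a k\<bar> powr p)))"
      unfolding \<mu>_def by (intro mult_left_mono sum_limit_deviation_le \<nu> p L) simp
    also have "\<dots> = ennreal ((\<mu> / (\<mu> - 1)) powr p * (\<nu> / (\<nu> - 1))) *
        (\<Sum>k. ennreal ((T / 2 ^ k) powr (- s * p)) * ennreal (\<bar>a (Suc k) - a k\<bar> powr p))"
    proof -
      have "(\<Sum>k. ennreal ((T / 2 ^ k) powr (- s * p)) * ennreal (\<bar>a (Suc k) - a k\<bar> powr p))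
       = ennreal (T powr (- s * p)) * (\<Sum>k. ennreal ((\<nu> ^ k)\<^sup>2) * ennreal (\<bar>a (Suc k) - a k\<bar> powr p))"
        unfolding t by (simp add: ennreal_mult mult.assoc)
      then show ?thesis by (simp only: mult.left_commute)
    qed
    finally show "(\<Sum>j. ennreal ((T / 2 ^ j) powr (- s * p)) * ennreal (\<bar>L - a j\<bar> powr p))
      \<le> ennreal ((\<mu> / (\<mu> - 1)) powr p * (\<nu> / (\<nu> - 1))) *
        (\<Sum>k. ennreal ((T / 2 ^ k) powr (- s * p)) * ennreal (\<bar>a (Suc k) - a k\<bar> powr p))" .
  qed
qed

section \<open>Grid cells and their interior points\<close>

lemma grid_size_exists:
  fixes \<Omega> :: "'a::euclidean_space set"
  assumes "bounded \<Omega>" "0 < t"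
  obtains M :: nat where "\<And>x i. x \<in> \<Omega> \<Longrightarrow> i \<in> Basis \<Longrightarrow> \<bar>x \<bullet> i / t\<bar> + 1 \<le> real M"
proof -
  obtain B where B: "\<And>x. x \<in> \<Omega> \<Longrightarrow> norm x \<le> B" using assms(1) by (auto simp: bounded_iff)
  obtain M :: nat where M: "B / t + 1 \<le> real M" using real_arch_simple by blast
  show thesis
  proof (rule that)
    fix x i :: 'a assume x: "x \<in> \<Omega>" and i: "i \<in> Basis"
    have "\<bar>x \<bullet> i\<bar> \<le> B" using Basis_le_norm[OF i, of x] B[OF x] by linarith
    then have "\<bar>x \<bullet> i / t\<bar> \<le> B / t" using assms(2) by (simp add: abs_divide divide_right_mono)
    then show "\<bar>x \<bullet> i / t\<bar> + 1 \<le> real M" using M by linarith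
  qed
qed

lemma active_dist_le:
  fixes x y :: "'a::euclidean_space"
  assumes "active t m x" "active t m y" "0 < t"
  shows "dist x y \<le> 2 * real DIM('a) * t"
proof -
  have "\<bar>(x - y) \<bullet> i\<bar> \<le> 2 * t" if "i \<in> Basis" for i
  proof -
    have "\<bar>x \<bullet> i / t - y \<bullet> i / t\<bar> \<le> 2"
      using assms(1,2) that unfolding active_def by (smt (verit))
    then have "\<bar>x \<bullet> i / t - y \<bullet> i / t\<bar> * t \<le> 2 * t" using assms(3) by (intro mult_right_mono) auto
    moreover have "\<bar>x \<bullet> i / t - y \<bullet> i / t\<bar> * t = \<bar>(x - y) \<bullet> i\<bar>"
    proof -
      have "\<bar>x \<bullet> i / t - y \<bullet> i / t\<bar> * t = \<bar>(x \<bullet> i / t - y \<bullet> i / t) * t\<bar>"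
        using assms(3) by (simp add: abs_mult)
      then show ?thesis using assms(3) by (simp add: left_diff_distrib inner_diff_left)
    qed
    ultimately show ?thesis by simp
  qed
  then have "(\<Sum>i\<in>Basis. \<bar>(x - y) \<bullet> i\<bar>) \<le> (\<Sum>i\<in>(Basis::'a set). 2 * t)" by (rule sum_mono)
  then show ?thesis
    using norm_le_l1[of "x - y"] by (simp add: dist_norm)
qed

text \<open>One interior point serves a whole cell: the corkscrew condition is used at an arbitrary
  point of \<Omega> in the cell, and the size of the cell adds 2 n t to the distance. Cells missing
  \<Omega> receive an arbitrary value.\<close>

lemma grid_points_exist:
  fixes \<Omega> :: "'a::euclidean_space set"
  assumes t: "0 < t" and cork: "\<And>x. x \<in> \<Omega> \<Longrightarrow> \<exists>z\<in>\<Omega>. dist x z \<le> t \<and> t / b \<le> bdist \<Omega> z"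
  obtains z where "\<And>m x. x \<in> \<Omega> \<Longrightarrow> active t m x \<Longrightarrow>
    z m \<in> \<Omega> \<and> dist x (z m) \<le> (2 * real DIM('a) + 1) * t \<and> t / b \<le> bdist \<Omega> (z m)"
proof -
  have "\<exists>z. \<forall>x\<in>\<Omega>. active t m x \<longrightarrow>
    z \<in> \<Omega> \<and> dist x z \<le> (2 * real DIM('a) + 1) * t \<and> t / b \<le> bdist \<Omega> z" for m :: "'a \<Rightarrow> int"
  proof (cases "\<exists>x0\<in>\<Omega>. active t m x0")
    case True
    then obtain x0 where x0: "x0 \<in> \<Omega>" "active t m x0" by blast
    obtain z where z: "z \<in> \<Omega>" "dist x0 z \<le> t" "t / b \<le> bdist \<Omega> z" using cork[OF x0(1)] by blast
    have "dist x z \<le> (2 * real DIM('a) + 1) * t" if "active t m x" for x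
      using active_dist_le[OF that x0(2) t] dist_triangle[of x z x0] z(2) by (simp add: algebra_simps)
    then show ?thesis using z by blast
  qed blast
  then obtain z where "\<forall>m. \<forall>x\<in>\<Omega>. active t m x \<longrightarrow>
    z m \<in> \<Omega> \<and> dist x (z m) \<le> (2 * real DIM('a) + 1) * t \<and> t / b \<le> bdist \<Omega> (z m)" by metis
  then show thesis using that by blast
qed

lemma Lp_power_add_le:
  assumes \<Omega>: "open \<Omega>" and [measurable]: "f \<in> borel_measurable borel" "g \<in> borel_measurable borel" and p: "0 \<le> p"
  shows "Lp_power p \<Omega> (\<lambda>x. f x + g x) \<le> ennreal (2 powr p) * (Lp_power p \<Omega> f + Lp_power p \<Omega> g)"
proof -
  have [measurable]: "\<Omega> \<in> sets borel" using \<Omega> by auto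
  have "Lp_power p \<Omega> (\<lambda>x. f x + g x) \<le> (\<integral>\<^sup>+x. ennreal (2 powr p) * (indicator \<Omega> x * ennreal (\<bar>f x\<bar> powr p) + indicator \<Omega> x * ennreal (\<bar>g x\<bar> powr p)) \<partial>lborel)"
    unfolding Lp_power_def
  proof (rule nn_integral_mono)
    fix x
    have "ennreal (\<bar>f x + g x\<bar> powr p) \<le> ennreal (2 powr p) * (ennreal (\<bar>f x\<bar> powr p) + ennreal (\<bar>g x\<bar> powr p))"
      using abs_add_powr_le[OF p, of "f x" "g x"] by (simp add: ennreal_mult[symmetric] ennreal_leI flip: ennreal_plus)
    then show "indicator \<Omega> x * ennreal (\<bar>f x + g x\<bar> powr p)
      \<le> ennreal (2 powr p) * (indicator \<Omega> x * ennreal (\<bar>f x\<bar> powr p) + indicator \<Omega> x * ennreal (\<bar>g x\<bar> powr p))"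
      by (auto simp: indicator_def)
  qed
  also have "\<dots> = ennreal (2 powr p) * (Lp_power p \<Omega> f + Lp_power p \<Omega> g)"
    unfolding Lp_power_def by (subst nn_integral_cmult, measurable) (subst nn_integral_add, measurable)
  finally show ?thesis .
qed

lemma zero_in_W1p:
  assumes \<Omega>: "open \<Omega>" "bounded \<Omega>" and p: "0 < p"
  shows "(\<lambda>x. 0) \<in> W1p_space p \<Omega>" "W1p_norm p \<Omega> (\<lambda>x. 0) = 0"
proof -
  note C1 = C1_in_W1p[OF \<Omega> p, of "\<lambda>x. 0" "\<lambda>i x. 0"]
  show "(\<lambda>x. 0) \<in> W1p_space p \<Omega>" by (rule C1(1)) auto
  have "ennreal (W1p_norm p \<Omega> (\<lambda>x. 0) powr p) = 0"
    by (subst C1(2)) (auto simp: Lp_power_def)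
  then have "W1p_norm p \<Omega> (\<lambda>x. 0) powr p = 0"
    by (simp add: ennreal_eq_0_iff)
  then show "W1p_norm p \<Omega> (\<lambda>x. 0) = 0" by simp
qed

section \<open>Smoothing on the scale of a uniform domain\<close>

lemma borel_measurable_local_energy [measurable]:
  assumes \<Omega>: "open \<Omega>" and [measurable]: "F \<in> borel_measurable borel"
  shows "local_energy p \<Omega> F \<rho> r \<in> borel_measurable borel"
proof -
  have [measurable]: "\<Omega> \<in> sets borel" using \<Omega> by auto
  show ?thesis unfolding local_energy_def[abs_def] by measurable
qed

text \<open>
  Finiteness of the inner integral of the restricted seminorm at \<open>x\<close> forces the averages near \<open>x\<close> to
  converge to \<open>F x\<close>, which takes the place of Lebesgue's differentiation theorem.
\<close>

lemma ball_avg_tendsto_bound: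
  fixes F :: "'a::euclidean_space \<Rightarrow> real"
  assumes F: "integrable lborel F" and p: "1 \<le> p" and s: "0 < s" and t: "0 < t" and \<delta>: "0 < \<delta>" and \<Lambda>: "0 < \<Lambda>"
    and z: "dist x z \<le> \<Lambda> * t" and small: "(\<Lambda> + \<delta>) * t \<le> bdist \<Omega> x / 2"
  shows "ennreal (\<bar>ball_avg F z (\<delta> * t) - F x\<bar> powr p) \<le>
    ennreal ((\<Lambda> + \<delta>) powr (real DIM('a) + s * p) / ball_vol TYPE('a) \<delta> * t powr (s * p)) *
    (\<integral>\<^sup>+y. indicator {y. norm (x - y) < bdist \<Omega> x / 2} y *
            ennreal (\<bar>F x - F y\<bar> powr p / norm (x - y) powr (real DIM('a) + s * p)) \<partial>lborel)"
proof -
  let ?\<beta> = "real DIM('a) + s * p"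
  let ?V = "ball_vol TYPE('a) (\<delta> * t)" and ?\<tau> = "(\<Lambda> + \<delta>) * t"
  let ?A = "\<bar>ball_avg F z (\<delta> * t) - F x\<bar> powr p"
  let ?G = "\<integral>\<^sup>+y. indicator {y. norm (x - y) < bdist \<Omega> x / 2} y * ennreal (\<bar>F x - F y\<bar> powr p / norm (x - y) powr ?\<beta>) \<partial>lborel"
  have [measurable]: "F \<in> borel_measurable borel" using F by auto
  have \<beta>: "0 \<le> ?\<beta>" using s p by simp
  have V: "0 < ?V" using t \<delta> by (simp add: ball_vol_pos)
  have "ennreal ?V * ennreal ?A \<le> (\<integral>\<^sup>+y. indicator (ball z (\<delta> * t)) y * ennreal (\<bar>F y - F x\<bar> powr p) \<partial>lborel)"
    by (rule ball_avg_deviation[OF F mult_pos_pos[OF \<delta> t] p])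
  also have "\<dots> \<le> (\<integral>\<^sup>+y. ennreal (?\<tau> powr ?\<beta>) * (indicator {y. norm (x - y) < bdist \<Omega> x / 2} y * ennreal (\<bar>F x - F y\<bar> powr p / norm (x - y) powr ?\<beta>)) \<partial>lborel)"
  proof (rule nn_integral_mono)
    fix y
    show "indicator (ball z (\<delta> * t)) y * ennreal (\<bar>F y - F x\<bar> powr p)
      \<le> ennreal (?\<tau> powr ?\<beta>) * (indicator {y. norm (x - y) < bdist \<Omega> x / 2} y * ennreal (\<bar>F x - F y\<bar> powr p / norm (x - y) powr ?\<beta>))"
    proof (cases "y \<in> ball z (\<delta> * t) \<and> y \<noteq> x")
      case True
      then have "dist z y < \<delta> * t" by simp
      then have lt: "norm (x - y) < ?\<tau>"
        using dist_triangle[of x y z] z by (simp add: dist_norm algebra_simps)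
      have "\<bar>F y - F x\<bar> powr p = norm (x - y) powr ?\<beta> * (\<bar>F x - F y\<bar> powr p / norm (x - y) powr ?\<beta>)"
        using True by (simp add: abs_minus_commute)
      also have "\<dots> \<le> ?\<tau> powr ?\<beta> * (\<bar>F x - F y\<bar> powr p / norm (x - y) powr ?\<beta>)"
        using lt \<beta> by (intro mult_right_mono powr_mono2) auto
      finally show ?thesis
        using True lt small by (simp add: ennreal_mult[symmetric] ennreal_leI)
    qed auto
  qed
  also have "\<dots> = ennreal (?\<tau> powr ?\<beta>) * ?G"
    by (rule nn_integral_cmult) measurable
  finally have *: "ennreal ?V * ennreal ?A \<le> ennreal (?\<tau> powr ?\<beta>) * ?G" .
  have "ennreal ?A = ennreal (1 / ?V) * (ennreal ?V * ennreal ?A)"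
    using V by (simp add: mult.assoc[symmetric] ennreal_mult'[symmetric])
  also have "\<dots> \<le> ennreal (1 / ?V) * (ennreal (?\<tau> powr ?\<beta>) * ?G)"
    by (intro mult_left_mono *) simp
  also have "\<dots> = ennreal (1 / ?V * ?\<tau> powr ?\<beta>) * ?G"
    using V by (simp add: mult.assoc[symmetric] ennreal_mult[symmetric])
  \<comment> \<open>The ball volume cancels t^n and leaves a positive power of t, so that the bound
    tends to 0 with the scale.\<close>
  also have "1 / ?V * ?\<tau> powr ?\<beta> = (\<Lambda> + \<delta>) powr ?\<beta> / ball_vol TYPE('a) \<delta> * t powr (s * p)"
  proof -
    have "?\<tau> powr ?\<beta> = (\<Lambda> + \<delta>) powr ?\<beta> * (t ^ DIM('a) * t powr (s * p))"
      using \<Lambda> \<delta> t by (simp add: powr_mult powr_add powr_realpow)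
    then show ?thesis using t by (simp add: ball_vol_mult)
  qed
  finally show ?thesis .
qed

lemma tendsto_dyadic_powr:
  fixes q T :: real
  assumes "0 < q" "0 < T"
  shows "(\<lambda>k. (T / 2 ^ k) powr q) \<longlonglongrightarrow> 0"
proof -
  have "(T / 2 ^ k) powr q = T powr q / (2 powr q) ^ k" for k :: nat
  proof -
    have "((2::real) ^ k) powr q = (2 powr q) ^ k" by (induction k) (simp_all add: powr_mult)
    then show ?thesis using assms by (simp add: powr_divide)
  qed
  moreover have "(\<lambda>k. T powr q / (2 powr q) ^ k) \<longlonglongrightarrow> 0"
    by (rule LIMSEQ_divide_realpow_zero) (use assms in simp)
  ultimately show ?thesis by simp
qed

text \<open>Standing data: F is a Borel representative, zero outside \<Omega>, of an element of the
  restricted space.\<close>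

locale smoothing =
  fixes \<Omega> :: "'a::euclidean_space set" and a b p s :: real and F :: "'a \<Rightarrow> real"
  assumes dom: "bounded_domain \<Omega>" and unif: "uniform_with a b \<Omega>"
    and p: "1 \<le> p" and s: "0 < s" "s < 1"
    and F_borel [measurable]: "F \<in> borel_measurable borel" and F_0: "\<And>x. x \<notin> \<Omega> \<Longrightarrow> F x = 0"
    and F_Lp: "Lp_power p \<Omega> F < \<infinity>"
    and F_energy: "restricted_energy s p \<Omega> F < \<infinity>"
begin

lemma open_\<Omega>: "open \<Omega>" and bounded_\<Omega>: "bounded \<Omega>"
  using dom by (auto simp: bounded_domain_def)

lemma \<Omega>_borel [measurable]: "\<Omega> \<in> sets borel"
  using open_\<Omega> by auto

lemma F_integrable: "integrable lborel F"
  by (rule integrable_if_Lp_power_finite[OF open_\<Omega> bounded_\<Omega> p F_borel F_0 F_Lp])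

text \<open>Both sums are dominated by the series of W k, the weighted integrals of \<Psi> k. The
  value \<Psi> k x bounds differences of averages in cells at x, within scale k and between scales k
  and k + 1: the gradient needs the former, Hardy's inequality the latter.\<close>

lemma approximation_exists:
  obtains T h dh where "0 < T"
    "\<And>k x. (h k has_derivative (\<lambda>v. \<Sum>i\<in>Basis. (v \<bullet> i) * dh k i x)) (at x)"
    "\<And>k i. i \<in> Basis \<Longrightarrow> continuous_on UNIV (dh k i)"
    "(\<Sum>k. ennreal ((T / 2 ^ k) powr (- s * p)) * Lp_power p \<Omega> (\<lambda>x. F x - h k x)) < \<infinity>"
    "\<And>i. i \<in> Basis \<Longrightarrow> (\<Sum>k. ennreal ((T / 2 ^ k) powr (p - s * p)) * Lp_power p \<Omega> (dh k i)) < \<infinity>"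
proof -
  have ab: "1 \<le> a" "1 \<le> b" using unif by (auto simp: uniform_with_def)
  let ?n = "DIM('a)"
  define \<Lambda> where "\<Lambda> = 2 * real ?n + 1"
  \<comment> \<open>Interior points at scale t have boundary distance t / b; the extra factor 2 lets
    those of scale t / 2 take part in chains at scale t.\<close>
  define \<kappa> where "\<kappa> = 1 / (2 * b)"
  define \<delta> where "\<delta> = \<kappa> / (16 * b)"
  have \<Lambda>: "0 < \<Lambda>" by (simp add: \<Lambda>_def)
  have \<kappa>: "0 < \<kappa>" using ab by (simp add: \<kappa>_def)
  have \<delta>: "0 < \<delta>" using ab \<kappa> by (simp add: \<delta>_def)
  obtain T where T: "0 < T" and cork: "\<And>x t. x \<in> \<Omega> \<Longrightarrow> 0 < t \<Longrightarrow> t \<le> T \<Longrightarrow> \<exists>z\<in>\<Omega>. dist x z \<le> t \<and> t / b \<le> bdist \<Omega> z"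
    using corkscrew[OF dom unif] by blast
  let ?t = "\<lambda>k::nat. T / 2 ^ k"
  have t: "0 < ?t k" "?t k \<le> T" for k
    using T by (auto simp: divide_le_eq mult_le_cancel_left1)
  obtain C \<rho> where C: "0 \<le> C" "0 < \<rho>" and chain: "\<And>x t P Q r r'. 0 < t \<Longrightarrow> P \<in> \<Omega> \<Longrightarrow> Q \<in> \<Omega> \<Longrightarrow>
      dist x P \<le> \<Lambda> * t \<Longrightarrow> dist x Q \<le> \<Lambda> * t \<Longrightarrow> \<kappa> * t \<le> bdist \<Omega> P \<Longrightarrow> \<kappa> * t \<le> bdist \<Omega> Q \<Longrightarrow>
      \<delta> * t / 2 \<le> r \<Longrightarrow> r \<le> \<delta> * t \<Longrightarrow> \<delta> * t / 2 \<le> r' \<Longrightarrow> r' \<le> \<delta> * t \<Longrightarrow>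
      ennreal (\<bar>ball_avg F P r - ball_avg F Q r'\<bar> powr p)
        \<le> ennreal (C / (t ^ DIM('a))\<^sup>2) * local_energy p \<Omega> F (\<rho> * t) (3 * (\<delta> * t)) x"
    using ball_avg_chain[OF unif \<kappa> \<Lambda> p \<delta>_def] F_integrable by metis
  have "\<exists>z. \<forall>m x. x \<in> \<Omega> \<longrightarrow> active (?t k) m x \<longrightarrow> z m \<in> \<Omega> \<and> dist x (z m) \<le> \<Lambda> * ?t k \<and> ?t k / b \<le> bdist \<Omega> (z m)" for k
    unfolding \<Lambda>_def using grid_points_exist[OF t(1) cork[OF _ t(1) t(2)]] by metis
  then obtain z where z: "\<And>k m x. x \<in> \<Omega> \<Longrightarrow> active (?t k) m x \<Longrightarrow> z k m \<in> \<Omega>"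
    "\<And>k m x. x \<in> \<Omega> \<Longrightarrow> active (?t k) m x \<Longrightarrow> dist x (z k m) \<le> \<Lambda> * ?t k"
    "\<And>k m x. x \<in> \<Omega> \<Longrightarrow> active (?t k) m x \<Longrightarrow> ?t k / b \<le> bdist \<Omega> (z k m)" by metis
  have "\<exists>M::nat. \<forall>x i. x \<in> \<Omega> \<longrightarrow> i \<in> Basis \<longrightarrow> \<bar>x \<bullet> i / ?t k\<bar> + 1 \<le> real M" for k
    using grid_size_exists[OF bounded_\<Omega> t(1)] by metis
  then obtain M :: "nat \<Rightarrow> nat" where M: "\<And>k x i. x \<in> \<Omega> \<Longrightarrow> i \<in> Basis \<Longrightarrow> \<bar>x \<bullet> i / ?t k\<bar> + 1 \<le> real (M k)"
    by metis
  define c where "c k m = ball_avg F (z k m) (\<delta> * ?t k)" for k m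
  define h where "h k x = (\<Sum>m\<in>grid (M k). c k m * bump (?t k) m x)" for k x
  define dh where "dh k i x = (\<Sum>m\<in>grid (M k). c k m * bump_deriv (?t k) m i x)" for k i x
  define \<Psi> where "\<Psi> k x = ennreal (C / (?t k ^ ?n)\<^sup>2) * local_energy p \<Omega> F (\<rho> * ?t k) (3 * (\<delta> * ?t k)) x" for k x
  have [measurable]: "\<Psi> k \<in> borel_measurable borel" for k
    unfolding \<Psi>_def[abs_def] using borel_measurable_local_energy[OF open_\<Omega> F_borel] by simp
  have h_deriv: "(h k has_derivative (\<lambda>v. \<Sum>i\<in>Basis. (v \<bullet> i) * dh k i x)) (at x)" for k x
  proof -
    have "(h k has_derivative (\<lambda>v. \<Sum>m\<in>grid (M k). c k m * (\<Sum>i\<in>Basis. (v \<bullet> i) * bump_deriv (?t k) m i x))) (at x)"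
      unfolding h_def[abs_def] using t(1)[of k]
      by (intro has_derivative_sum has_derivative_mult_right bump_has_derivative) auto
    moreover have "(\<Sum>m\<in>grid (M k). c k m * (\<Sum>i\<in>Basis. (v \<bullet> i) * bump_deriv (?t k) m i x)) = (\<Sum>i\<in>Basis. (v \<bullet> i) * dh k i x)" for v
      unfolding dh_def sum_distrib_left by (subst sum.swap) (simp add: mult_ac)
    ultimately show ?thesis by simp
  qed
  have dh_cont: "continuous_on UNIV (dh k i)" if "i \<in> Basis" for k i
    unfolding dh_def[abs_def] using t(1)[of k]
    by (intro continuous_intros continuous_on_bump_deriv) auto
  have h_cont: "continuous_on UNIV (h k)" for k
    using has_derivative_continuous[OF h_deriv] by (simp add: continuous_on_eq_continuous_at)
  have [measurable]: "h k \<in> borel_measurable borel" for k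
    by (rule borel_measurable_continuous_onI[OF h_cont])
  have \<kappa>t: "\<kappa> * ?t k \<le> ?t k / b" for k
    using ab t(1)[of k] unfolding \<kappa>_def by (simp add: divide_simps mult_le_cancel_left1)
  have half: "x / 2 \<le> x" if "0 < x" for x :: real using that by simp
  have near_same: "ennreal (\<bar>c k m - c k m'\<bar> powr p) \<le> \<Psi> k x"
    if "x \<in> \<Omega>" "active (?t k) m x" "active (?t k) m' x" for k m m' x
  proof -
    have "\<delta> * ?t k / 2 \<le> \<delta> * ?t k" using half[OF mult_pos_pos[OF \<delta> t(1)[of k]]] .
    then show ?thesis
      unfolding c_def \<Psi>_def
      by (intro chain[OF t(1) z(1)[OF that(1,2)] z(1)[OF that(1,3)] z(2)[OF that(1,2)] z(2)[OF that(1,3)]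
          order_trans[OF \<kappa>t z(3)[OF that(1,2)]] order_trans[OF \<kappa>t z(3)[OF that(1,3)]] _ order_refl _ order_refl])
  qed
  have near_next: "ennreal (\<bar>c k m - c (Suc k) m'\<bar> powr p) \<le> \<Psi> k x"
    if x: "x \<in> \<Omega>" and m: "active (?t k) m x" and m': "active (?t (Suc k)) m' x" for k m m' x
  proof -
    have "?t (Suc k) \<le> ?t k" using half[OF t(1)[of k]] by simp
    then have d: "dist x (z (Suc k) m') \<le> \<Lambda> * ?t k"
      using z(2)[OF x m'] mult_left_mono[of "?t (Suc k)" "?t k" \<Lambda>] \<Lambda> by linarith
    have "\<kappa> * ?t k = ?t (Suc k) / b" by (simp add: \<kappa>_def)
    then have b: "\<kappa> * ?t k \<le> bdist \<Omega> (z (Suc k) m')"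
      using z(3)[OF x m'] by (simp only:)
    have eq: "\<delta> * ?t (Suc k) = \<delta> * ?t k / 2" by simp
    have r: "\<delta> * ?t k / 2 \<le> \<delta> * ?t k" by (rule half[OF mult_pos_pos[OF \<delta> t(1)[of k]]])
    have r': "\<delta> * ?t k / 2 \<le> \<delta> * ?t (Suc k)" "\<delta> * ?t (Suc k) \<le> \<delta> * ?t k"
      unfolding eq by (rule order_refl, rule r)
    show ?thesis
      unfolding c_def \<Psi>_def
      by (rule chain[OF t(1) z(1)[OF x m] z(1)[OF x m'] z(2)[OF x m] d order_trans[OF \<kappa>t z(3)[OF x m]] b r order_refl r'])
  qed
  have diff_le: "ennreal (\<bar>h (Suc k) x - h k x\<bar> powr p) \<le> \<Psi> k x" if x: "x \<in> \<Omega>" for k x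
  proof -
    \<comment> \<open>The finer sum is compared with the constant h k x, then the coarser sum with
      the coefficient of the finer one found there.\<close>
    obtain m' where m': "active (?t (Suc k)) m' x" "\<bar>h (Suc k) x - h k x\<bar> \<le> \<bar>c (Suc k) m' - h k x\<bar>"
      using sum_bump_deviation[OF M[OF x], of "Suc k" "c (Suc k)" "h k x"] unfolding h_def[of "Suc k"] by blast
    obtain m where m: "active (?t k) m x" "\<bar>h k x - c (Suc k) m'\<bar> \<le> \<bar>c k m - c (Suc k) m'\<bar>"
      using sum_bump_deviation[OF M[OF x], of k "c k" "c (Suc k) m'"] unfolding h_def[of k] by blast
    have "\<bar>h (Suc k) x - h k x\<bar> powr p \<le> \<bar>c k m - c (Suc k) m'\<bar> powr p"
      using m(2) m'(2) p by (intro powr_mono2) auto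
    then show ?thesis
      using near_next[OF x m(1) m'(1)] by (auto intro: order_trans ennreal_leI)
  qed
  have grad_le: "ennreal (\<bar>dh k i x\<bar> powr p) \<le> ennreal ((2 ^ ?n * 2) powr p * ?t k powr (- p)) * \<Psi> k x"
    if x: "x \<in> \<Omega>" and i: "i \<in> Basis" for k i x
  proof -
    obtain m0 where m0: "active (?t k) m0 x" using exists_active[OF M[OF x], of k] by blast
    obtain m where m: "active (?t k) m x" "\<bar>dh k i x\<bar> \<le> 2 ^ ?n * (2 / ?t k) * \<bar>c k m - c k m0\<bar>"
      using sum_bump_deriv_deviation[OF M[OF x] t(1) i, of k "c k" "c k m0"] unfolding dh_def by blast
    have "\<bar>dh k i x\<bar> powr p \<le> ((2 ^ ?n * 2) / ?t k * \<bar>c k m - c k m0\<bar>) powr p"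
      using m(2) p by (intro powr_mono2) auto
    also have "\<dots> = (2 ^ ?n * 2) powr p * ?t k powr (- p) * \<bar>c k m - c k m0\<bar> powr p"
      using t(1)[of k] by (simp only: powr_mult powr_divide powr_minus_divide) simp
    finally have "ennreal (\<bar>dh k i x\<bar> powr p) \<le> ennreal ((2 ^ ?n * 2) powr p * ?t k powr (- p)) * ennreal (\<bar>c k m - c k m0\<bar> powr p)"
      by (simp add: ennreal_mult[symmetric] ennreal_leI)
    also have "\<dots> \<le> ennreal ((2 ^ ?n * 2) powr p * ?t k powr (- p)) * \<Psi> k x"
      by (intro mult_left_mono near_same x m m0) simp
    finally show ?thesis .
  qed
  let ?G = "\<lambda>x. \<integral>\<^sup>+y. indicator {y. norm (x - y) < bdist \<Omega> x / 2} y *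
            ennreal (\<bar>F x - F y\<bar> powr p / norm (x - y) powr (real ?n + s * p)) \<partial>lborel"
  have G_fin: "AE x in lborel. indicator \<Omega> x * ?G x \<noteq> \<infinity>"
    by (rule nn_integral_PInf_AE) (use F_energy in \<open>auto simp: restricted_energy_def\<close>)
  have conv: "AE x in lborel. x \<in> \<Omega> \<longrightarrow> (\<lambda>k. h k x) \<longlonglongrightarrow> F x"
    using G_fin
  proof eventually_elim
    case (elim x)
    show ?case
    proof
      assume x: "x \<in> \<Omega>"
      define g where "g = enn2real (?G x)"
      have g: "?G x = ennreal g" "0 \<le> g" using elim x by (auto simp: g_def top.not_eq_extremum)
      define A where "A = (\<Lambda> + \<delta>) powr (real ?n + s * p) / ball_vol TYPE('a) \<delta>"
      have A: "0 \<le> A" unfolding A_def using ball_vol_pos[OF \<delta>, where 'a = 'a] by simp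
      have "(\<lambda>k. (\<Lambda> + \<delta>) * ?t k) \<longlonglongrightarrow> (\<Lambda> + \<delta>) * 0"
        by (intro tendsto_mult tendsto_const LIMSEQ_divide_realpow_zero) simp
      \<comment> \<open>Once the scale is small compared with the boundary distance of x, the balls
        attached to x fit into the range of the inner integral.\<close>
      then have ev: "eventually (\<lambda>k. (\<Lambda> + \<delta>) * ?t k < bdist \<Omega> x / 2) sequentially"
        by (rule order_tendstoD(2)) (use bdist_pos[OF dom x] in simp)
      have "eventually (\<lambda>k. norm (h k x - F x) \<le> (A * g) powr (1 / p) * ?t k powr s) sequentially"
        using ev
      proof eventually_elim
        case (elim k)
        obtain m where m: "active (?t k) m x" "\<bar>h k x - F x\<bar> \<le> \<bar>c k m - F x\<bar>"
          using sum_bump_deviation[OF M[OF x], of k "c k" "F x"] unfolding h_def by blast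
        have "ennreal (\<bar>c k m - F x\<bar> powr p) \<le> ennreal (A * ?t k powr (s * p)) * ?G x"
          unfolding c_def A_def
          by (rule ball_avg_tendsto_bound[OF F_integrable p s(1) t(1) \<delta> \<Lambda> z(2)[OF x m(1)] less_imp_le[OF elim]])
        also have "\<dots> = ennreal (A * ?t k powr (s * p) * g)"
          unfolding g(1) using A g(2) by (simp add: ennreal_mult[symmetric])
        finally have "\<bar>c k m - F x\<bar> powr p \<le> A * ?t k powr (s * p) * g"
          using A g(2) by (subst (asm) ennreal_le_iff) auto
        also have "\<dots> = ((A * g) powr (1 / p) * ?t k powr s) powr p"
          (is "_ = ?r")
        proof -
          have "?r = ((A * g) powr (1 / p)) powr p * (?t k powr s) powr p"
            by (rule powr_mult)
          also have "((A * g) powr (1 / p)) powr p = A * g"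
            using A g(2) p by (simp add: powr_powr)
          also have "(?t k powr s) powr p = ?t k powr (s * p)" by (rule powr_powr)
          finally show ?thesis by (simp only: mult.assoc mult.commute[of g])
        qed
        finally have "\<bar>c k m - F x\<bar> \<le> (A * g) powr (1 / p) * ?t k powr s"
          by (rule le_if_powr_le) (use p in auto)
        then show ?case using m(2) by simp
      qed
      moreover have "(\<lambda>k. (A * g) powr (1 / p) * ?t k powr s) \<longlonglongrightarrow> (A * g) powr (1 / p) * 0"
        by (intro tendsto_mult tendsto_const tendsto_dyadic_powr s T)
      ultimately have "(\<lambda>k. h k x - F x) \<longlonglongrightarrow> 0"
        unfolding mult_zero_right by (rule Lim_null_comparison)
      then show "(\<lambda>k. h k x) \<longlonglongrightarrow> F x" by (simp add: LIM_zero_iff)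
    qed
  qed
  define W where "W k = ennreal (?t k powr (- s * p)) * (\<integral>\<^sup>+x. indicator \<Omega> x * \<Psi> k x \<partial>lborel)" for k
  have W_sum: "(\<Sum>k. W k) < \<infinity>"
  proof -
    define V where "V = ball_vol TYPE('a) \<rho>"
    have V: "0 < V" unfolding V_def using C by (simp add: ball_vol_pos)
    obtain C2 where C2: "(\<Sum>k. ennreal (?t k powr (- (real ?n + s * p))) *
      (\<integral>\<^sup>+y. indicator \<Omega> y * local_osc p \<Omega> F ((3 * \<delta>) * ?t k) y \<partial>lborel)) \<le> ennreal C2 * restricted_energy s p \<Omega> F"
      using sum_local_osc_le_energy[OF open_\<Omega> F_borel p s(1) T, of "3 * \<delta>"] \<delta> by auto
    have "W k \<le> ennreal (C * V) * (ennreal (?t k powr (- (real ?n + s * p))) *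
      (\<integral>\<^sup>+y. indicator \<Omega> y * local_osc p \<Omega> F ((3 * \<delta>) * ?t k) y \<partial>lborel))" for k
    proof -
      let ?L = "\<integral>\<^sup>+y. indicator \<Omega> y * local_osc p \<Omega> F ((3 * \<delta>) * ?t k) y \<partial>lborel"
      have "(\<integral>\<^sup>+x. indicator \<Omega> x * \<Psi> k x \<partial>lborel) \<le> (\<integral>\<^sup>+x. \<Psi> k x \<partial>lborel)"
        by (intro nn_integral_mono) (auto simp: indicator_def)
      also have "\<dots> = ennreal (C / (?t k ^ ?n)\<^sup>2) * (ennreal (ball_vol TYPE('a) (\<rho> * ?t k)) * ?L)"
      proof -
        have "0 \<le> \<rho> * ?t k" using C t(1)[of k] by (intro mult_nonneg_nonneg) auto
        then have "(\<integral>\<^sup>+x. local_energy p \<Omega> F (\<rho> * ?t k) (3 * (\<delta> * ?t k)) x \<partial>lborel) = ennreal (ball_vol TYPE('a) (\<rho> * ?t k)) * ?L"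
          unfolding mult.assoc[of 3 \<delta>] by (rule nn_integral_local_energy[OF open_\<Omega> F_borel])
        moreover have "(\<integral>\<^sup>+x. \<Psi> k x \<partial>lborel) = ennreal (C / (?t k ^ ?n)\<^sup>2) * (\<integral>\<^sup>+x. local_energy p \<Omega> F (\<rho> * ?t k) (3 * (\<delta> * ?t k)) x \<partial>lborel)"
          unfolding \<Psi>_def by (rule nn_integral_cmult) (simp add: borel_measurable_local_energy[OF open_\<Omega> F_borel])
        ultimately show ?thesis by (simp only:)
      qed
      finally have "W k \<le> ennreal (?t k powr (- s * p)) * (ennreal (C / (?t k ^ ?n)\<^sup>2) * (ennreal (ball_vol TYPE('a) (\<rho> * ?t k)) * ?L))"
        unfolding W_def by (rule mult_left_mono) simp
      also have "\<dots> = ennreal (?t k powr (- s * p) * (C / (?t k ^ ?n)\<^sup>2 * ball_vol TYPE('a) (\<rho> * ?t k))) * ?L"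
      proof -
        have "ennreal x1 * (ennreal x2 * (ennreal x3 * L)) = ennreal (x1 * (x2 * x3)) * L"
          if "0 \<le> x1" "0 \<le> x2" "0 \<le> x3" for x1 x2 x3 L
          using that by (simp add: ennreal_mult mult.assoc)
        then show ?thesis
          using C(1) less_imp_le[OF ball_vol_pos[OF mult_pos_pos[OF C(2) t(1)[of k]], where 'a = 'a]] by simp
      qed
      \<comment> \<open>The exponents add up: -2 n from averaging over two balls, n from integrating
        the local energy over x, and -s p from the weight.\<close>
      also have "?t k powr (- s * p) * (C / (?t k ^ ?n)\<^sup>2 * ball_vol TYPE('a) (\<rho> * ?t k)) = C * V * ?t k powr (- (real ?n + s * p))"
      proof -
        have "?t k powr (- (real ?n + s * p)) = ?t k powr (- s * p - real ?n)"
          by (simp add: algebra_simps)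
        also have "\<dots> = ?t k powr (- s * p) / ?t k powr real ?n" by (rule powr_diff)
        also have "?t k powr real ?n = ?t k ^ ?n" by (rule powr_realpow[OF t(1)])
        finally have "?t k powr (- (real ?n + s * p)) = ?t k powr (- s * p) / ?t k ^ ?n" .
        then show ?thesis
          using t(1)[of k] unfolding ball_vol_mult V_def by (simp only: power2_eq_square) simp
      qed
      also have "ennreal \<dots> * ?L = ennreal (C * V) * (ennreal (?t k powr (- (real ?n + s * p))) * ?L)"
        using C V by (simp add: ennreal_mult mult.assoc)
      finally show ?thesis .
    qed
    then have "(\<Sum>k. W k) \<le> (\<Sum>k. ennreal (C * V) * (ennreal (?t k powr (- (real ?n + s * p))) *
      (\<integral>\<^sup>+y. indicator \<Omega> y * local_osc p \<Omega> F ((3 * \<delta>) * ?t k) y \<partial>lborel)))"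
      by (intro suminf_le summableI)
    also have "\<dots> \<le> ennreal (C * V) * (ennreal C2 * restricted_energy s p \<Omega> F)"
      unfolding ennreal_suminf_cmult by (intro mult_left_mono C2) simp
    also have "\<dots> < \<infinity>" using F_energy by (auto simp: ennreal_mult_less_top)
    finally show ?thesis .
  qed
  obtain C3 where C3: "0 \<le> C3" "\<And>a L. a \<longlonglongrightarrow> L \<Longrightarrow>
    (\<Sum>j. ennreal (?t j powr (- s * p)) * ennreal (\<bar>L - a j\<bar> powr p))
    \<le> ennreal C3 * (\<Sum>k. ennreal (?t k powr (- s * p)) * ennreal (\<bar>a (Suc k) - a k\<bar> powr p))"
    using dyadic_Hardy[OF s(1) _ T, of p] p by auto
  have X_sum: "(\<Sum>k. ennreal (?t k powr (- s * p)) * Lp_power p \<Omega> (\<lambda>x. F x - h k x)) < \<infinity>"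
  proof -
    have "(\<Sum>k. ennreal (?t k powr (- s * p)) * Lp_power p \<Omega> (\<lambda>x. F x - h k x))
      = (\<Sum>k. \<integral>\<^sup>+x. ennreal (?t k powr (- s * p)) * (indicator \<Omega> x * ennreal (\<bar>F x - h k x\<bar> powr p)) \<partial>lborel)"
      unfolding Lp_power_def by (subst nn_integral_cmult) measurable
    also have "\<dots> = (\<integral>\<^sup>+x. (\<Sum>k. ennreal (?t k powr (- s * p)) * (indicator \<Omega> x * ennreal (\<bar>F x - h k x\<bar> powr p))) \<partial>lborel)"
      by (rule nn_integral_suminf[symmetric]) measurable
    also have "\<dots> \<le> (\<integral>\<^sup>+x. ennreal C3 * (\<Sum>k. ennreal (?t k powr (- s * p)) * (indicator \<Omega> x * \<Psi> k x)) \<partial>lborel)"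
    proof (rule nn_integral_mono_AE, use conv in eventually_elim)
      fix x assume cx: "x \<in> \<Omega> \<longrightarrow> (\<lambda>k. h k x) \<longlonglongrightarrow> F x"
      show "(\<Sum>k. ennreal (?t k powr (- s * p)) * (indicator \<Omega> x * ennreal (\<bar>F x - h k x\<bar> powr p)))
        \<le> ennreal C3 * (\<Sum>k. ennreal (?t k powr (- s * p)) * (indicator \<Omega> x * \<Psi> k x))"
      proof (cases "x \<in> \<Omega>")
        case True
        \<comment> \<open>Hardy's inequality is applied for each x to the numbers h k x with limit F
          x; integration over x comes afterwards.\<close>
        have "(\<Sum>k. ennreal (?t k powr (- s * p)) * ennreal (\<bar>F x - h k x\<bar> powr p))
          \<le> ennreal C3 * (\<Sum>k. ennreal (?t k powr (- s * p)) * ennreal (\<bar>h (Suc k) x - h k x\<bar> powr p))"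
          using cx True by (intro C3(2)) simp
        also have "\<dots> \<le> ennreal C3 * (\<Sum>k. ennreal (?t k powr (- s * p)) * \<Psi> k x)"
          by (intro mult_left_mono suminf_le summableI diff_le True) simp_all
        finally show ?thesis using True by simp
      qed simp
    qed
    also have "\<dots> = ennreal C3 * (\<integral>\<^sup>+x. (\<Sum>k. ennreal (?t k powr (- s * p)) * (indicator \<Omega> x * \<Psi> k x)) \<partial>lborel)"
      by (rule nn_integral_cmult) measurable
    also have "(\<integral>\<^sup>+x. (\<Sum>k. ennreal (?t k powr (- s * p)) * (indicator \<Omega> x * \<Psi> k x)) \<partial>lborel)
      = (\<Sum>k. \<integral>\<^sup>+x. ennreal (?t k powr (- s * p)) * (indicator \<Omega> x * \<Psi> k x) \<partial>lborel)"
      by (rule nn_integral_suminf) measurable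
    also have "\<dots> = (\<Sum>k. W k)"
      unfolding W_def by (subst nn_integral_cmult) measurable
    also have "ennreal C3 * (\<Sum>k. W k) < \<infinity>"
      using W_sum by (auto simp: ennreal_mult_less_top)
    finally show ?thesis .
  qed
  have D_sum: "(\<Sum>k. ennreal (?t k powr (p - s * p)) * Lp_power p \<Omega> (dh k i)) < \<infinity>" if i: "i \<in> Basis" for i
  proof -
    have "ennreal (?t k powr (p - s * p)) * Lp_power p \<Omega> (dh k i) \<le> ennreal ((2 ^ ?n * 2) powr p) * W k" for k
    proof -
      have "Lp_power p \<Omega> (dh k i) \<le> (\<integral>\<^sup>+x. ennreal ((2 ^ ?n * 2) powr p * ?t k powr (- p)) * (indicator \<Omega> x * \<Psi> k x) \<partial>lborel)"
        unfolding Lp_power_def by (rule nn_integral_mono) (use grad_le[OF _ i] in \<open>auto simp: indicator_def\<close>)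
      also have "\<dots> = ennreal ((2 ^ ?n * 2) powr p * ?t k powr (- p)) * (\<integral>\<^sup>+x. indicator \<Omega> x * \<Psi> k x \<partial>lborel)"
        by (rule nn_integral_cmult) measurable
      finally have "ennreal (?t k powr (p - s * p)) * Lp_power p \<Omega> (dh k i)
        \<le> ennreal (?t k powr (p - s * p)) * (ennreal ((2 ^ ?n * 2) powr p * ?t k powr (- p)) * (\<integral>\<^sup>+x. indicator \<Omega> x * \<Psi> k x \<partial>lborel))"
        by (rule mult_left_mono) simp
      also have "\<dots> = ennreal (?t k powr (p - s * p) * ((2 ^ ?n * 2) powr p * ?t k powr (- p))) * (\<integral>\<^sup>+x. indicator \<Omega> x * \<Psi> k x \<partial>lborel)"
        by (subst ennreal_mult, simp, simp, simp only: mult.assoc)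
      also have "?t k powr (p - s * p) * ((2 ^ ?n * 2) powr p * ?t k powr (- p)) = (2 ^ ?n * 2) powr p * ?t k powr (- s * p)"
      proof -
        have "?t k powr (p - s * p) * ?t k powr (- p) = ?t k powr (- s * p)"
          by (simp flip: powr_add)
        then show ?thesis by (simp only: mult.left_commute)
      qed
      also have "ennreal \<dots> * (\<integral>\<^sup>+x. indicator \<Omega> x * \<Psi> k x \<partial>lborel) = ennreal ((2 ^ ?n * 2) powr p) * W k"
        unfolding W_def by (subst ennreal_mult, simp, simp, simp only: mult.assoc)
      finally show ?thesis .
    qed
    then have "(\<Sum>k. ennreal (?t k powr (p - s * p)) * Lp_power p \<Omega> (dh k i)) \<le> (\<Sum>k. ennreal ((2 ^ ?n * 2) powr p) * W k)"
      by (intro suminf_le summableI)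
    also have "\<dots> < \<infinity>"
      unfolding ennreal_suminf_cmult using W_sum by (auto simp: ennreal_mult_less_top)
    finally show ?thesis .
  qed
  show thesis
    by (rule that[OF T h_deriv dh_cont X_sum D_sum])
qed

end

text \<open>In f = (f - h k) + h k the gradient of the second part is controlled by the
  approximation. Its own norm is at most a constant times those of F and F - h k together, and the
  contribution of F sums because s < 1.\<close>

lemma (in smoothing) interpolation_memI:
  assumes f: "f \<in> Lp_space p \<Omega>" and fF: "AE x in lborel. x \<in> \<Omega> \<longrightarrow> f x = F x"
  shows "f \<in> interpolation_space s p \<Omega>"
proof -
  have S: "\<Omega> \<in> sets lebesgue" using open_\<Omega> by simp
  have p0: "0 < p" "0 \<le> p" using p by auto
  obtain T h dh where T: "0 < T"
    and h: "\<And>k x. (h k has_derivative (\<lambda>v. \<Sum>i\<in>Basis. (v \<bullet> i) * dh k i x)) (at x)"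
    and dh: "\<And>k i. i \<in> Basis \<Longrightarrow> continuous_on UNIV (dh k i)"
    and X: "(\<Sum>k. ennreal ((T / 2 ^ k) powr (- s * p)) * Lp_power p \<Omega> (\<lambda>x. F x - h k x)) < \<infinity>"
    and D: "\<And>i. i \<in> Basis \<Longrightarrow> (\<Sum>k. ennreal ((T / 2 ^ k) powr (p - s * p)) * Lp_power p \<Omega> (dh k i)) < \<infinity>"
  proof (rule approximation_exists)
    fix T h dh
    assume *: "0 < T" "\<And>k x. (h k has_derivative (\<lambda>v. \<Sum>i\<in>Basis. (v \<bullet> i) * dh k i x)) (at x)"
      "\<And>k i. i \<in> Basis \<Longrightarrow> continuous_on UNIV (dh k i)"
      "(\<Sum>k. ennreal ((T / 2 ^ k) powr (- s * p)) * Lp_power p \<Omega> (\<lambda>x. F x - h k x)) < \<infinity>"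
      "\<And>i. i \<in> Basis \<Longrightarrow> (\<Sum>k. ennreal ((T / 2 ^ k) powr (p - s * p)) * Lp_power p \<Omega> (dh k i)) < \<infinity>"
    show thesis by (rule that[OF *])
  qed
  let ?t = "\<lambda>k::nat. T / 2 ^ k"
  have t: "0 < ?t k" "?t k \<le> T" for k
    using T by (auto simp: divide_le_eq mult_le_cancel_left1)
  note hW = C1_in_W1p[OF open_\<Omega> bounded_\<Omega> p0(1) h dh]
  have h_cont: "continuous_on UNIV (h k)" for k
    using has_derivative_continuous[OF h] by (simp add: continuous_on_eq_continuous_at)
  have h_borel [measurable]: "h k \<in> borel_measurable borel" for k
    by (rule borel_measurable_continuous_onI[OF h_cont])
  define g where "g k x = f x - h k x" for k x
  have gF: "Lp_power p \<Omega> (g k) = Lp_power p \<Omega> (\<lambda>x. F x - h k x)" for k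
    by (rule Lp_power_cong) (use fF in eventually_elim, simp add: g_def)
  have hL: "h k \<in> Lp_space p \<Omega>" for k
    using hW(1) by (simp add: W1p_space_def)
  have gL: "g k \<in> Lp_space p \<Omega>" for k
    unfolding Lp_space_iff[OF S]
  proof
    have m: "f \<in> borel_measurable (lebesgue_on \<Omega>)" "h k \<in> borel_measurable (lebesgue_on \<Omega>)"
      using f hL[of k] by (auto simp: Lp_space_def)
    show "g k \<in> borel_measurable (lebesgue_on \<Omega>)"
      unfolding g_def[abs_def] by (rule borel_measurable_diff[OF m])
    have "Lp_power p \<Omega> (\<lambda>x. F x + - h k x) \<le> ennreal (2 powr p) * (Lp_power p \<Omega> F + Lp_power p \<Omega> (\<lambda>x. - h k x))"
      by (rule Lp_power_add_le[OF open_\<Omega> _ _ p0(2)]) measurable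
    also have "\<dots> < \<infinity>"
      using F_Lp hL[of k] by (auto simp: ennreal_mult_less_top Lp_space_iff[OF S] Lp_power_def)
    finally show "Lp_power p \<Omega> (g k) < \<infinity>" unfolding gF by simp
  qed
  have dec: "decomposes \<Omega> f (g k) (h k)" for k
    by (simp add: decomposes_def g_def)
  let ?K = "\<lambda>l. K_functional p \<Omega> l f"
  let ?X = "\<lambda>k. Lp_power p \<Omega> (\<lambda>x. F x - h k x)"
  \<comment> \<open>From t_k^(p - s p) \<le> T^p t_k^(-s p): the norm of F - h k that enters through
    h k is absorbed by a series known to converge.\<close>
  define c where "c = ennreal (2 powr p * T powr p)"
  have K_le: "ennreal (?t k powr (- s * p) * ?K (?t k) powr p)
    \<le> ennreal (2 powr p) * (ennreal (?t k powr (- s * p)) * ?X k + (ennreal (2 powr p) * Lp_power p \<Omega> F * ennreal (?t k powr (p - s * p))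
        + c * (ennreal (?t k powr (- s * p)) * ?X k)
        + (\<Sum>i\<in>Basis. ennreal (?t k powr (p - s * p)) * Lp_power p \<Omega> (dh k i))))" for k
  proof -
    let ?\<alpha> = "?t k powr (- s * p)" and ?\<beta> = "?t k powr (p - s * p)"
    have \<alpha>\<beta>: "?\<alpha> * ?t k powr p = ?\<beta>" by (simp flip: powr_add)
    have "?K (?t k) \<le> Lp_norm p \<Omega> (g k) + ?t k * W1p_norm p \<Omega> (h k)"
      by (rule K_functional_le[OF dec gL hW(1) less_imp_le[OF t(1)]])
    moreover have "0 \<le> ?K (?t k)"
      by (rule K_functional_nonneg[OF dec[of k] gL hW(1) less_imp_le[OF t(1)]])
    ultimately have "?K (?t k) powr p \<le> \<bar>Lp_norm p \<Omega> (g k) + ?t k * W1p_norm p \<Omega> (h k)\<bar> powr p"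
      using p0 by (intro powr_mono2) auto
    also have "\<dots> \<le> 2 powr p * (\<bar>Lp_norm p \<Omega> (g k)\<bar> powr p + \<bar>?t k * W1p_norm p \<Omega> (h k)\<bar> powr p)"
      by (rule abs_add_powr_le[OF p0(2)])
    also have "\<dots> = 2 powr p * (Lp_norm p \<Omega> (g k) powr p + ?t k powr p * W1p_norm p \<Omega> (h k) powr p)"
    proof -
      have "\<bar>?t k * W1p_norm p \<Omega> (h k)\<bar> = ?t k * W1p_norm p \<Omega> (h k)"
        by (intro abs_of_nonneg mult_nonneg_nonneg less_imp_le[OF t(1)] W1p_norm_nonneg)
      moreover have "(?t k * W1p_norm p \<Omega> (h k)) powr p = ?t k powr p * W1p_norm p \<Omega> (h k) powr p"
        by (rule powr_mult)
      ultimately show ?thesis by (simp only: abs_of_nonneg[OF Lp_norm_nonneg])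
    qed
    finally have "?\<alpha> * ?K (?t k) powr p \<le> ?\<alpha> * (2 powr p * (Lp_norm p \<Omega> (g k) powr p + ?t k powr p * W1p_norm p \<Omega> (h k) powr p))"
      by (rule mult_left_mono) simp
    also have "\<dots> = 2 powr p * (?\<alpha> * Lp_norm p \<Omega> (g k) powr p + ?\<beta> * W1p_norm p \<Omega> (h k) powr p)"
      unfolding \<alpha>\<beta>[symmetric] by (simp only: distrib_left mult_ac)
    finally have "ennreal (?\<alpha> * ?K (?t k) powr p) \<le> ennreal (2 powr p * (?\<alpha> * Lp_norm p \<Omega> (g k) powr p + ?\<beta> * W1p_norm p \<Omega> (h k) powr p))"
      by (rule ennreal_leI)
    also have "\<dots> = ennreal (2 powr p) * (ennreal ?\<alpha> * ennreal (Lp_norm p \<Omega> (g k) powr p) + ennreal ?\<beta> * ennreal (W1p_norm p \<Omega> (h k) powr p))"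
      by (simp only: ennreal_mult ennreal_plus powr_ge_zero mult_nonneg_nonneg add_nonneg_nonneg)
    also have "ennreal (Lp_norm p \<Omega> (g k) powr p) = ?X k"
      using Lp_norm_powr[OF S gL p0(1)] gF by simp
    also have "ennreal (W1p_norm p \<Omega> (h k) powr p) = Lp_power p \<Omega> (h k) + (\<Sum>i\<in>Basis. Lp_power p \<Omega> (dh k i))"
      by (rule hW(2))
    also have "ennreal (2 powr p) * (ennreal ?\<alpha> * ?X k + ennreal ?\<beta> * (Lp_power p \<Omega> (h k) + (\<Sum>i\<in>Basis. Lp_power p \<Omega> (dh k i))))
      \<le> ennreal (2 powr p) * (ennreal ?\<alpha> * ?X k + (ennreal (2 powr p) * Lp_power p \<Omega> F * ennreal ?\<beta> + c * (ennreal ?\<alpha> * ?X k)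
        + (\<Sum>i\<in>Basis. ennreal ?\<beta> * Lp_power p \<Omega> (dh k i))))"
    proof (intro mult_left_mono add_left_mono)
      have "Lp_power p \<Omega> (h k) = Lp_power p \<Omega> (\<lambda>x. F x + - (F x - h k x))" by simp
      also have "\<dots> \<le> ennreal (2 powr p) * (Lp_power p \<Omega> F + Lp_power p \<Omega> (\<lambda>x. - (F x - h k x)))"
        by (rule Lp_power_add_le[OF open_\<Omega> _ _ p0(2)]) measurable
      also have "Lp_power p \<Omega> (\<lambda>x. - (F x - h k x)) = ?X k"
        by (simp add: Lp_power_def abs_minus_commute)
      finally have "ennreal ?\<beta> * Lp_power p \<Omega> (h k) \<le> ennreal ?\<beta> * (ennreal (2 powr p) * (Lp_power p \<Omega> F + ?X k))"
        by (rule mult_left_mono) simp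
      also have "\<dots> = ennreal (2 powr p) * Lp_power p \<Omega> F * ennreal ?\<beta> + ennreal (2 powr p) * (ennreal ?\<beta> * ?X k)"
        by (simp only: distrib_left mult_ac)
      also have "\<dots> \<le> ennreal (2 powr p) * Lp_power p \<Omega> F * ennreal ?\<beta> + c * (ennreal ?\<alpha> * ?X k)"
      proof (rule add_left_mono)
        have "?\<beta> \<le> ?\<alpha> * T powr p"
          unfolding \<alpha>\<beta>[symmetric] using t[of k] p0 by (intro mult_left_mono powr_mono2) auto
        then have "ennreal (2 powr p) * (ennreal ?\<beta> * ?X k) \<le> ennreal (2 powr p) * (ennreal (?\<alpha> * T powr p) * ?X k)"
          by (intro mult_left_mono mult_right_mono ennreal_leI) auto
        also have "\<dots> = c * (ennreal ?\<alpha> * ?X k)"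
          unfolding c_def by (simp only: ennreal_mult powr_ge_zero mult_ac)
        finally show "ennreal (2 powr p) * (ennreal ?\<beta> * ?X k) \<le> c * (ennreal ?\<alpha> * ?X k)" .
      qed
      finally have "ennreal ?\<beta> * Lp_power p \<Omega> (h k) \<le> ennreal (2 powr p) * Lp_power p \<Omega> F * ennreal ?\<beta> + c * (ennreal ?\<alpha> * ?X k)" .
      then show "ennreal ?\<beta> * (Lp_power p \<Omega> (h k) + (\<Sum>i\<in>Basis. Lp_power p \<Omega> (dh k i)))
        \<le> ennreal (2 powr p) * Lp_power p \<Omega> F * ennreal ?\<beta> + c * (ennreal ?\<alpha> * ?X k) + (\<Sum>i\<in>Basis. ennreal ?\<beta> * Lp_power p \<Omega> (dh k i))"
        unfolding distrib_left sum_distrib_left by (rule add_right_mono)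
    qed simp
    finally show ?thesis .
  qed
  have "(\<Sum>k. ennreal (?t k powr (- s * p) * ?K (?t k) powr p))
    \<le> (\<Sum>k. ennreal (2 powr p) * (ennreal (?t k powr (- s * p)) * ?X k + (ennreal (2 powr p) * Lp_power p \<Omega> F * ennreal (?t k powr (p - s * p))
        + c * (ennreal (?t k powr (- s * p)) * ?X k)
        + (\<Sum>i\<in>Basis. ennreal (?t k powr (p - s * p)) * Lp_power p \<Omega> (dh k i)))))"
    by (intro suminf_le summableI K_le)
  also have "\<dots> = ennreal (2 powr p) * ((\<Sum>k. ennreal (?t k powr (- s * p)) * ?X k)
      + (ennreal (2 powr p) * Lp_power p \<Omega> F * (\<Sum>k. ennreal (?t k powr (p - s * p)))
        + c * (\<Sum>k. ennreal (?t k powr (- s * p)) * ?X k)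
        + (\<Sum>i\<in>Basis. \<Sum>k. ennreal (?t k powr (p - s * p)) * Lp_power p \<Omega> (dh k i))))"
    by (simp only: ennreal_suminf_cmult suminf_add[OF summableI summableI, symmetric] suminf_sum[OF summableI])
  also have "\<dots> < \<infinity>"
  proof -
    have "(\<Sum>k. ennreal (?t k powr (p - s * p))) < \<infinity>"
      using p s by (intro suminf_dyadic_powr_finite T) (simp add: mult_less_cancel_right1)
    then show ?thesis
      using X D F_Lp by (auto simp: ennreal_mult_less_top c_def)
  qed
  finally have fin: "(\<Sum>k. ennreal (?t k powr (- s * p) * ?K (?t k) powr p)) < \<infinity>" .
  note zero = zero_in_W1p[OF open_\<Omega> bounded_\<Omega> p0(1)]
  \<comment> \<open>The trivial decomposition bounds K uniformly in the scale, as required above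
    T.\<close>
  have dec0: "decomposes \<Omega> f f (\<lambda>x. 0)" by (simp add: decomposes_def)
  have "?K l \<le> Lp_norm p \<Omega> f" if "0 < l" for l
    using K_functional_le[OF dec0 f zero(1), of l] that zero(2) by simp
  then have "interpolation_seminorm s p \<Omega> f < \<infinity>"
    by (rule interpolation_seminorm_finite_if_dyadic[OF dec0 f zero(1) p s(1) T _ fin])
  then show ?thesis
    unfolding interpolation_space_def using dec0 f zero(1) by blast
qed

lemma restricted_subset_interpolation:
  fixes \<Omega> :: "'a::euclidean_space set"
  assumes \<Omega>: "uniform_domain \<Omega>" and p: "1 \<le> p" and s: "0 < s" "s < 1"
  shows "restricted_space s p \<Omega> \<subseteq> interpolation_space s p \<Omega>"
proof
  fix f assume f: "f \<in> restricted_space s p \<Omega>"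
  have dom: "bounded_domain \<Omega>" using \<Omega> by (simp add: uniform_domain_def)
  then have op: "open \<Omega>" by (simp add: bounded_domain_def)
  obtain a b where ab: "uniform_with a b \<Omega>" by (rule uniform_domain_imp_uniform_with[OF \<Omega>])
  have fL: "f \<in> Lp_space p \<Omega>" and fin: "restricted_energy s p \<Omega> f < \<infinity>"
    using f by (simp_all add: restricted_space_def restricted_seminorm_finite_iff[unfolded infinity_ennreal_def])
  then have "f \<in> borel_measurable (lebesgue_on \<Omega>)" by (simp add: Lp_space_def)
  from borel_representative[OF op this] obtain F where
    F: "F \<in> borel_measurable borel" "\<And>x. x \<notin> \<Omega> \<Longrightarrow> F x = 0" "AE x in lborel. x \<in> \<Omega> \<longrightarrow> f x = F x" by metis
  interpret smoothing \<Omega> a b p s F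
  proof
    show "Lp_power p \<Omega> F < \<infinity>"
      using fL op by (simp add: Lp_space_iff Lp_power_cong[OF F(3), symmetric])
    show "restricted_energy s p \<Omega> F < \<infinity>"
      using fin by (simp add: restricted_energy_cong[OF F(3)])
  qed (use dom ab p s F in auto)
  show "f \<in> interpolation_space s p \<Omega>"
    by (rule interpolation_memI[OF fL F(3)])
qed

theorem proposition4p2:
  fixes \<Omega> :: "(real ^ 2) set" and s p :: real
  assumes "1 \<le> p" and "0 < s" and "s < 1"
    and "uniform_domain \<Omega>" and "simply_connected \<Omega>"
  shows "interpolation_space s p \<Omega> = restricted_space s p \<Omega>"
  using interpolation_subset_restricted[of \<Omega> p s] restricted_subset_interpolation[of \<Omega> p s] assms
  by (auto simp: uniform_domain_def)

end
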